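(* In the directed FCFS bipartite matching model, assume the stability condition $\lambda_C<\mu_{\mathcal S(C)}$ for every nonempty $C\subseteq\mathcal C$. Then the stationary distributions $\pi_U$, $\pi_W$ of the detailed Markov chains $U(N)$ and $W(N)$ are given by the same expression: for every state $u=(u_1,\dots,u_L)$ of $U$ that is admissible (occurs with positive probability under stationarity), $\pi_U(u)$ equals, and for every admissible state $u=(u_1,\dots,u_L)$ of $W$, $\pi_W(u)$ equals, $$B\left(\frac{\bar\lambda}{\bar\lambda+\bar\mu}\right)^{\#\text{agents}}\left(\frac{\bar\mu}{\bar\lambda+\bar\mu}\right)^{\#\text{goods}}\prod_{c_i\in\mathcal C}\alpha_{c_i}^{\#c_i+\#\tilde c_i}\prod_{s_j\in\mathcal S}\beta_{s_j}^{\#s_j+\#\tilde s_j},$$ where $\#\text{agents}$ is the total number of entries of $u$ of the form $c_i$ or $\tilde c_i$, $\#\text{goods}$ is the total number of entries of the form $s_j$ or $\tilde s_j$, $\#x$ is the number of entries of $u$ equal to the symbol $x$, and the normalizing constant is $$B=\left(\sum_{k=0}^I\ \sum_{C\subseteq\mathcal C,\,|C|=k}\ \sum_{(C_1,\dots,C_k)\in\mathcal P(C)}\ \prod_{\ell=1}^k\frac{\lambda_{C_\ell}}{\mu_{\mathcal S(\{C_1,\dots,C_\ell\})}-\lambda_{\{C_1,\dots,C_\ell\}}}\right)^{-1},$$ with $\mathcal P(C)$ the set of orderings (permutations) of $C$ and the $k=0$ term equal to $1$. (For the empty state the expression equals $B$.)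
   Context: Model. $\mathcal C=\{c_1,\dots,c_I\}$ (agent types) and $\mathcal S=\{s_1,\dots,s_J\}$ (good types) are disjoint finite sets, $\mathcal G\subseteq\mathcal S\times\mathcal C$ is a bipartite compatibility graph, $\bar\lambda,\bar\mu>0$, and $\alpha,\beta$ are probability vectors on $\mathcal C,\mathcal S$. Put $\lambda_{c_i}=\bar\lambda\alpha_{c_i}$, $\mu_{s_j}=\bar\mu\beta_{s_j}$. The sequence $(z^n)_{n\in\mathbb Z}$ is i.i.d. with $P(z^n=c_i)=\lambda_{c_i}/(\bar\lambda+\bar\mu)$, $P(z^n=s_j)=\mu_{s_j}/(\bar\lambda+\bar\mu)$. For $C\subseteq\mathcal C$: $\mathcal S(C)=\{s_j:(s_j,c)\in\mathcal G\text{ for some }c\in C\}$, $\lambda_C=\sum_{c\in C}\lambda_c$; for $S\subseteq\mathcal S$: $\mu_S=\sum_{s\in S}\mu_s$. Directed FCFS matching: each item is matched at most once, and a good $z^n=s_j$ is matched with an agent $z^m=c_i$ if and only if (i) $n>m$; (ii) $(s_j,c_i)\in\mathcal G$; (iii) for every $k<m$ with $z^k=c_{i'}$ and $(s_j,c_{i'})\in\mathcal G$ there is $l<n$ such that $z^l$ is matched with $z^k$. A good with no such match remains unmatched (lost). Under the stability condition there is almost surely a unique directed FCFS matching of $(z^n)_{n\in\mathbb Z}$ in which all agents are matched; the processes below refer to it. Exchange: exchanging a matched pair $z^m=c_i$, $z^n=s_j$ ($m<n$) means writing $\tilde s_j$ in position $m$ and $\tilde c_i$ in position $n$. $X(N)$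 is the list, in order of position, of the types of the agents in positions $\le N$ not matched to goods in positions $\le N$. $U(N)$: perform all matches of goods in positions $\le N$ and exchange the matched pairs. If $X(N)=\emptyset$ then $U(N)=\emptyset$. Otherwise let $\underline N$ be the position of the first agent still unmatched; $U(N)=(u^1,\dots,u^L)$, $L=N-\underline N+1$, records positions $\underline N,\dots,N$: the entry is $c_i$ if the position holds a still unmatched agent of type $c_i$; $\tilde s_j$ if it holds a good $s_j$ that remained unmatched, or if it originally held an agent that has been matched and exchanged with a good of type $s_j$ (in a later position $\le N$); $\tilde c_i$ if it originally held a good that has been matched and exchanged with an earlier agent of type $c_i$. $W(N)$: match and exchange all agents in positions $\le N$ (with goods that may lie in positions $>N$), but no agents in positions $>N$. If $X(N)=\emptyset$ then $W(N)=\emptyset$. Otherwise let $\overline N>N$ be the position of the last matched and exchanged good; $W(N)=(w^1,\dots,w^K)$, $K=\overline N-N$, records positions $N+1,\dots,\overline N$: the entry is $c_i$ for an agent of type $c_i$; $s_j$ for a good of type $s_j$ not matched to an agent in position $\le N$; $\tilde c_i$ for a good that has been matched and exchanged with an agent of type $c_i$ in position $\le N$.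
   Formalization: All-agents-matched FCFS matchings are not unique: the one meant is taken to be that with no unmatched agents at arbitrarily early positions. A good may be matched only to an agent not already matched earlier, as (i)–(iii) alone contradict matching at most once. *)

theory Defs
  imports "HOL-Probability.Probability" "HOL-Combinatorics.Combinatorics"
begin

datatype ('c, 's) item = Agent (agent_type: 'c) | Good (good_type: 's)

(* Symbols in the detailed states: Tilde x stands for the letter x written with a tilde. *)
datatype 'x entry = Plain 'x | Tilde 'x


section \<open>Directed FCFS matchings of a sample path\<close>

text \<open>A matching is a set of pairs \<open>(m, n)\<close>, \<open>m\<close> being the position of the agent and \<open>n\<close> the
  position of the good.\<close>

definition matched_at_most_once :: "(int \<times> int) set \<Rightarrow> bool" where
  "matched_at_most_once Mt \<longleftrightarrow>
     (\<forall>m n n'. (m, n) \<in> Mt \<and> (m, n') \<in> Mt \<longrightarrow> n = n') \<and>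
     (\<forall>m m' n. (m, n) \<in> Mt \<and> (m', n) \<in> Mt \<longrightarrow> m = m')"

(* The last conjunct says that the agent in position m is still available when the good in
   position n arrives; without it the equivalence would contradict matched_at_most_once as soon
   as a second compatible good arrives after an agent that has already been matched. *)
definition directed_FCFS_matching ::
    "('s \<times> 'c) set \<Rightarrow> (int \<Rightarrow> ('c, 's) item) \<Rightarrow> (int \<times> int) set \<Rightarrow> bool" where
  "directed_FCFS_matching G w Mt \<longleftrightarrow>
     matched_at_most_once Mt \<and>
     (\<forall>m n. (m, n) \<in> Mt \<longleftrightarrow>
        (\<exists>c s. w m = Agent c \<and> w n = Good s \<and>
           m < n \<and> (s, c) \<in> G \<and>
           (\<forall>k c'. k < m \<and> w k = Agent c' \<and> (s, c') \<in> G \<longrightarrow> (\<exists>l<n. (k, l) \<in> Mt)) \<and>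
           (\<forall>l<n. (m, l) \<notin> Mt)))"

definition all_agents_matched :: "(int \<Rightarrow> ('c, 's) item) \<Rightarrow> (int \<times> int) set \<Rightarrow> bool" where
  "all_agents_matched w Mt \<longleftrightarrow> (\<forall>m c. w m = Agent c \<longrightarrow> (\<exists>n. (m, n) \<in> Mt))"

definition unmatched_agents :: "(int \<Rightarrow> ('c, 's) item) \<Rightarrow> (int \<times> int) set \<Rightarrow> int \<Rightarrow> int set" where
  "unmatched_agents w Mt N = {m. m \<le> N \<and> (\<exists>c. w m = Agent c) \<and> \<not> (\<exists>n\<le>N. (m, n) \<in> Mt)}"

(* A sample path can have many directed FCFS matchings that match all agents: with one agent type
   and one good type, shifting the k-th agent by d goods far in the past gives one for every large
   d, with a backlog of unmatched agents that grows linearly towards minus infinity.  The matching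
   meant is the one in which the backlog does not come from minus infinity, i.e. is empty at
   arbitrarily early positions.  There is at most one such matching, since a matching with empty
   backlog at some position has, from there on, a backlog contained in that of any other matching. *)
definition no_backlog_from_infinity :: "(int \<Rightarrow> ('c, 's) item) \<Rightarrow> (int \<times> int) set \<Rightarrow> bool" where
  "no_backlog_from_infinity w Mt \<longleftrightarrow> (\<forall>N. \<exists>N'\<le>N. unmatched_agents w Mt N' = {})"

definition the_matching :: "('s \<times> 'c) set \<Rightarrow> (int \<Rightarrow> ('c, 's) item) \<Rightarrow> (int \<times> int) set" where
  "the_matching G w =
     (THE Mt. directed_FCFS_matching G w Mt \<and> all_agents_matched w Mt \<and>
              no_backlog_from_infinity w Mt)"


section \<open>The processes X, U and W along a sample path\<close>

definition X_list :: "(int \<Rightarrow> ('c, 's) item) \<Rightarrow> (int \<times> int) set \<Rightarrow> int \<Rightarrow> 'c list" where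
  "X_list w Mt N = map (\<lambda>m. agent_type (w m)) (sorted_list_of_set (unmatched_agents w Mt N))"

(* THE n and THE m below pick the partner of position p. *)
definition U_entry ::
    "(int \<Rightarrow> ('c, 's) item) \<Rightarrow> (int \<times> int) set \<Rightarrow> int \<Rightarrow> int \<Rightarrow> ('c, 's) item entry" where
  "U_entry w Mt N p =
     (case w p of
        Agent c \<Rightarrow> (if \<exists>n\<le>N. (p, n) \<in> Mt then Tilde (w (THE n. (p, n) \<in> Mt)) else Plain (Agent c))
      | Good s \<Rightarrow> (if \<exists>m. (m, p) \<in> Mt then Tilde (w (THE m. (m, p) \<in> Mt)) else Tilde (Good s)))"

definition U_path ::
    "(int \<Rightarrow> ('c, 's) item) \<Rightarrow> (int \<times> int) set \<Rightarrow> int \<Rightarrow> ('c, 's) item entry list" where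
  "U_path w Mt N =
     (if X_list w Mt N = [] then []
      else map (U_entry w Mt N) [Min (unmatched_agents w Mt N)..N])"

definition W_entry ::
    "(int \<Rightarrow> ('c, 's) item) \<Rightarrow> (int \<times> int) set \<Rightarrow> int \<Rightarrow> int \<Rightarrow> ('c, 's) item entry" where
  "W_entry w Mt N p =
     (case w p of
        Agent c \<Rightarrow> Plain (Agent c)
      | Good s \<Rightarrow> (if \<exists>m\<le>N. (m, p) \<in> Mt then Tilde (w (THE m. (m, p) \<in> Mt)) else Plain (Good s)))"

(* Only goods beyond N are considered in the maximum, since the set of all goods matched to agents
   in positions up to N is unbounded below and Max is meaningful for finite sets only. *)
definition W_path ::
    "(int \<Rightarrow> ('c, 's) item) \<Rightarrow> (int \<times> int) set \<Rightarrow> int \<Rightarrow> ('c, 's) item entry list" where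
  "W_path w Mt N =
     (if X_list w Mt N = [] then []
      else map (W_entry w Mt N) [N + 1..Max {n. N < n \<and> (\<exists>m\<le>N. (m, n) \<in> Mt)}])"

definition U_process ::
    "('s \<times> 'c) set \<Rightarrow> (int \<Rightarrow> 'a \<Rightarrow> ('c, 's) item) \<Rightarrow> int \<Rightarrow> 'a \<Rightarrow> ('c, 's) item entry list" where
  "U_process G z N \<omega> = (let w = (\<lambda>n. z n \<omega>) in U_path w (the_matching G w) N)"

definition W_process ::
    "('s \<times> 'c) set \<Rightarrow> (int \<Rightarrow> 'a \<Rightarrow> ('c, 's) item) \<Rightarrow> int \<Rightarrow> 'a \<Rightarrow> ('c, 's) item entry list" where
  "W_process G z N \<omega> = (let w = (\<lambda>n. z n \<omega>) in W_path w (the_matching G w) N)"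


section \<open>Markov chains indexed by the integers\<close>

text \<open>The processes above are specified only outside a null set, so probabilities are taken in
  the completion of the underlying space.\<close>

definition markov_chain :: "'a measure \<Rightarrow> (int \<Rightarrow> 'a \<Rightarrow> 'b) \<Rightarrow> ('b \<Rightarrow> 'b pmf) \<Rightarrow> bool" where
  "markov_chain M Y K \<longleftrightarrow>
     (\<forall>N. Y N \<in> measurable (completion M) (count_space UNIV)) \<and>
     (\<forall>N (xs :: 'b list) x y.
        measure (completion M)
          {\<omega> \<in> space M. (\<forall>i<length xs. Y (N - int (length xs) + int i) \<omega> = xs ! i) \<and>
                        Y N \<omega> = x \<and> Y (N + 1) \<omega> = y} =
        measure (completion M)
          {\<omega> \<in> space M. (\<forall>i<length xs. Y (N - int (length xs) + int i) \<omega> = xs ! i) \<and>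
                        Y N \<omega> = x} * pmf (K x) y)"

text \<open>\<open>\<pi>\<close> is the stationary distribution of the chain \<open>Y\<close>, which runs in its stationary regime.\<close>

definition stationary_distribution_of_chain ::
    "'a measure \<Rightarrow> (int \<Rightarrow> 'a \<Rightarrow> 'b) \<Rightarrow> 'b pmf \<Rightarrow> bool" where
  "stationary_distribution_of_chain M Y \<pi> \<longleftrightarrow>
     (\<exists>K. markov_chain M Y K \<and> bind_pmf \<pi> K = \<pi> \<and>
        (\<forall>N x. measure (completion M) {\<omega> \<in> space M. Y N \<omega> = x} = pmf \<pi> x))"


section \<open>The product form\<close>

definition compatible_goods :: "('s \<times> 'c) set \<Rightarrow> 'c set \<Rightarrow> 's set" where
  "compatible_goods G C = {s. \<exists>c\<in>C. (s, c) \<in> G}"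

(* lb and mb are the total rates of agents and goods. *)
definition agent_rate :: "real \<Rightarrow> ('c \<Rightarrow> real) \<Rightarrow> 'c set \<Rightarrow> real" where
  "agent_rate lb \<alpha> C = (\<Sum>c\<in>C. lb * \<alpha> c)"

definition good_rate :: "real \<Rightarrow> ('s \<Rightarrow> real) \<Rightarrow> 's set \<Rightarrow> real" where
  "good_rate mb \<beta> S = (\<Sum>s\<in>S. mb * \<beta> s)"

definition normalizing_constant ::
    "('s \<times> 'c::finite) set \<Rightarrow> real \<Rightarrow> real \<Rightarrow> ('c \<Rightarrow> real) \<Rightarrow> ('s::finite \<Rightarrow> real) \<Rightarrow> real" where
  "normalizing_constant G lb mb \<alpha> \<beta> =
     inverse (\<Sum>k = 0..CARD('c). \<Sum>C\<in>{C. card C = k}. \<Sum>p\<in>permutations_of_set C.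
       \<Prod>l = 1..k. agent_rate lb \<alpha> {p ! (l - 1)} /
         (good_rate mb \<beta> (compatible_goods G (set (take l p))) - agent_rate lb \<alpha> (set (take l p))))"

(* number of entries equal to the letter x, with or without a tilde *)
definition letter_count :: "'x entry list \<Rightarrow> 'x \<Rightarrow> nat" where
  "letter_count u x = count_list u (Plain x) + count_list u (Tilde x)"

definition num_agents :: "('c, 's) item entry list \<Rightarrow> nat" where
  "num_agents u = length (filter (\<lambda>e. \<exists>c. e = Plain (Agent c) \<or> e = Tilde (Agent c)) u)"

definition num_goods :: "('c, 's) item entry list \<Rightarrow> nat" where
  "num_goods u = length (filter (\<lambda>e. \<exists>s. e = Plain (Good s) \<or> e = Tilde (Good s)) u)"

definition product_form ::
    "('s \<times> 'c::finite) set \<Rightarrow> real \<Rightarrow> real \<Rightarrow> ('c \<Rightarrow> real) \<Rightarrow> ('s::finite \<Rightarrow> real) \<Rightarrow>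
     ('c, 's) item entry list \<Rightarrow> real" where
  "product_form G lb mb \<alpha> \<beta> u =
     normalizing_constant G lb mb \<alpha> \<beta> *
     (lb / (lb + mb)) ^ num_agents u * (mb / (lb + mb)) ^ num_goods u *
     (\<Prod>c\<in>UNIV. \<alpha> c ^ letter_count u (Agent c)) *
     (\<Prod>s\<in>UNIV. \<beta> s ^ letter_count u (Good s))"

end

(*
Read the items one by one. The exchanged state U is then a Markov chain driven by the i.i.d. items,
and the product weight, restricted to the states in which no lost good is preceded by a compatible
waiting agent, solves its balance equations: an admissible state that ends with a matched pair has,
up to a geometric series over the truncated entries, exactly one predecessor. Splitting a state at
the first occurrences of its waiting types evaluates the total weight and gives B.

The queue started from the empty list is dominated by the queue started from any other list, so it
is empty at a given time with probability at least B, however early it starts. Hence, by the 0-1 law,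
the queues started at all earlier times are almost surely empty together at arbitrarily early times,
and by shift invariance also at arbitrarily late times. On such paths the matching exists and is
unique, and U at time N is the chain started from the empty state at such a time. Its law is
invariant, hence equal to the product form, because the empty state is reachable from every state.

W is a function of the queue at N, which has weight prod lambda(c_i) / mu(S(c_1, ..., c_i)), and of
the independent later items. Removing the matched agents one by one, the sum over all queues that
produce a given W-state collapses by a telescoping (order independence) identity.
*)

theory Submission
  imports Defs "HOL-Library.Sublist"
begin

section \<open>Dynamics of the states\<close>

text \<open>The processes are defined through a matching of the whole path, whose existence is part
  of what has to be shown. The product form is therefore obtained as an invariant law of the
  one-sided dynamics \<open>U_step\<close>, before any bi-infinite matching is available. Stability
  enters through the positivity of \<open>mass_goods D\<close> and of
  \<open>mass_goods D - mass_agents D\<close>, which make geometric series over free words converge;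
  there is no drift argument. Recurrence of the empty state comes out of the summable invariant
  weight, since B, that is \<open>1 / total_weight\<close>, is its normalized mass at the empty
  state. For W the obstacle is that its state looks into the future. The state \<open>x\<close> at
  time \<open>N\<close> is settled by the items up to \<open>N + length x\<close>, and once it is
  known so are all earlier states; the items beyond are still independent and drive the next step.
  Cutting the path there, not at \<open>N\<close>, gives the Markov property.\<close>

lemma split_list_first_unique:
  "v @ x # u = v' @ x # u' \<Longrightarrow> x \<notin> set v \<Longrightarrow> x \<notin> set v' \<Longrightarrow> v = v' \<and> u = u'"
proof (induction v arbitrary: v')
  case Nil
  then show ?case by (cases v') auto
next
  case (Cons a v)
  then show ?case by (cases v') auto
qed

lemma split_list_last_unique:
  assumes "a @ x # b = a' @ x' # b'" "Q x" "Q x'" "\<forall>e\<in>set b. \<not> Q e" "\<forall>e\<in>set b'. \<not> Q e"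
  shows "a = a' \<and> x = x' \<and> b = b'"
  using assms(1)
proof (induction a arbitrary: a')
  case Nil
  then show ?case using assms(2-5) by (cases a') auto
next
  case (Cons y a)
  then show ?case using assms(2-5) by (cases a') auto
qed

lemma sorted_wrt_less_distinct: "sorted_wrt (<) (xs :: int list) \<Longrightarrow> distinct xs"
  by (simp add: strict_sorted_iff)

lemma less_eq_add1: "(l::int) \<le> n + 1 \<longleftrightarrow> l \<le> n \<or> l = n + 1"
  by auto

lemma find_Some_sorted:
  fixes zs :: "'a::linorder list"
  assumes "sorted_wrt (<) zs"
  shows "find R zs = Some m \<longleftrightarrow> m \<in> set zs \<and> R m \<and> (\<forall>k. k \<in> set zs \<and> R k \<longrightarrow> m \<le> k)"
  using assms
proof (induction zs)
  case (Cons a zs)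
  then show ?case
    by (cases "R a"; cases "m = a") (auto dest: less_imp_le leD)
qed simp

text \<open>Compares the search through all positions of an exchanged state with the search through
  the backlog, which lists the waiting positions only.\<close>

lemma find_cong_sorted:
  fixes xs ys :: "'a::linorder list"
  assumes "sorted_wrt (<) xs" "sorted_wrt (<) ys" "\<And>x. x \<in> set xs \<and> P x \<longleftrightarrow> x \<in> set ys \<and> Q x"
  shows "find P xs = find Q ys"
proof -
  have "find P xs = Some m \<longleftrightarrow> find Q ys = Some m" for m
    unfolding find_Some_sorted[OF assms(1)] find_Some_sorted[OF assms(2)] using assms(3) by auto
  then show ?thesis
    by (metis option.exhaust)
qed

lemma find_map: "find P (map f xs) = map_option f (find (\<lambda>x. P (f x)) xs)"
  by (induction xs) auto

lemma find_append: "find P (xs @ ys) = (case find P xs of None \<Rightarrow> find P ys | Some x \<Rightarrow> Some x)"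
  by (induction xs) auto

section \<open>Removal and replacement of the first match in a list\<close>

primrec remove_first :: "('a \<Rightarrow> bool) \<Rightarrow> 'a list \<Rightarrow> 'a list" where
  "remove_first P [] = []"
| "remove_first P (x # xs) = (if P x then xs else x # remove_first P xs)"

primrec replace_first :: "('a \<Rightarrow> bool) \<Rightarrow> 'a \<Rightarrow> 'a list \<Rightarrow> 'a list" where
  "replace_first P y [] = []"
| "replace_first P y (x # xs) = (if P x then y # xs else x # replace_first P y xs)"

lemma remove_first_map: "remove_first P (map f xs) = map f (remove_first (\<lambda>x. P (f x)) xs)"
  by (induction xs) auto

lemma remove_first_append:
  "remove_first P (xs @ ys) = (if find P xs = None then xs @ remove_first P ys else remove_first P xs @ ys)"
  by (induction xs) auto

lemma replace_first_append:
  "replace_first P y (xs @ ys) =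
     (if find P xs = None then xs @ replace_first P y ys else replace_first P y xs @ ys)"
  by (induction xs) auto

lemma remove_first_None: "find P xs = None \<Longrightarrow> remove_first P xs = xs"
  by (induction xs) (auto split: if_splits)

lemma set_remove_first_subset: "set (remove_first P xs) \<subseteq> set xs"
  by (induction xs) auto

lemma sorted_remove_first: "sorted_wrt R xs \<Longrightarrow> sorted_wrt R (remove_first P xs)"
  using set_remove_first_subset[of P] by (induction xs) auto

lemma upto_append: "j \<le> k \<Longrightarrow> k \<le> n \<Longrightarrow> [j + 1..n] = [j + 1..k] @ [k + 1..n]"
  using upto_split2[of "j + 1" k n] by (cases "j = k") auto

lemma subseq_remove_first_self: "subseq (remove_first P xs) xs"
  by (induction xs) auto

text \<open>If the longer list loses an element that the shorter one does not use, the shorter list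
  still embeds, and its own removal only shortens it.\<close>

lemma subseq_remove_first: "subseq xs ys \<Longrightarrow> subseq (remove_first P xs) (remove_first P ys)"
proof (induction rule: list_emb.induct)
  case (list_emb_Cons xs ys y)
  then show ?case
    using subseq_remove_first_self[of P xs] subseq_order.trans by auto
qed auto

lemma set_remove_first:
  "distinct xs \<Longrightarrow> set (remove_first P xs) = set xs - {x. find P xs = Some x}"
  by (induction xs) (auto simp: find_Some_iff)

lemma length_remove_first: "find P xs = Some x \<Longrightarrow> length xs = Suc (length (remove_first P xs))"
  by (induction xs) (auto split: if_splits)

lemma replace_first_map:
  assumes "distinct ps" "find (\<lambda>p. P (f p)) ps = Some m"
  shows "replace_first P y (map f ps) = map (f(m := y)) ps"
  using assms
proof (induction ps)
  case (Cons p ps)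
  then show ?case
    by (auto simp: find_Some_iff intro!: map_cong split: if_splits)
qed simp

lemma find_Some_split:
  assumes "find P xs = Some x"
  obtains as bs where "xs = as @ x # bs" "P x" "\<forall>a\<in>set as. \<not> P a"
proof -
  from assms have "\<exists>as bs. xs = as @ x # bs \<and> P x \<and> (\<forall>a\<in>set as. \<not> P a)"
  proof (induction xs)
    case (Cons a xs)
    show ?case
    proof (cases "P a")
      case True
      with Cons.prems show ?thesis by (intro exI[of _ "[]"] exI[of _ xs]) auto
    next
      case False
      with Cons obtain as bs where "xs = as @ x # bs" "P x" "\<forall>a\<in>set as. \<not> P a" by auto
      with False show ?thesis by (intro exI[of _ "a # as"] exI[of _ bs]) auto
    qed
  qed simp
  then show thesis using that by blast
qed

lemma find_append_Cons:
  assumes "\<forall>a\<in>set as. \<not> P a" "P x"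
  shows "find P (as @ x # bs) = Some x" "remove_first P (as @ x # bs) = as @ bs"
    "replace_first P y (as @ x # bs) = as @ y # bs"
  using assms by (induction as) auto

section \<open>Entries of the detailed states and the two ways of cutting a state\<close>

fun tilde :: "'x entry \<Rightarrow> 'x entry" where
  "tilde (Plain x) = Tilde x"
| "tilde (Tilde x) = Tilde x"

fun is_tilde :: "'x entry \<Rightarrow> bool" where
  "is_tilde (Plain x) = False"
| "is_tilde (Tilde x) = True"

fun letter :: "'x entry \<Rightarrow> 'x" where
  "letter (Plain x) = x"
| "letter (Tilde x) = x"

fun is_waiting :: "('c, 's) item entry \<Rightarrow> bool" where
  "is_waiting (Plain (Agent c)) = True"
| "is_waiting _ = False"

text \<open>The cut at the first unmatched position. A state without waiting agents becomes the
  empty list, as the definition of U demands.\<close>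

definition trim :: "('c, 's) item entry list \<Rightarrow> ('c, 's) item entry list" where
  "trim u = dropWhile (\<lambda>e. \<not> is_waiting e) u"

fun waiting :: "('c, 's) item entry list \<Rightarrow> 'c list" where
  "waiting [] = []"
| "waiting (Plain (Agent c) # u) = c # waiting u"
| "waiting (Plain (Good s) # u) = waiting u"
| "waiting (Tilde x # u) = waiting u"

text \<open>The cut for W-states, at the other end: there the tildes are the goods exchanged with
  agents of the queue, and the state ends with the last of them.\<close>

definition strip :: "'x entry list \<Rightarrow> 'x entry list" where
  "strip u = rev (dropWhile (\<lambda>e. \<not> is_tilde e) (rev u))"

lemma waiting_append: "waiting (u @ v) = waiting u @ waiting v"
  by (induction u rule: waiting.induct) auto

lemma waiting_trim: "waiting (trim u) = waiting u"
  unfolding trim_def by (induction u rule: waiting.induct) auto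

lemma waiting_eq_Nil: "waiting u = [] \<longleftrightarrow> (\<forall>e\<in>set u. \<not> is_waiting e)"
  by (induction u rule: waiting.induct) auto

lemma trim_eq_Nil: "trim u = [] \<longleftrightarrow> waiting u = []"
  unfolding trim_def waiting_eq_Nil by (simp add: dropWhile_eq_Nil_conv)

lemma trim_append: "trim (a @ b) = (if waiting a = [] then trim b else trim a @ b)"
proof (cases "waiting a = []")
  case True
  then show ?thesis unfolding trim_def waiting_eq_Nil by (simp add: dropWhile_append2)
next
  case False
  then obtain e where "e \<in> set a" "is_waiting e" unfolding waiting_eq_Nil by auto
  with False show ?thesis unfolding trim_def by (simp add: dropWhile_append1)
qed

lemma trim_trim [simp]: "trim (trim u) = trim u"
  unfolding trim_def by simp

lemma trim_split: obtains a where "u = a @ trim u" "waiting a = []"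
proof
  show "u = takeWhile (\<lambda>e. \<not> is_waiting e) u @ trim u"
    unfolding trim_def by simp
  show "waiting (takeWhile (\<lambda>e. \<not> is_waiting e) u) = []"
    unfolding waiting_eq_Nil by (auto dest: set_takeWhileD)
qed

lemma strip_append_Plain: "strip (u @ map Plain v) = strip u"
  unfolding strip_def by (induction v rule: rev_induct) auto

lemma strip_split: obtains v where "u = strip u @ map Plain v"
proof -
  let ?t = "takeWhile (\<lambda>e. \<not> is_tilde e) (rev u)"
  have "rev u = ?t @ dropWhile (\<lambda>e. \<not> is_tilde e) (rev u)" by simp
  then have *: "u = strip u @ rev ?t" unfolding strip_def by (metis rev_append rev_rev_ident)
  have "\<forall>e\<in>set ?t. \<not> is_tilde e" by (auto dest: set_takeWhileD)
  then have "rev ?t = map Plain (map letter (rev ?t))"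
  proof -
    assume a: "\<forall>e\<in>set ?t. \<not> is_tilde e"
    have "map Plain (map letter xs) = xs" if "\<forall>e\<in>set xs. \<not> is_tilde e" for xs :: "'a entry list"
      using that
    proof (induction xs)
      case (Cons e xs) then show ?case by (cases e) auto
    qed simp
    from this[of "rev ?t"] a show ?thesis by simp
  qed
  with * show thesis using that by metis
qed

lemma strip_eq_self: "u = [] \<or> is_tilde (last u) \<Longrightarrow> strip u = u"
  unfolding strip_def by (cases u rule: rev_cases) auto

lemma strip_last: "strip u = [] \<or> is_tilde (last (strip u))"
  unfolding strip_def
  by (metis (no_types, lifting) hd_dropWhile last_rev rev_is_Nil_conv)

lemma strip_Nil [simp]: "strip [] = []" by (simp add: strip_def)

context
  fixes G :: "('s \<times> 'c) set"
begin

section \<open>Effect of one item on the queue and on the exchanged state\<close>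

fun queue_step :: "'c list \<Rightarrow> ('c, 's) item \<Rightarrow> 'c list" where
  "queue_step x (Agent c) = x @ [c]"
| "queue_step x (Good s) = remove_first (\<lambda>c. (s, c) \<in> G) x"

definition available :: "'s \<Rightarrow> ('c, 's) item entry \<Rightarrow> bool" where
  "available s e \<longleftrightarrow> (\<exists>c. e = Plain (Agent c) \<and> (s, c) \<in> G)"

fun exchange_step :: "('c, 's) item entry list \<Rightarrow> ('c, 's) item \<Rightarrow> ('c, 's) item entry list" where
  "exchange_step u (Agent c) = u @ [Plain (Agent c)]"
| "exchange_step u (Good s) =
     (case find (available s) u of
        None \<Rightarrow> u @ [Tilde (Good s)]
      | Some e \<Rightarrow> replace_first (available s) (Tilde (Good s)) u @ [tilde e])"

definition U_step :: "('c, 's) item entry list \<Rightarrow> ('c, 's) item \<Rightarrow> ('c, 's) item entry list" where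
  "U_step u i = trim (exchange_step u i)"

lemma find_available:
  "find (available s) u = map_option (\<lambda>c. Plain (Agent c)) (find (\<lambda>c. (s, c) \<in> G) (waiting u))"
  by (induction u rule: waiting.induct) (auto simp: available_def)

lemma waiting_replace_first:
  "waiting (replace_first (available s) (Tilde x) u) = remove_first (\<lambda>c. (s, c) \<in> G) (waiting u)"
  by (induction u rule: waiting.induct) (auto simp: available_def)

lemma waiting_exchange_step: "waiting (exchange_step u i) = queue_step (waiting u) i"
  by (cases i) (auto simp: waiting_append waiting_replace_first find_available remove_first_None
      split: option.splits)

lemma waiting_U_step: "waiting (U_step u i) = queue_step (waiting u) i"
  unfolding U_step_def by (simp add: waiting_trim waiting_exchange_step)

lemma waiting_foldl_U_step: "waiting (foldl U_step u zs) = foldl queue_step (waiting u) zs"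
  by (induction zs rule: rev_induct) (auto simp: waiting_U_step)

lemma exchange_step_append:
  assumes "waiting a = []"
  shows "exchange_step (a @ u) i = a @ exchange_step u i"
  using assms by (cases i) (auto simp: find_append find_available replace_first_append waiting_append
      split: option.splits)

text \<open>Entries in front of the first waiting agent are never touched again, so trimming after
  every step agrees with trimming once at the end.\<close>

lemma trim_exchange_step: "trim (exchange_step (trim u) i) = trim (exchange_step u i)"
proof -
  obtain a where a: "u = a @ trim u" "waiting a = []" by (rule trim_split)
  have "trim (exchange_step u i) = trim (a @ exchange_step (trim u) i)"
    using exchange_step_append[OF a(2)] a(1) by metis
  with a(2) show ?thesis by (simp add: trim_append)
qed

lemma foldl_U_step: "foldl U_step [] zs = trim (foldl exchange_step [] zs)"
  by (induction zs rule: rev_induct) (auto simp: U_step_def trim_exchange_step trim_def[of "[]"])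

text \<open>Domination of queues has to respect the order. Inclusion of the contents alone is not
  preserved: a good compatible with \<open>a\<close> and \<open>b\<close> turns
  \<open>[a, b]\<close> into \<open>[b]\<close> but \<open>[b, a]\<close> into
  \<open>[a]\<close>.\<close>

lemma subseq_queue_step: "subseq x y \<Longrightarrow> subseq (queue_step x i) (queue_step y i)"
  by (cases i) (auto simp: subseq_remove_first)

lemma subseq_foldl_queue_step: "subseq x y \<Longrightarrow> subseq (foldl queue_step x zs) (foldl queue_step y zs)"
  by (induction zs rule: rev_induct) (auto simp: subseq_queue_step)

text \<open>\<open>serve\<close> and \<open>left_over\<close> ignore the arriving agents: only those in the list \<open>x\<close> are matched.\<close>

primrec serve :: "'c list \<Rightarrow> ('c, 's) item list \<Rightarrow> ('c, 's) item entry list" where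
  "serve x [] = []"
| "serve x (i # zs) =
     (case i of
        Agent c \<Rightarrow> Plain i # serve x zs
      | Good s \<Rightarrow>
          (case find (\<lambda>c. (s, c) \<in> G) x of
             None \<Rightarrow> Plain i # serve x zs
           | Some c \<Rightarrow> Tilde (Agent c) # serve (remove_first (\<lambda>c. (s, c) \<in> G) x) zs))"

primrec left_over :: "'c list \<Rightarrow> ('c, 's) item list \<Rightarrow> 'c list" where
  "left_over x [] = x"
| "left_over x (i # zs) =
     (case i of
        Agent c \<Rightarrow> left_over x zs
      | Good s \<Rightarrow> left_over (remove_first (\<lambda>c. (s, c) \<in> G) x) zs)"

lemma length_serve [simp]: "length (serve x zs) = length zs"
  by (induction zs arbitrary: x) (auto split: item.splits option.splits)

lemma serve_append: "serve x (zs @ zs') = serve x zs @ serve (left_over x zs) zs'"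
  by (induction zs arbitrary: x) (auto simp: remove_first_None split: item.splits option.splits)

lemma left_over_append: "left_over x (zs @ zs') = left_over (left_over x zs) zs'"
  by (induction zs arbitrary: x) (auto split: item.splits)

lemma serve_Nil [simp]: "serve [] zs = map Plain zs"
  by (induction zs) (auto split: item.splits)

lemma left_over_Nil [simp]: "left_over [] zs = []"
  by (induction zs) (auto split: item.splits)

lemma left_over_serve_Plain:
  "serve x zs = map Plain v \<Longrightarrow> left_over x zs = x"
proof (induction zs arbitrary: x v)
  case (Cons i zs)
  then show ?case by (cases v) (auto simp: remove_first_None split: item.splits option.splits)
qed simp

text \<open>Each tilde marks one served agent. When nobody is left over, the number of tildes is the
  length of the queue behind the state, which leaves finitely many candidates for that
  queue.\<close>

lemma length_left_over:
  "length x = length (left_over x zs) + length (filter is_tilde (serve x zs))"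
proof (induction zs arbitrary: x)
  case (Cons i zs)
  show ?case
    using Cons[of x] Cons[of "remove_first (\<lambda>c. (good_type i, c) \<in> G) x"]
      length_remove_first[of "\<lambda>c. (good_type i, c) \<in> G" x]
    by (auto simp: remove_first_None split: item.splits option.splits)
qed simp

definition mark :: "'c \<Rightarrow> ('c, 's) item entry list \<Rightarrow> ('c, 's) item entry list" where
  "mark c F = replace_first (\<lambda>e. \<exists>s. e = Plain (Good s) \<and> (s, c) \<in> G) (Tilde (Agent c)) F"

text \<open>An agent with the lowest priority takes the first compatible good that the others leave.\<close>

lemma serve_snoc: "serve (x @ [c]) zs = mark c (serve x zs)"
  by (induction zs arbitrary: x)
    (auto simp: mark_def find_append remove_first_append remove_first_None split: item.splits option.splits)

lemma subseq_left_over: "subseq x y \<Longrightarrow> subseq (left_over x zs) (left_over y zs)"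
  by (induction zs arbitrary: x y) (auto simp: subseq_remove_first split: item.splits)

text \<open>The evolution of a complete (untrimmed) \<open>W\<close>-state when the observation point moves by one.\<close>

fun advance :: "('c, 's) item entry list \<Rightarrow> ('c, 's) item entry list" where
  "advance [] = []"
| "advance (Plain (Agent c) # F) = mark c F"
| "advance (_ # F) = F"

lemma advance_serve: "advance (serve x (i # zs)) = serve (queue_step x i) zs"
  by (cases i) (auto simp: serve_snoc remove_first_None split: option.splits)

text \<open>An arriving agent can only enlarge what is left over, and for a good both sides are the
  same computation. Hence a window that is long enough for the next observation point is long enough
  for the present one.\<close>

lemma left_over_queue_step:
  assumes "left_over (queue_step x i) zs = []"
  shows "left_over x (i # zs) = []"
proof (cases i)
  case (Agent c)
  have "subseq (left_over x zs) (left_over (x @ [c]) zs)"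
    by (rule subseq_left_over) (induction x; simp)
  with assms Agent show ?thesis by simp
qed (use assms in simp)

text \<open>The window \<open>zs\<close> is exactly the extent of the W-state \<open>u\<close>: it
  serves the whole queue, and its last item serves somebody.\<close>

definition finishes :: "'c list \<Rightarrow> ('c, 's) item list \<Rightarrow> ('c, 's) item entry list \<Rightarrow> bool" where
  "finishes x zs u \<longleftrightarrow> serve x zs = u \<and> left_over x zs = [] \<and> (u = [] \<or> is_tilde (last u))"

lemma strip_serve_append:
  "left_over x zs = [] \<Longrightarrow> strip (serve x (zs @ zs')) = strip (serve x zs)"
  by (simp add: serve_append strip_append_Plain)

text \<open>What \<open>strip\<close> cuts off carries no tilde and so serves nobody; everybody was
  already served before it. The event that a W-state equals \<open>u\<close> thus concerns only
  \<open>length u\<close> later items besides the queue.\<close>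

lemma strip_serve_eq_iff:
  assumes "left_over x (zs @ zs') = []" "length zs = length u"
  shows "strip (serve x (zs @ zs')) = u \<longleftrightarrow> finishes x zs u"
proof
  assume eq: "strip (serve x (zs @ zs')) = u"
  obtain v where v: "serve x (zs @ zs') = u @ map Plain v"
    using strip_split eq by metis
  then have s: "serve x zs = u" and s': "serve (left_over x zs) zs' = map Plain v"
    using assms(2) by (auto simp: serve_append)
  have "left_over x zs = left_over (left_over x zs) zs'"
    using left_over_serve_Plain[OF s'] by simp
  with assms(1) have "left_over x zs = []" by (simp add: left_over_append)
  with s strip_last[of "serve x (zs @ zs')"] eq show "finishes x zs u"
    unfolding finishes_def by simp
next
  assume "finishes x zs u"
  then show "strip (serve x (zs @ zs')) = u"
    unfolding finishes_def by (simp add: strip_serve_append strip_eq_self)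
qed

end

section \<open>The matching of a sample path\<close>

context
  fixes G :: "('s \<times> 'c) set" and w :: "int \<Rightarrow> ('c, 's) item"
begin

section \<open>Backlogs started from an empty queue\<close>

fun position_step :: "int list \<Rightarrow> int \<Rightarrow> int list" where
  "position_step q n =
     (case w n of
        Agent c \<Rightarrow> q @ [n]
      | Good s \<Rightarrow> remove_first (\<lambda>m. (s, agent_type (w m)) \<in> G) q)"

text \<open>The queue is kept as a list of positions rather than types, so that matched pairs can be
  read off from it.\<close>

definition backlog :: "int \<Rightarrow> int \<Rightarrow> int list" where
  "backlog k n = foldl position_step [] [k + 1..n]"

text \<open>A renewal point: all queues started empty before \<open>k\<close> are empty at
  \<open>k\<close> together, so from \<open>k\<close> on they coincide. The event depends on the
  items up to \<open>k\<close> only.\<close>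

definition empties :: "int \<Rightarrow> bool" where
  "empties k \<longleftrightarrow> (\<forall>j\<le>k. foldl (queue_step G) [] (map w [j + 1..k]) = [])"

lemma backlog_self [simp]: "backlog k k = []"
  by (simp add: backlog_def)

lemma backlog_step: "k < n \<Longrightarrow> backlog k n = position_step (backlog k (n - 1)) n"
  unfolding backlog_def by (subst upto_rec2) auto

lemma map_backlog: "map (\<lambda>m. agent_type (w m)) (backlog k n) = foldl (queue_step G) [] (map w [k + 1..n])"
proof -
  have "map (\<lambda>m. agent_type (w m)) (foldl position_step q ps) =
      foldl (queue_step G) (map (\<lambda>m. agent_type (w m)) q) (map w ps)" for q ps
    by (induction ps arbitrary: q) (auto simp: remove_first_map split: item.splits)
  from this[of "[]"] show ?thesis by (simp add: backlog_def)
qed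

lemma empties_iff: "empties k \<longleftrightarrow> (\<forall>j\<le>k. backlog j k = [])"
  unfolding empties_def map_backlog[symmetric] by simp

lemma backlog_restart:
  assumes "j \<le> k" "k \<le> n" "backlog j k = []"
  shows "backlog j n = backlog k n"
proof -
  have "[j + 1..n] = [j + 1..k] @ [k + 1..n]"
    using assms(1,2) by (rule upto_append)
  with assms(3) show ?thesis by (simp add: backlog_def)
qed

lemma backlog_props:
  assumes "k \<le> n"
  shows "sorted_wrt (<) (backlog k n)" "set (backlog k n) \<subseteq> {k<..n}" "\<forall>m\<in>set (backlog k n). \<exists>c. w m = Agent c"
proof -
  have "sorted_wrt (<) (backlog k n) \<and> set (backlog k n) \<subseteq> {k<..n} \<and> (\<forall>m\<in>set (backlog k n). \<exists>c. w m = Agent c)"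
    using assms
  proof (induction n rule: int_ge_induct)
    case (step n)
    note sub = set_remove_first_subset[of _ "backlog k n"]
    from step have "backlog k (n + 1) = position_step (backlog k n) (n + 1)"
      using backlog_step[of k "n + 1"] by simp
    then show ?case
      using step sub
      by (cases "w (n + 1)") (force simp: sorted_wrt_append sorted_remove_first dest!: subsetD[OF sub])+
  qed simp
  then show "sorted_wrt (<) (backlog k n)" "set (backlog k n) \<subseteq> {k<..n}"
    "\<forall>m\<in>set (backlog k n). \<exists>c. w m = Agent c" by blast+
qed

text \<open>With the elements of \<open>q\<close> as the agents still available before
  \<open>n\<close>, the first-come-first-served clause says that \<open>m\<close> is the least
  compatible element of \<open>q\<close>. In a sorted list this is what \<open>find\<close>
  returns.\<close>

lemma first_unmatched_iff:
  assumes q: "\<And>k. k \<in> set q \<longleftrightarrow> k < n \<and> (\<exists>c. w k = Agent c) \<and> \<not> (\<exists>l<n. (k, l) \<in> Mt)"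
    and "sorted_wrt (<) q"
  shows "(\<exists>s. w n = Good s \<and> find (\<lambda>m. (s, agent_type (w m)) \<in> G) q = Some m) \<longleftrightarrow>
    (\<exists>c s. w m = Agent c \<and> w n = Good s \<and> m < n \<and> (s, c) \<in> G \<and>
       (\<forall>k c'. k < m \<and> w k = Agent c' \<and> (s, c') \<in> G \<longrightarrow> (\<exists>l<n. (k, l) \<in> Mt)) \<and>
       (\<forall>l<n. (m, l) \<notin> Mt))"
proof -
  have "(\<forall>k c'. k < m \<and> w k = Agent c' \<and> (s, c') \<in> G \<longrightarrow> (\<exists>l<n. (k, l) \<in> Mt)) \<longleftrightarrow>
      (\<forall>k. k \<in> set q \<and> (s, agent_type (w k)) \<in> G \<longrightarrow> m \<le> k)" if "m < n" for s
  proof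
    assume "\<forall>k c'. k < m \<and> w k = Agent c' \<and> (s, c') \<in> G \<longrightarrow> (\<exists>l<n. (k, l) \<in> Mt)"
    then show "\<forall>k. k \<in> set q \<and> (s, agent_type (w k)) \<in> G \<longrightarrow> m \<le> k"
      unfolding q by (metis item.sel(1) not_le)
  next
    assume *: "\<forall>k. k \<in> set q \<and> (s, agent_type (w k)) \<in> G \<longrightarrow> m \<le> k"
    show "\<forall>k c'. k < m \<and> w k = Agent c' \<and> (s, c') \<in> G \<longrightarrow> (\<exists>l<n. (k, l) \<in> Mt)"
    proof (intro allI impI, elim conjE)
      fix k c' assume "k < m" "w k = Agent c'" "(s, c') \<in> G"
      with * have "k \<notin> set q" by fastforce
      with \<open>k < m\<close> \<open>m < n\<close> \<open>w k = Agent c'\<close> show "\<exists>l<n. (k, l) \<in> Mt"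
        unfolding q by auto
    qed
  qed
  then show ?thesis unfolding find_Some_sorted[OF assms(2)] q by fastforce
qed

text \<open>A matching influences the partner of a good only through the set of agents unmatched
  just before it. A matching is therefore determined by its backlogs.\<close>

lemma match_iff:
  assumes "directed_FCFS_matching G w Mt" "unmatched_agents w Mt (n - 1) = set q" "sorted_wrt (<) q"
  shows "(m, n) \<in> Mt \<longleftrightarrow>
    (\<exists>s. w n = Good s \<and> find (\<lambda>m. (s, agent_type (w m)) \<in> G) q = Some m)"
proof (subst first_unmatched_iff[OF _ assms(3)])
  show "k \<in> set q \<longleftrightarrow> k < n \<and> (\<exists>c. w k = Agent c) \<and> \<not> (\<exists>l<n. (k, l) \<in> Mt)" for k
    unfolding assms(2)[symmetric] unmatched_agents_def by auto
qed (use assms(1) in \<open>unfold directed_FCFS_matching_def, blast\<close>)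

lemma unmatched_step:
  assumes "directed_FCFS_matching G w Mt" "unmatched_agents w Mt (n - 1) = set q" "sorted_wrt (<) q"
  shows "unmatched_agents w Mt n = set (position_step q n)"
proof -
  have later: "m < l" if "(m, l) \<in> Mt" for m l
    using assms(1) that unfolding directed_FCFS_matching_def by blast
  have "unmatched_agents w Mt n =
      {m. m \<in> unmatched_agents w Mt (n - 1) \<and> (m, n) \<notin> Mt} \<union> {m. m = n \<and> (\<exists>c. w m = Agent c)}"
  proof -
    have "(\<exists>l\<le>n. (m, l) \<in> Mt) \<longleftrightarrow> (\<exists>l\<le>n - 1. (m, l) \<in> Mt) \<or> (m, n) \<in> Mt" for m
      by (metis order_refl order_le_less zle_diff1_eq)
    moreover have "m \<le> n \<longleftrightarrow> m \<le> n - 1 \<or> m = n" for m by auto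
    moreover have "\<not> (\<exists>l\<le>n - 1. (n, l) \<in> Mt)" "(n, n) \<notin> Mt"
      using later by fastforce+
    ultimately show ?thesis unfolding unmatched_agents_def by blast
  qed
  also have "\<dots> = set (position_step q n)"
    unfolding assms(2) match_iff[OF assms]
    by (cases "w n") (auto simp: set_remove_first[OF sorted_wrt_less_distinct[OF assms(3)]])
  finally show ?thesis .
qed

lemma unmatched_eq_backlog:
  assumes "directed_FCFS_matching G w Mt" "unmatched_agents w Mt k = {}" "k \<le> n"
  shows "unmatched_agents w Mt n = set (backlog k n)"
  using assms(3)
proof (induction n rule: int_ge_induct)
  case (step n)
  then show ?case
    using unmatched_step[OF assms(1), of "n + 1" "backlog k n"] backlog_props(1)[of k n]
      backlog_step[of k "n + 1"] by simp
qed (simp add: assms)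

lemma X_list_eq_backlog:
  assumes "unmatched_agents w Mt n = set q" "sorted_wrt (<) q"
  shows "X_list w Mt n = map (\<lambda>m. agent_type (w m)) q"
proof -
  have "sorted_list_of_set (set q) = q"
    using assms(2) by (simp add: sorted_list_of_set.idem_if_sorted_distinct strict_sorted_iff)
  with assms show ?thesis unfolding X_list_def by simp
qed

section \<open>The processes U and W computed from a matching\<close>

lemma U_entry_unmatched: "(p, n + 1) \<notin> Mt \<Longrightarrow> U_entry w Mt (n + 1) p = U_entry w Mt n p"
proof -
  assume "(p, n + 1) \<notin> Mt"
  then have "(\<exists>l\<le>n + 1. (p, l) \<in> Mt) \<longleftrightarrow> (\<exists>l\<le>n. (p, l) \<in> Mt)"
    by (metis less_eq_add1)
  then show ?thesis unfolding U_entry_def by (simp split: item.splits)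
qed

text \<open>With nobody unmatched at \<open>k\<close>, all exchanges after \<open>k\<close> stay
  inside the window. Moving the right end to \<open>n + 1\<close> appends one entry and changes at
  most one other, that of the partner of a good in position \<open>n + 1\<close>. Leaving the window
  untrimmed keeps entries aligned with positions.\<close>

lemma map_U_entry:
  assumes D: "directed_FCFS_matching G w Mt" and "unmatched_agents w Mt k = {}" "k \<le> n"
  shows "map (U_entry w Mt n) [k + 1..n] = foldl (exchange_step G) [] (map w [k + 1..n])"
  using assms(3)
proof (induction n rule: int_ge_induct)
  case (step n)
  let ?q = "backlog k n" and ?e = "U_entry w Mt n" and ?e' = "U_entry w Mt (n + 1)"
  note unm = unmatched_eq_backlog[OF D assms(2) step.hyps]
  note match = match_iff[OF D, of "n + 1", simplified, OF unm backlog_props(1)[OF step.hyps]]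
  have once: "matched_at_most_once Mt" and later: "\<And>m l. (m, l) \<in> Mt \<Longrightarrow> m < l"
    using D unfolding directed_FCFS_matching_def by blast+
  have split: "[k + 1..n + 1] = [k + 1..n] @ [n + 1]"
    using step.hyps by (subst upto_rec2) auto
  have waiting_iff: "?e p = Plain (Agent c) \<longleftrightarrow> w p = Agent c \<and> p \<in> set ?q" if "p \<le> n" for p c
    unfolding unm[symmetric] U_entry_def unmatched_agents_def using that by (auto split: item.splits)
  show ?case
  proof (cases "w (n + 1)")
    case (Agent c)
    have "?e' p = ?e p" for p
      by (rule U_entry_unmatched) (simp add: match Agent)
    moreover have "?e' (n + 1) = Plain (Agent c)"
      unfolding U_entry_def using Agent later by (auto split: item.splits) (metis later not_less)
    ultimately show ?thesis
      unfolding split map_append foldl_append step.IH[symmetric] using Agent by simp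
  next
    case (Good s)
    let ?P = "\<lambda>m. (s, agent_type (w m)) \<in> G"
    \<comment> \<open>The plain agents of the window sit exactly at the backlog positions, so
      searching the entries and searching the backlog find the same position.\<close>
    have "find (\<lambda>p. available G s (?e p)) [k + 1..n] = find ?P ?q"
    proof (rule find_cong_sorted)
      show "p \<in> set [k + 1..n] \<and> available G s (?e p) \<longleftrightarrow> p \<in> set ?q \<and> ?P p" for p
        using backlog_props(2,3)[OF step.hyps] waiting_iff
        by (cases "p \<le> n") (fastforce simp: available_def)+
    qed (auto simp: backlog_props(1)[OF step.hyps])
    then have fnd: "find (available G s) (map ?e [k + 1..n]) = map_option ?e (find ?P ?q)"
      and fnd': "find (\<lambda>p. available G s (?e p)) [k + 1..n] = find ?P ?q"
      unfolding find_map by simp_all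
    show ?thesis
    proof (cases "find ?P ?q")
      case None
      then have no: "(p, n + 1) \<notin> Mt" for p unfolding match using Good by simp
      have "?e' p = ?e p" for p
        by (rule U_entry_unmatched[OF no])
      moreover have "?e' (n + 1) = Tilde (Good s)"
        unfolding U_entry_def using Good no by simp
      ultimately show ?thesis
        unfolding split map_append foldl_append step.IH[symmetric] using Good None fnd by simp
    next
      case (Some m)
      then have m: "(p, n + 1) \<in> Mt \<longleftrightarrow> p = m" for p unfolding match using Good by auto
      have "m \<in> set ?q" using Some by (auto simp: find_Some_iff)
      then obtain c where c: "w m = Agent c" "k < m" "m \<le> n"
        using backlog_props(2,3)[OF step.hyps] by fastforce
      have the1: "(THE l. (m, l) \<in> Mt) = n + 1"
      proof (rule the_equality)
        show "(m, n + 1) \<in> Mt" using m by simp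
        show "l = n + 1" if "(m, l) \<in> Mt" for l
          using that \<open>(m, n + 1) \<in> Mt\<close> once unfolding matched_at_most_once_def by metis
      qed
      have the2: "(THE l. (l, n + 1) \<in> Mt) = m"
        using m by simp
      have other: "?e' p = (?e(m := Tilde (Good s))) p" if "p \<le> n" for p
      proof (cases "p = m")
        case True
        have "\<exists>l\<le>n + 1. (m, l) \<in> Mt" using m by blast
        with True show ?thesis unfolding U_entry_def by (simp add: c the1 Good)
      next
        case False
        then show ?thesis using U_entry_unmatched[of p n Mt] m by simp
      qed
      have e'n: "?e' (n + 1) = Tilde (Agent c)"
        unfolding U_entry_def using Good m the2 c by auto
      have em: "?e m = Plain (Agent c)"
        using waiting_iff[of m c] c \<open>m \<in> set ?q\<close> by simp
      have repl: "replace_first (available G s) (Tilde (Good s)) (map ?e [k + 1..n])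
          = map (?e(m := Tilde (Good s))) [k + 1..n]"
        by (rule replace_first_map) (auto simp: fnd' Some)
      have mp: "map ?e' [k + 1..n] = map (?e(m := Tilde (Good s))) [k + 1..n]"
        using other by (intro map_cong) auto
      show ?thesis
        unfolding split map_append foldl_append step.IH[symmetric] mp
        using Good fnd Some repl em e'n by (simp del: map_eq_conv)
    qed
  qed
qed simp

lemma U_path_eq:
  assumes D: "directed_FCFS_matching G w Mt" and "unmatched_agents w Mt k = {}" "k \<le> n"
  shows "U_path w Mt n = foldl (U_step G) [] (map w [k + 1..n])"
proof -
  let ?q = "backlog k n" and ?e = "U_entry w Mt n"
  note unm = unmatched_eq_backlog[OF assms]
  note q = backlog_props[OF assms(3)]
  have waiting_iff: "is_waiting (?e p) \<longleftrightarrow> p \<in> set ?q" if "p \<le> n" for p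
    unfolding unm[symmetric] U_entry_def unmatched_agents_def using that by (auto split: item.splits)
  have X: "X_list w Mt n = [] \<longleftrightarrow> ?q = []"
    using X_list_eq_backlog[OF unm q(1)] by simp
  have "U_path w Mt n = trim (map ?e [k + 1..n])"
  proof (cases ?q)
    case Nil
    then have "waiting (map ?e [k + 1..n]) = []"
      using waiting_iff by (auto simp: waiting_eq_Nil)
    then have "trim (map ?e [k + 1..n]) = []" by (simp only: trim_eq_Nil)
    then show ?thesis using Nil X by (simp add: U_path_def)
  next
    case (Cons m q')
    then have m: "Min (set ?q) = m"
      using q(1) by (intro Min_eqI) auto
    have "k < m" "m \<le> n" using q(2) Cons by auto
    then have "[k + 1..n] = [k + 1..m - 1] @ [m..n]" "[m..n] = m # [m + 1..n]"
      using upto_split1[of "k + 1" m n] by (auto simp: upto_rec1)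
    moreover have "waiting (map ?e [k + 1..m - 1]) = []"
      using waiting_iff q(1) Cons \<open>m \<le> n\<close> by (auto simp: waiting_eq_Nil)
    moreover have "is_waiting (?e m)" using waiting_iff \<open>m \<le> n\<close> Cons by simp
    ultimately have "trim (map ?e [k + 1..n]) = map ?e [m..n]"
      by (simp add: trim_append) (simp add: trim_def)
    then show ?thesis using X Cons m unm by (simp add: U_path_def)
  qed
  then show ?thesis by (simp add: foldl_U_step map_U_entry[OF assms])
qed

text \<open>Agents from positions up to \<open>N\<close> precede all later arrivals in the backlog.
  A good therefore takes a later agent only if it fits none of the old ones, and the old part of the
  backlog evolves by itself. This justifies that \<open>serve\<close> ignores arrivals.\<close>

lemma map_W_entry:
  assumes D: "directed_FCFS_matching G w Mt" and "unmatched_agents w Mt k = {}" "k \<le> N" "N \<le> M"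
  shows "map (W_entry w Mt N) [N + 1..M] = serve G (X_list w Mt N) (map w [N + 1..M])"
    and "left_over G (X_list w Mt N) (map w [N + 1..M]) =
      map (\<lambda>m. agent_type (w m)) (filter (\<lambda>m. m \<le> N) (backlog k M))"
proof -
  let ?t = "\<lambda>m. agent_type (w m)"
  define R where "R p = filter (\<lambda>m. m \<le> N) (backlog k p)" for p
  have later: "\<And>m l. (m, l) \<in> Mt \<Longrightarrow> m < l"
    using D unfolding directed_FCFS_matching_def by blast
  have serve_step: "W_entry w Mt N (p + 1) # serve G (map ?t (R (p + 1))) zs = serve G (map ?t (R p)) (w (p + 1) # zs)
      \<and> left_over G (map ?t (R p)) (w (p + 1) # zs) = left_over G (map ?t (R (p + 1))) zs"
    if "N \<le> p" for p zs
  proof -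
    have kp: "k \<le> p" using that assms by simp
    note unm = unmatched_eq_backlog[OF D assms(2) kp] and q = backlog_props[OF kp]
    note match = match_iff[OF D, of "p + 1", simplified, OF unm q(1)]
    have st: "backlog k (p + 1) = position_step (backlog k p) (p + 1)"
      using backlog_step[of k "p + 1"] kp by simp
    \<comment> \<open>The backlog is sorted by position, so its old part is a prefix.\<close>
    have split: "backlog k p = R p @ filter (\<lambda>m. \<not> m \<le> N) (backlog k p)"
    proof -
      have "xs = filter (\<lambda>m. m \<le> N) xs @ filter (\<lambda>m. \<not> m \<le> N) xs" if "sorted_wrt (<) xs" for xs :: "int list"
        using that
      proof (induction xs)
        case (Cons x xs)
        show ?case
        proof (cases "x \<le> N")
          case True then show ?thesis using Cons by simp
        next
          case False
          then have "filter (\<lambda>m. m \<le> N) xs = []" using Cons.prems by (auto simp: filter_empty_conv)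
          then show ?thesis using False Cons by simp
        qed
      qed simp
      then show ?thesis using q(1) unfolding R_def by blast
    qed
    show ?thesis
    proof (cases "w (p + 1)")
      case (Agent c)
      then have "R (p + 1) = R p" unfolding R_def st using that by simp
      then show ?thesis using Agent by (simp add: W_entry_def)
    next
      case (Good s)
      let ?P = "\<lambda>m. (s, ?t m) \<in> G"
      let ?r = "filter (\<lambda>m. \<not> m \<le> N) (backlog k p)"
      have f: "find ?P (backlog k p) = (case find ?P (R p) of None \<Rightarrow> find ?P ?r | Some x \<Rightarrow> Some x)"
        by (subst split) (rule find_append)
      have rem: "R (p + 1) = remove_first ?P (R p)"
      proof -
        have "R (p + 1) = filter (\<lambda>m. m \<le> N) (remove_first ?P (R p @ ?r))"
          unfolding R_def[of "p + 1"] st using Good split by simp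
        also have "\<dots> = remove_first ?P (R p)"
        proof -
          have a: "filter (\<lambda>m. m \<le> N) (remove_first ?P ?r) = []"
            using set_remove_first_subset[of ?P ?r] by (auto simp: filter_empty_conv)
          have b: "filter (\<lambda>m. m \<le> N) (remove_first ?P (R p)) = remove_first ?P (R p)"
            using set_remove_first_subset[of ?P "R p"]
            by (intro filter_True) (auto simp: R_def)
          have c: "filter (\<lambda>m. m \<le> N) (R p) = R p" by (simp add: R_def)
          show ?thesis using a b c by (auto simp: remove_first_append remove_first_None)
        qed
        finally show ?thesis .
      qed
      have W: "W_entry w Mt N (p + 1) =
          (case find ?P (R p) of None \<Rightarrow> Plain (Good s) | Some m \<Rightarrow> Tilde (Agent (?t m)))"
      proof (cases "find ?P (R p)")
        case None
        have "\<not> (\<exists>m\<le>N. (m, p + 1) \<in> Mt)"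
        proof
          assume "\<exists>m\<le>N. (m, p + 1) \<in> Mt"
          then obtain m where "m \<le> N" "find ?P (backlog k p) = Some m"
            unfolding match using Good by auto
          then have "find ?P ?r = Some m" "m \<le> N" using f None by simp_all
          then show False by (auto simp: find_Some_iff) (metis mem_Collect_eq nth_mem set_filter)
        qed
        with None Good show ?thesis by (simp add: W_entry_def)
      next
        case (Some m)
        then have m: "(l, p + 1) \<in> Mt \<longleftrightarrow> l = m" for l unfolding match using Good f by auto
        have "m \<in> set (R p)" using Some by (auto simp: find_Some_iff)
        then have "m \<le> N" "m \<in> set (backlog k p)" unfolding R_def by auto
        then obtain c where "w m = Agent c" using q(3) by blast
        with Some Good m \<open>m \<le> N\<close> show ?thesis by (auto simp: W_entry_def)
      qed
      show ?thesis
        using Good by (simp add: W rem find_map remove_first_map remove_first_None split: option.splits)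
    qed
  qed
  have RN: "R N = backlog k N"
    using backlog_props(2)[OF assms(3)] unfolding R_def by (intro filter_True) auto
  have X: "X_list w Mt N = map ?t (R N)"
    unfolding RN using X_list_eq_backlog[OF unmatched_eq_backlog[OF D assms(2,3)] backlog_props(1)[OF assms(3)]] .
  \<comment> \<open>Downward induction from \<open>M\<close>, because \<open>serve\<close> and
    \<open>left_over\<close> consume the window from its left end.\<close>
  have "map (W_entry w Mt N) [p + 1..M] = serve G (map ?t (R p)) (map w [p + 1..M]) \<and>
      left_over G (map ?t (R p)) (map w [p + 1..M]) = map ?t (R M)" if "N \<le> p" "p \<le> M" for p
    using that(2,1)
  proof (induction p rule: int_le_induct)
    case (step p)
    have "[p..M] = p # [p + 1..M]"
      using step by (simp add: upto_rec1)
    then have "map w [p..M] = w p # map w [p + 1..M]" "map (W_entry w Mt N) [p..M] = W_entry w Mt N p # map (W_entry w Mt N) [p + 1..M]"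
      by simp_all
    then show ?case
      using step serve_step[of "p - 1" "map w [p + 1..M]"] by (simp del: serve.simps left_over.simps)
  qed simp
  from this[of N] assms(4) show "map (W_entry w Mt N) [N + 1..M] = serve G (X_list w Mt N) (map w [N + 1..M])"
    "left_over G (X_list w Mt N) (map w [N + 1..M]) =
      map (\<lambda>m. agent_type (w m)) (filter (\<lambda>m. m \<le> N) (backlog k M))"
    unfolding X R_def[symmetric] by simp_all
qed

text \<open>By \<open>fin\<close> every agent waiting at \<open>N\<close> is served by
  \<open>M\<close>, so the goods over which \<open>W_path\<close> takes a maximum lie between
  \<open>N\<close> and \<open>M\<close>. Behind the last of them no entry has a tilde, and
  \<open>strip\<close> cuts at the same place.\<close>

lemma W_path_eq:
  assumes D: "directed_FCFS_matching G w Mt" and "unmatched_agents w Mt k = {}" "k \<le> N" "N \<le> M"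
    and fin: "left_over G (X_list w Mt N) (map w [N + 1..M]) = []"
  shows "W_path w Mt N = strip (serve G (X_list w Mt N) (map w [N + 1..M]))"
proof -
  let ?S = "{n. N < n \<and> (\<exists>m\<le>N. (m, n) \<in> Mt)}"
  have once: "matched_at_most_once Mt" and later: "\<And>m l. (m, l) \<in> Mt \<Longrightarrow> m < l"
    and good: "\<And>m l. (m, l) \<in> Mt \<Longrightarrow> (\<exists>s. w l = Good s) \<and> (\<exists>c. w m = Agent c)"
    using D unfolding directed_FCFS_matching_def by blast+
  have tl: "is_tilde (W_entry w Mt N p) \<longleftrightarrow> (\<exists>m\<le>N. (m, p) \<in> Mt)" for p
  proof (cases "w p")
    case (Agent c)
    then have "(m, p) \<notin> Mt" for m using good[of m p] by auto
    then show ?thesis using Agent by (simp add: W_entry_def)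
  qed (simp add: W_entry_def)
  have k': "k \<le> M" using assms by simp
  have "{m \<in> set (backlog k M). m \<le> N} = {}"
    using fin unfolding map_W_entry(2)[OF assms(1-4)] by (auto simp: filter_empty_conv)
  then have matched: "\<exists>l\<le>M. (m, l) \<in> Mt" if "m \<in> unmatched_agents w Mt N" for m
    using that assms(4) unfolding unmatched_eq_backlog[OF D assms(2) k', symmetric] unmatched_agents_def
    by (smt (verit, best) empty_iff mem_Collect_eq)
  have bound: "l \<le> M" if "l \<in> ?S" for l
  proof -
    from that obtain m where m: "N < l" "m \<le> N" "(m, l) \<in> Mt" by auto
    have uniq: "l' = l" if "(m, l') \<in> Mt" for l'
      using once m(3) that unfolding matched_at_most_once_def by metis
    then have "m \<in> unmatched_agents w Mt N"
      using good[OF m(3)] m(1,2) unfolding unmatched_agents_def by auto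
    from matched[OF this] uniq show ?thesis by auto
  qed
  have "W_path w Mt N = strip (map (W_entry w Mt N) [N + 1..M])"
  proof (cases "X_list w Mt N = []")
    case True
    then show ?thesis unfolding map_W_entry(1)[OF assms(1-4)]
      using strip_append_Plain[of "[]" "map w [N + 1..M]"] by (simp add: W_path_def)
  next
    case False
    then obtain m where m: "m \<in> unmatched_agents w Mt N"
      using X_list_eq_backlog[OF unmatched_eq_backlog[OF D assms(2,3)] backlog_props(1)[OF assms(3)]]
        unmatched_eq_backlog[OF D assms(2,3)] by (cases "backlog k N") auto
    then obtain l where "(m, l) \<in> Mt" using matched by blast
    with m have ne: "l \<in> ?S" unfolding unmatched_agents_def by (auto simp: not_le[symmetric])
    have "?S \<subseteq> {N..M}"
    proof
      fix l assume "l \<in> ?S"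
      then show "l \<in> {N..M}" using bound[of l] by auto
    qed
    then have "finite ?S" using finite_subset by blast
    define n where "n = Max ?S"
    have n: "n \<in> ?S" "\<And>l. l \<in> ?S \<Longrightarrow> l \<le> n"
      unfolding n_def using \<open>finite ?S\<close> ne Max_in[of ?S] by auto
    have "n \<le> M" using bound n(1) .
    have "N < n" using n(1) by simp
    have sp: "[N + 1..M] = [N + 1..n] @ [n + 1..M]"
      using \<open>N < n\<close> \<open>n \<le> M\<close> upto_split2[of "N + 1" n M] by simp
    have "strip (map (W_entry w Mt N) [N + 1..n] @ map (W_entry w Mt N) [n + 1..M]) =
        strip (map (W_entry w Mt N) [N + 1..n])"
    proof -
      have "\<not> is_tilde (W_entry w Mt N p)" if "p \<in> set [n + 1..M]" for p
        using that n(2)[of p] \<open>N < n\<close> unfolding tl by auto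
      then have "map (W_entry w Mt N) [n + 1..M] = map Plain (map (letter \<circ> W_entry w Mt N) [n + 1..M])"
          by (auto intro!: map_cong) (metis is_tilde.elims(3) letter.simps(1))
      then show ?thesis by (metis strip_append_Plain)
    qed
    also have "[N + 1..n] = [N + 1..n - 1] @ [n]"
      using \<open>N < n\<close> by (subst upto_rec2) auto
    then have "strip (map (W_entry w Mt N) [N + 1..n]) = map (W_entry w Mt N) [N + 1..n]"
      using n(1) tl by (intro strip_eq_self) auto
    finally show ?thesis
      using False by (simp add: W_path_def sp n_def)
  qed
  then show ?thesis by (simp add: map_W_entry(1)[OF assms(1-4)])
qed

text \<open>Renewal points in the past give existence and uniqueness of the matching; those in the
  future ensure that every agent gets matched and that the W-states can be computed from a finite
  window.\<close>

definition regular :: bool where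
  "regular \<longleftrightarrow> (\<forall>N. \<exists>k\<le>N. empties k) \<and> (\<forall>N. \<exists>k\<ge>N. empties k)"

text \<open>Taking the least \<open>j\<close>, not just some \<open>j\<close>, makes \<open>start\<close> a measurable function of the path.\<close>

definition start :: "int \<Rightarrow> int" where
  "start n = n - int (LEAST j. empties (n - int j))"

text \<open>Pairs are read off from the backlog since the latest renewal point before
  \<open>n\<close>. Any earlier renewal point would give the same backlog, by
  \<open>backlog_empties\<close>.\<close>

definition limit_matching :: "(int \<times> int) set" where
  "limit_matching = {(m, n). \<exists>s. w n = Good s \<and>
     find (\<lambda>m. (s, agent_type (w m)) \<in> G) (backlog (start (n - 1)) (n - 1)) = Some m}"

lemma start_props:
  assumes "\<exists>k\<le>n. empties k"
  shows "start n \<le> n" "empties (start n)"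
proof -
  from assms obtain k where "k \<le> n" "empties k" by blast
  then have "empties (n - int (nat (n - k)))" by simp
  then show "start n \<le> n" "empties (start n)"
    unfolding start_def using LeastI[of "\<lambda>j. empties (n - int j)" "nat (n - k)"] by simp_all
qed

lemma backlog_empties:
  assumes "empties j" "empties k" "j \<le> n" "k \<le> n"
  shows "backlog j n = backlog k n"
proof (cases "j \<le> k")
  case True
  then show ?thesis using backlog_restart[of j k n] assms by (simp add: empties_iff)
next
  case False
  then show ?thesis using backlog_restart[of k j n] assms by (simp add: empties_iff)
qed

text \<open>The latest renewal point may jump between \<open>n - 1\<close> and \<open>n\<close>.
  Both points are valid starts for the backlog at \<open>n\<close>, so the jump has no effect on
  it.\<close>

lemma backlog_start_step:
  assumes "\<forall>N. \<exists>k\<le>N. empties k"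
  shows "backlog (start n) n = position_step (backlog (start (n - 1)) (n - 1)) n"
proof -
  have s: "start n \<le> n" "empties (start n)" for n using assms start_props by blast+
  have "backlog (start n) n = backlog (start (n - 1)) n"
    using s[of n] s[of "n - 1"] by (intro backlog_empties) auto
  then show ?thesis using s[of "n - 1"] backlog_step[of "start (n - 1)" n] by force
qed

text \<open>An agent enters the backlog at its own position and leaves it at the good that takes it;
  induction over the time since its arrival.\<close>

lemma unmatched_limit_matching:
  assumes "\<forall>N. \<exists>k\<le>N. empties k"
  shows "unmatched_agents w limit_matching n = set (backlog (start n) n)"
proof -
  define b where "b n = backlog (start n) n" for n
  have b_step: "b n = position_step (b (n - 1)) n" for n
    unfolding b_def by (rule backlog_start_step[OF assms])
  have s: "start n \<le> n" for n using assms start_props by blast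
  have props: "sorted_wrt (<) (b n)" "set (b n) \<subseteq> {..n}" "\<forall>m\<in>set (b n). \<exists>c. w m = Agent c" for n
    using backlog_props[OF s, of n] unfolding b_def by auto
  have Mt: "(m, n) \<in> limit_matching \<longleftrightarrow> (\<exists>s. w n = Good s \<and>
     find (\<lambda>m. (s, agent_type (w m)) \<in> G) (b (n - 1)) = Some m)" for m n
    unfolding limit_matching_def b_def by simp
  have set_b: "m \<in> set (b n) \<longleftrightarrow>
      m \<in> set (b (n - 1)) \<and> (m, n) \<notin> limit_matching \<or> m = n \<and> (\<exists>c. w n = Agent c)" for m n
    unfolding Mt b_step[of n]
    by (cases "w n") (auto simp: set_remove_first[OF sorted_wrt_less_distinct[OF props(1)]])
  have later: "m < n" if "(m, n) \<in> limit_matching" for m n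
  proof -
    have "m \<in> set (b (n - 1))" using that unfolding Mt by (auto simp: find_Some_iff)
    then show ?thesis using props(2)[of "n - 1"] by force
  qed
  have "m \<in> set (b n) \<longleftrightarrow> \<not> (\<exists>l\<le>n. (m, l) \<in> limit_matching)" if "w m = Agent c" "m \<le> n" for m c n
    using that(2)
  proof (induction n rule: int_ge_induct)
    case base
    have "\<not> (\<exists>l\<le>m. (m, l) \<in> limit_matching)" using later by fastforce
    then show ?case using set_b[of m m] that(1) by simp
  next
    case (step n)
    have "m \<in> set (b (n + 1)) \<longleftrightarrow> m \<in> set (b n) \<and> (m, n + 1) \<notin> limit_matching"
      using set_b[of m "n + 1"] step.hyps by simp
    with step.IH show ?case unfolding less_eq_add1 by blast
  qed
  then show ?thesis
    unfolding unmatched_agents_def b_def[symmetric] using props(2,3)[of n] by blast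
qed

lemma directed_FCFS_limit_matching:
  assumes "\<forall>N. \<exists>k\<le>N. empties k"
  shows "directed_FCFS_matching G w limit_matching"
proof -
  define b where "b n = backlog (start n) n" for n
  have s: "start n \<le> n" for n using assms start_props by blast
  have srt: "sorted_wrt (<) (b n)" for n
    using backlog_props(1)[OF s, of n] unfolding b_def .
  have Mt: "(m, n) \<in> limit_matching \<longleftrightarrow> (\<exists>s. w n = Good s \<and>
     find (\<lambda>m. (s, agent_type (w m)) \<in> G) (b (n - 1)) = Some m)" for m n
    unfolding limit_matching_def b_def by simp
  have b_iff: "m \<in> set (b (n - 1)) \<longleftrightarrow>
      m < n \<and> (\<exists>c. w m = Agent c) \<and> \<not> (\<exists>l<n. (m, l) \<in> limit_matching)" for m n
    using unmatched_limit_matching[OF assms, of "n - 1"] unfolding b_def unmatched_agents_def by auto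
  have in_b: "m \<in> set (b (n - 1))" if "(m, n) \<in> limit_matching" for m n
    using that unfolding Mt by (auto simp: find_Some_iff)
  have once: "matched_at_most_once limit_matching"
    unfolding matched_at_most_once_def
  proof (intro conjI allI impI)
    fix m n n' assume *: "(m, n) \<in> limit_matching \<and> (m, n') \<in> limit_matching"
    then have "\<not> n < n'" "\<not> n' < n" using in_b[of m n] in_b[of m n'] unfolding b_iff by blast+
    then show "n = n'" by simp
  next
    fix m m' n assume "(m, n) \<in> limit_matching \<and> (m', n) \<in> limit_matching"
    then show "m = m'" unfolding Mt by auto
  qed
  moreover note Mt[unfolded first_unmatched_iff[OF b_iff srt]]
  ultimately show ?thesis unfolding directed_FCFS_matching_def by blast
qed

lemma the_matching_eq:
  assumes regular
  shows "the_matching G w = limit_matching"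
  unfolding the_matching_def
proof (rule the_equality)
  have past: "\<forall>N. \<exists>k\<le>N. empties k" and future: "\<forall>N. \<exists>k\<ge>N. empties k"
    using assms unfolding regular_def by auto
  have s: "start n \<le> n" "empties (start n)" for n using past start_props by blast+
  have unm: "unmatched_agents w limit_matching n = {}" if "empties n" for n
    unfolding unmatched_limit_matching[OF past] using that s(1) by (simp add: empties_iff)
  show "directed_FCFS_matching G w limit_matching \<and> all_agents_matched w limit_matching \<and>
      no_backlog_from_infinity w limit_matching"
  proof (intro conjI directed_FCFS_limit_matching past)
    show "all_agents_matched w limit_matching"
      unfolding all_agents_matched_def
    proof (intro allI impI)
      fix m c assume c: "w m = Agent c"
      obtain k where "m \<le> k" "empties k" using future by blast
      then have "m \<notin> unmatched_agents w limit_matching k" using unm by simp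
      with c \<open>m \<le> k\<close> show "\<exists>n. (m, n) \<in> limit_matching" unfolding unmatched_agents_def by blast
    qed
    show "no_backlog_from_infinity w limit_matching"
      unfolding no_backlog_from_infinity_def using past unm by blast
  qed
next
  fix Mt assume "directed_FCFS_matching G w Mt \<and> all_agents_matched w Mt \<and> no_backlog_from_infinity w Mt"
  then have D: "directed_FCFS_matching G w Mt" and nb: "\<And>N. \<exists>k\<le>N. unmatched_agents w Mt k = {}"
    unfolding no_backlog_from_infinity_def by blast+
  have past: "\<forall>N. \<exists>k\<le>N. empties k" using assms unfolding regular_def by auto
  have s: "start n \<le> n" "empties (start n)" for n using past start_props by blast+
  have unm: "unmatched_agents w Mt n = set (backlog (start n) n)" for n
  proof -
    \<comment> \<open>A time before the renewal point at which \<open>Mt\<close> has nobody waiting.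
      The backlog from \<open>k\<close> is empty at \<open>start n\<close> because
      \<open>start n\<close> is a renewal point, so the two starts agree afterwards.\<close>
    obtain k where k: "k \<le> start n" "unmatched_agents w Mt k = {}" using nb by blast
    then have "unmatched_agents w Mt n = set (backlog k n)"
      using s(1)[of n] by (intro unmatched_eq_backlog[OF D]) auto
    also have "backlog k n = backlog (start n) n"
      using k s[of n] by (intro backlog_restart) (auto simp: empties_iff)
    finally show ?thesis .
  qed
  have "(m, n) \<in> Mt \<longleftrightarrow> (m, n) \<in> limit_matching" for m n
    unfolding match_iff[OF D unm backlog_props(1)[OF s(1)]] limit_matching_def by simp
  then show "Mt = limit_matching" by auto
qed

text \<open>The interface to the probabilistic part, free of matchings: every renewal point
  \<open>k\<close> may serve as start, and every \<open>M\<close> by which the queue of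
  \<open>N\<close> has been served as horizon.\<close>

lemma regular_processes:
  assumes regular "empties k" "k \<le> N"
  defines "u \<equiv> foldl (U_step G) [] (map w [k + 1..N])"
  shows "U_path w (the_matching G w) N = u"
    and "N \<le> M \<Longrightarrow> left_over G (waiting u) (map w [N + 1..M]) = [] \<Longrightarrow>
      W_path w (the_matching G w) N = strip (serve G (waiting u) (map w [N + 1..M]))"
    and "\<exists>M\<ge>N. left_over G (waiting u) (map w [N + 1..M]) = []"
proof -
  have past: "\<forall>N. \<exists>k\<le>N. empties k" and future: "\<forall>N. \<exists>k\<ge>N. empties k"
    using assms(1) unfolding regular_def by auto
  have s: "start n \<le> n" "empties (start n)" for n using past start_props by blast+
  note D = directed_FCFS_limit_matching[OF past]
  have unm: "unmatched_agents w limit_matching k = {}"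
    unfolding unmatched_limit_matching[OF past] using assms(2) s(1) by (simp add: empties_iff)
  have X: "X_list w limit_matching N = waiting u"
    using X_list_eq_backlog[OF unmatched_eq_backlog[OF D unm assms(3)] backlog_props(1)[OF assms(3)]]
    by (simp add: u_def waiting_foldl_U_step map_backlog)
  show "U_path w (the_matching G w) N = u"
    unfolding the_matching_eq[OF assms(1)] u_def by (rule U_path_eq[OF D unm assms(3)])
  show "W_path w (the_matching G w) N = strip (serve G (waiting u) (map w [N + 1..M]))"
    if "N \<le> M" "left_over G (waiting u) (map w [N + 1..M]) = []"
    unfolding the_matching_eq[OF assms(1)] using W_path_eq[OF D unm assms(3) that(1)] that(2) X by simp
  obtain M where M: "M \<ge> N" "empties M" using future by blast
  have "backlog k M = []" using M assms(3) by (simp add: empties_iff)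
  then have "left_over G (waiting u) (map w [N + 1..M]) = []"
    using map_W_entry(2)[OF D unm assms(3) M(1)] X by simp
  with M show "\<exists>M\<ge>N. left_over G (waiting u) (map w [N + 1..M]) = []" by blast
qed

end

section \<open>Weights of the admissible states\<close>

lemma UNIV_item: "(UNIV :: ('c, 's) item set) = range Agent \<union> range Good"
proof -
  have "i \<in> range Agent \<union> range Good" for i :: "('c, 's) item"
    by (cases i) auto
  then show ?thesis by blast
qed

lemma UNIV_entry: "(UNIV :: 'x entry set) = range Plain \<union> range Tilde"
proof -
  have "e \<in> range Plain \<union> range Tilde" for e :: "'x entry"
    by (cases e) auto
  then show ?thesis by blast
qed

instance item :: (finite, finite) finite
  by standard (simp add: UNIV_item)

instance entry :: (finite) finite
  by standard (simp add: UNIV_entry)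

lemma sum_item: "(\<Sum>i\<in>UNIV. f i) = (\<Sum>c\<in>UNIV. f (Agent c)) + (\<Sum>s\<in>UNIV. f (Good s))"
  for f :: "('c::finite, 's::finite) item \<Rightarrow> real"
  unfolding UNIV_item by (subst sum.union_disjoint) (auto simp: sum.reindex inj_on_def)

section \<open>Unconditional sums over pairs, disjoint unions and words\<close>

lemma has_sum_Times_nonneg:
  fixes f :: "'i \<Rightarrow> real" and g :: "'j \<Rightarrow> real"
  assumes f: "(f has_sum a) A" and g: "(g has_sum b) B"
    and "\<And>x. x \<in> A \<Longrightarrow> 0 \<le> f x" "\<And>y. y \<in> B \<Longrightarrow> 0 \<le> g y"
  shows "((\<lambda>(x, y). f x * g y) has_sum a * b) (A \<times> B)"
proof (rule has_sum_SigmaI)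
  show inner: "((\<lambda>y. case (x, y) of (x, y) \<Rightarrow> f x * g y) has_sum f x * b) B" if "x \<in> A" for x
    using has_sum_cmult_right[OF g] by simp
  show outer: "((\<lambda>x. f x * b) has_sum a * b) A"
    by (rule has_sum_cmult_left[OF f])
  show "(\<lambda>(x, y). f x * g y) summable_on A \<times> B"
    using inner has_sum_imp_summable[OF outer] assms(3,4) by (intro summable_on_SigmaI) auto
qed

lemma has_sum_UN_finite:
  fixes f :: "'e \<Rightarrow> real"
  assumes "finite C" "\<And>c. c \<in> C \<Longrightarrow> (f has_sum a c) (A c)" "disjoint_family_on A C"
  shows "(f has_sum (\<Sum>c\<in>C. a c)) (\<Union>c\<in>C. A c)"
  using assms
proof (induction C)
  case (insert c C)
  then have "A c \<inter> (\<Union>c\<in>C. A c) = {}" "disjoint_family_on A C"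
    by (auto simp: disjoint_family_on_def)
  with insert show ?case by (auto intro!: has_sum_Un_disjoint)
qed simp

lemma sum_lists_Suc:
  fixes f :: "'e list \<Rightarrow> real"
  assumes "finite S"
  shows "(\<Sum>v\<in>{v. set v \<subseteq> S \<and> length v = Suc n}. f v) =
    (\<Sum>e\<in>S. \<Sum>v\<in>{v. set v \<subseteq> S \<and> length v = n}. f (e # v))"
proof -
  have "(\<Sum>v\<in>{v. set v \<subseteq> S \<and> length v = Suc n}. f v) =
      (\<Sum>(v, e)\<in>{v. set v \<subseteq> S \<and> length v = n} \<times> S. f (e # v))"
    unfolding lists_length_Suc_eq by (subst sum.reindex) (auto simp: inj_on_def split_def)
  also have "\<dots> = (\<Sum>v\<in>{v. set v \<subseteq> S \<and> length v = n}. \<Sum>e\<in>S. f (e # v))"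
    by (simp add: sum.cartesian_product)
  also have "\<dots> = (\<Sum>e\<in>S. \<Sum>v\<in>{v. set v \<subseteq> S \<and> length v = n}. f (e # v))"
    by (rule sum.swap)
  finally show ?thesis .
qed

text \<open>Words of length \<open>n\<close> have total weight \<open>sum w S ^ n\<close>, so this
  is a geometric series; nonnegativity permits summing in blocks of equal length.\<close>

lemma has_sum_lists:
  fixes w :: "'e \<Rightarrow> real"
  assumes S: "finite S" and w: "\<And>e. e \<in> S \<Longrightarrow> 0 \<le> w e" and q: "sum w S < 1"
  shows "((\<lambda>v. prod_list (map w v)) has_sum 1 / (1 - sum w S)) (lists S)"
proof -
  let ?f = "\<lambda>v. prod_list (map w v)" and ?B = "\<lambda>n. {v. set v \<subseteq> S \<and> length v = n}"
  have q0: "0 \<le> sum w S" using w by (intro sum_nonneg)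
  have nonneg: "0 \<le> ?f v" if "v \<in> lists S" for v
    using that by (induction v) (auto simp: w)
  have len: "sum ?f (?B n) = sum w S ^ n" for n
  proof (induction n)
    case 0
    have "?B 0 = {[]}" by auto
    then show ?case by simp
  next
    case (Suc n)
    then show ?case
      unfolding sum_lists_Suc[OF S] by (simp add: sum_distrib_left[symmetric] sum_distrib_right[symmetric])
  qed
  have inner: "((\<lambda>v. case (n, v) of (n, v) \<Rightarrow> ?f v) has_sum sum w S ^ n) (?B n)" for n
    using has_sum_finite[OF finite_lists_length_eq[OF S, of n], of ?f] by (simp add: len)
  have outer: "((\<lambda>n. sum w S ^ n) has_sum 1 / (1 - sum w S)) UNIV"
    using geometric_sums[of "sum w S"] q q0 by (intro sums_nonneg_imp_has_sum) auto
  have "((\<lambda>(n, v). ?f v) has_sum 1 / (1 - sum w S)) (Sigma UNIV ?B)"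
  proof (rule has_sum_SigmaI[OF inner outer])
    show "(\<lambda>(n, v). ?f v) summable_on Sigma UNIV ?B"
      using inner has_sum_imp_summable[OF outer] nonneg by (intro summable_on_SigmaI) auto
  qed
  moreover have "bij_betw snd (Sigma UNIV ?B) (lists S)"
    by (rule bij_betwI[where g = "\<lambda>v. (length v, v)"]) auto
  ultimately show ?thesis
    by (subst has_sum_reindex_bij_betw[symmetric, of snd "Sigma UNIV ?B"]) (auto simp: split_def)
qed

text \<open>\<open>p\<close> is the law of a single item. Its point masses are the rates divided by
  the total rate, a scaling under which the stability condition keeps its form.\<close>

locale fcfs_model =
  fixes G :: "('s::finite \<times> 'c::finite) set" and p :: "('c, 's) item pmf"
  assumes stable: "C \<noteq> {} \<Longrightarrow>
    (\<Sum>c\<in>C. pmf p (Agent c)) < (\<Sum>s\<in>compatible_goods G C. pmf p (Good s))"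
begin

section \<open>Weights of words and of admissible states\<close>

definition mass_agents :: "'c set \<Rightarrow> real" where
  "mass_agents C = (\<Sum>c\<in>C. pmf p (Agent c))"

definition mass_goods :: "'c set \<Rightarrow> real" where
  "mass_goods C = (\<Sum>s\<in>compatible_goods G C. pmf p (Good s))"

definition weight :: "('c, 's) item entry list \<Rightarrow> real" where
  "weight u = prod_list (map (\<lambda>e. pmf p (letter e)) u)"

lemma weight_simps [simp]:
  "weight [] = 1" "weight (e # u) = pmf p (letter e) * weight u" "weight (u @ v) = weight u * weight v"
  by (simp_all add: weight_def)

lemma weight_nonneg: "0 \<le> weight u"
  by (induction u) auto

lemma mass_less: "C \<noteq> {} \<Longrightarrow> mass_agents C < mass_goods C"
  unfolding mass_agents_def mass_goods_def by (rule stable)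

lemma mass_agents_nonneg: "0 \<le> mass_agents C"
  unfolding mass_agents_def by (simp add: sum_nonneg)

lemma mass_goods_pos: "C \<noteq> {} \<Longrightarrow> 0 < mass_goods C"
  using mass_less[of C] mass_agents_nonneg[of C] by simp

lemma mass_goods_empty [simp]: "mass_goods {} = 0"
  by (simp add: mass_goods_def compatible_goods_def)

text \<open>\<open>D\<close> collects the types of the agents waiting ahead. A good letter, whether
  lost or moved to the position of its agent, cannot stand behind a waiting agent compatible with
  it, since the good would have taken that agent. Letters of exchanged agents are
  unrestricted.\<close>

fun continuation :: "'c set \<Rightarrow> ('c, 's) item entry list \<Rightarrow> bool" where
  "continuation D [] \<longleftrightarrow> True"
| "continuation D (Plain (Agent c) # u) \<longleftrightarrow> continuation (insert c D) u"
| "continuation D (Plain (Good s) # u) \<longleftrightarrow> False"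
| "continuation D (Tilde (Agent c) # u) \<longleftrightarrow> continuation D u"
| "continuation D (Tilde (Good s) # u) \<longleftrightarrow> s \<notin> compatible_goods G D \<and> continuation D u"

definition admissible :: "('c, 's) item entry list \<Rightarrow> bool" where
  "admissible u \<longleftrightarrow> trim u = u \<and> continuation {} u"

text \<open>The entries that may follow an initial segment whose waiting types form the set \<open>D\<close> without
  showing a waiting type outside \<open>E\<close>.\<close>

definition stays :: "'c set \<Rightarrow> 'c set \<Rightarrow> ('c, 's) item entry set" where
  "stays D E = range (\<lambda>c. Tilde (Agent c)) \<union> (\<lambda>s. Tilde (Good s)) ` (- compatible_goods G D) \<union>
     (\<lambda>c. Plain (Agent c)) ` E"

abbreviation tildes :: "'c set \<Rightarrow> ('c, 's) item entry set" where
  "tildes D \<equiv> stays D {}"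

lemma sum_stays: "(\<Sum>e\<in>stays D E. pmf p (letter e)) = 1 - mass_goods D + mass_agents E"
proof -
  have "(\<Sum>e\<in>stays D E. pmf p (letter e)) = (\<Sum>c\<in>UNIV. pmf p (Agent c)) +
      (\<Sum>s\<in>- compatible_goods G D. pmf p (Good s)) + mass_agents E"
    unfolding stays_def mass_agents_def
    by (subst sum.union_disjoint; (subst sum.union_disjoint)?) (auto simp: sum.reindex inj_on_def)
  moreover have "(\<Sum>s\<in>UNIV. pmf p (Good s)) = mass_goods D + (\<Sum>s\<in>- compatible_goods G D. pmf p (Good s))"
    unfolding mass_goods_def by (subst sum.union_disjoint[symmetric]) (auto simp: Compl_partition)
  moreover have "(\<Sum>i\<in>UNIV. pmf p i) = 1"
    by (simp add: sum_pmf_eq_1)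
  ultimately show ?thesis by (simp add: sum_item)
qed

lemma continuation_append_stays:
  "v \<in> lists (stays D E) \<Longrightarrow> E \<subseteq> D \<Longrightarrow> continuation D (v @ u) \<longleftrightarrow> continuation D u"
  by (induction v) (auto simp: stays_def insert_absorb subset_iff)

lemma waiting_tildes: "v \<in> lists (tildes D) \<Longrightarrow> waiting v = []"
  by (induction v) (auto simp: stays_def)

lemma continuation_mono: "continuation D u \<Longrightarrow> C \<subseteq> D \<Longrightarrow> continuation C u"
proof (induction D u arbitrary: C rule: continuation.induct)
  case (2 D c u)
  then have "continuation (insert c C) u" by (auto intro!: "2.IH"[of "insert c C"])
  then show ?case by simp
qed (auto simp: compatible_goods_def)

text \<open>An allowed entry outside \<open>stays D E\<close> is a waiting agent of a type not in
  \<open>E\<close>. With \<open>E = {}\<close> the split is at the first waiting agent, with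
  \<open>E = D\<close> at the first new waiting type.\<close>

lemma continuation_split:
  assumes "continuation D u" "E \<subseteq> D"
  obtains "u \<in> lists (stays D E)"
  | v c u' where "u = v @ Plain (Agent c) # u'" "v \<in> lists (stays D E)" "c \<notin> E" "continuation (insert c D) u'"
proof -
  have "u \<in> lists (stays D E) \<or>
    (\<exists>v c u'. u = v @ Plain (Agent c) # u' \<and> v \<in> lists (stays D E) \<and> c \<notin> E \<and> continuation (insert c D) u')"
    using assms(1)
  proof (induction u)
    case (Cons e u)
    show ?case
    proof (cases "e \<in> stays D E")
      case True
      then have "continuation D u" using Cons.prems continuation_append_stays[of "[e]" D E u] assms(2) by simp
      from Cons.IH[OF this] show ?thesis
      proof (elim disjE exE conjE)
        fix v c u' assume "u = v @ Plain (Agent c) # u'" "v \<in> lists (stays D E)" "c \<notin> E" "continuation (insert c D) u'"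
        with True show ?thesis by (intro disjI2 exI[of _ "e # v"]) auto
      qed (use True in simp)
    next
      case False
      with Cons.prems obtain c where "e = Plain (Agent c)" "c \<notin> E" "continuation (insert c D) u"
        by (cases "(D, e # u)" rule: continuation.cases) (auto simp: stays_def)
      then show ?thesis by (intro disjI2 exI[of _ "[]"]) auto
    qed
  qed simp
  then show thesis using that by blast
qed

text \<open>A geometric series whose ratio is \<open>1 - (mass_goods D - mass_agents E)\<close>;
  stability makes it smaller than 1.\<close>

lemma has_sum_stays:
  assumes "D \<noteq> {}" "E \<subseteq> D"
  shows "(weight has_sum 1 / (mass_goods D - mass_agents E)) (lists (stays D E))"
proof -
  have "mass_agents E \<le> mass_agents D"
    unfolding mass_agents_def using assms(2) by (intro sum_mono2) auto
  then have "((\<lambda>v. prod_list (map (\<lambda>e. pmf p (letter e)) v)) has_sum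
      1 / (1 - (\<Sum>e\<in>stays D E. pmf p (letter e)))) (lists (stays D E))"
    using mass_less[OF assms(1)] by (intro has_sum_lists) (auto simp: sum_stays)
  then show ?thesis unfolding weight_def[abs_def] by (simp add: sum_stays)
qed

lemma has_sum_tildes: "D \<noteq> {} \<Longrightarrow> (weight has_sum 1 / mass_goods D) (lists (tildes D))"
  using has_sum_stays[of D "{}"] by (simp add: mass_agents_def)

lemma has_sum_append_Cons:
  assumes "(weight has_sum a) (lists S)" "(weight has_sum b) U" "e \<notin> S"
  shows "(weight has_sum a * (pmf p (letter e) * b)) ((\<lambda>(v, u). v @ e # u) ` (lists S \<times> U))"
proof -
  have inj: "inj_on (\<lambda>(v, u). v @ e # u) (lists S \<times> U)"
  proof (rule inj_onI)
    fix x y assume *: "x \<in> lists S \<times> U" "y \<in> lists S \<times> U" "(\<lambda>(v, u). v @ e # u) x = (\<lambda>(v, u). v @ e # u) y"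
    obtain v u v' u' where xy: "x = (v, u)" "y = (v', u')" by (metis surj_pair)
    have "v @ e # u = v' @ e # u'" "e \<notin> set v" "e \<notin> set v'"
      using * assms(3) unfolding xy by auto
    then have "v = v' \<and> u = u'" by - (rule split_list_first_unique)
    then show "x = y" unfolding xy by simp
  qed
  have "((\<lambda>(v, u). weight v * (pmf p (letter e) * weight u)) has_sum a * (pmf p (letter e) * b)) (lists S \<times> U)"
    using assms(1,2) by (intro has_sum_Times_nonneg has_sum_cmult_right) (auto simp: weight_nonneg)
  then show ?thesis
    by (subst has_sum_reindex[OF inj]) (simp add: o_def split_def)
qed

text \<open>The stationary weight of the list of waiting agents, apart from the normalizing constant; the
  extra argument is the set of agent types further ahead in the queue.\<close>

primrec queue_weight :: "'c set \<Rightarrow> 'c list \<Rightarrow> real" where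
  "queue_weight D [] = 1"
| "queue_weight D (c # x) = pmf p (Agent c) / mass_goods (insert c D) * queue_weight (insert c D) x"

text \<open>A free word over \<open>tildes D\<close> stands behind each waiting agent. The factor
  \<open>1 / mass_goods D\<close> belongs to the word that follows the agents already counted in
  \<open>D\<close>.\<close>

lemma has_sum_continuation_waiting:
  assumes "D \<noteq> {}"
  shows "(weight has_sum queue_weight D x / mass_goods D) {u. continuation D u \<and> waiting u = x}"
  using assms
proof (induction x arbitrary: D)
  case Nil
  have "{u. continuation D u \<and> waiting u = []} = lists (tildes D)"
  proof (intro set_eqI iffI)
    fix u assume "u \<in> {u. continuation D u \<and> waiting u = []}"
    then have "continuation D u" and wu: "waiting u = []" by auto
    from this(1) empty_subsetI show "u \<in> lists (tildes D)"
      by (cases rule: continuation_split) (use wu in \<open>auto simp: waiting_append\<close>)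
  next
    fix u assume "u \<in> lists (tildes D)"
    then show "u \<in> {u. continuation D u \<and> waiting u = []}"
      using continuation_append_stays[of u D "{}" "[]"] waiting_tildes[of u D] by simp
  qed
  then show ?case using has_sum_tildes[OF Nil] by simp
next
  case (Cons c x)
  let ?U = "{u. continuation (insert c D) u \<and> waiting u = x}"
  let ?h = "\<lambda>(v, u'). v @ Plain (Agent c) # u'"
  have tl: "Plain (Agent c) \<notin> tildes D" by (auto simp: stays_def)
  have img: "?h ` (lists (tildes D) \<times> ?U) = {u. continuation D u \<and> waiting u = c # x}"
  proof (intro equalityI subsetI)
    fix u assume "u \<in> {u. continuation D u \<and> waiting u = c # x}"
    then have "continuation D u" and wu: "waiting u = c # x" by auto
    from this(1) empty_subsetI show "u \<in> ?h ` (lists (tildes D) \<times> ?U)"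
    proof (cases rule: continuation_split)
      case 1
      then show ?thesis using wu waiting_tildes[of u D] by simp
    next
      case (2 v c' u')
      then have "waiting u = c' # waiting u'" using waiting_tildes[of v D] by (simp add: waiting_append)
      with 2 have "(v, u') \<in> lists (tildes D) \<times> ?U" "u = ?h (v, u')" using wu by auto
      then show ?thesis by blast
    qed
  next
    fix u assume "u \<in> ?h ` (lists (tildes D) \<times> ?U)"
    then show "u \<in> {u. continuation D u \<and> waiting u = c # x}"
    proof (elim imageE SigmaE2)
      fix a assume a: "u = ?h a" "a \<in> lists (tildes D) \<times> ?U"
      obtain v u' where "a = (v, u')" by (cases a)
      with a show ?thesis
        using continuation_append_stays[of v D "{}"] waiting_tildes[of v D] by (simp add: waiting_append)
    qed
  qed
  show ?case
    using has_sum_append_Cons[OF has_sum_tildes[OF Cons.prems] Cons.IH[of "insert c D"] tl]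
    unfolding img by (simp add: mult.commute)
qed

lemma admissible_Cons: "admissible (e # u) \<longleftrightarrow> (\<exists>c. e = Plain (Agent c) \<and> continuation {c} u)"
  unfolding admissible_def trim_def
  by (cases "(\<lambda>e. \<not> is_waiting e, e # u)" rule: prod.exhaust; cases e rule: is_waiting.cases)
    (auto dest: arg_cong[where f = length] simp: le_imp_less_Suc[OF length_dropWhile_le] less_not_refl3)

lemma admissible_Nil [simp]: "admissible []"
  by (simp add: admissible_def trim_def)

lemma has_sum_Cons_image:
  assumes "(weight has_sum a) A"
  shows "(weight has_sum pmf p (letter e) * a) ((#) e ` A)"
  using has_sum_cmult_right[OF assms, of "pmf p (letter e)"]
  by (subst has_sum_reindex) (auto simp: o_def)

text \<open>An admissible state starts with its first waiting agent, so no free word stands in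
  front. The result is the stationary law of the queue up to normalization.\<close>

lemma has_sum_admissible_waiting:
  "(weight has_sum queue_weight {} x) {u. admissible u \<and> waiting u = x}"
proof (cases x)
  case Nil
  have "{u. admissible u \<and> waiting u = []} = {[]}"
  proof -
    have "u = []" if "admissible u" "waiting u = []" for u :: "('c, 's) item entry list"
      using that trim_eq_Nil[of u] unfolding admissible_def by metis
    then show ?thesis by auto
  qed
  then show ?thesis using Nil has_sum_finite[of "{[]}" weight] by simp
next
  case (Cons c y)
  have "{u. admissible u \<and> waiting u = x} = (#) (Plain (Agent c)) ` {u. continuation {c} u \<and> waiting u = y}"
  proof (intro equalityI subsetI)
    fix u assume "u \<in> {u. admissible u \<and> waiting u = x}"
    then show "u \<in> (#) (Plain (Agent c)) ` {u. continuation {c} u \<and> waiting u = y}"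
      using Cons by (cases u) (auto simp: admissible_Cons)
  qed (use Cons in \<open>auto simp: admissible_Cons\<close>)
  then show ?thesis
    using has_sum_Cons_image[OF has_sum_continuation_waiting[of "{c}" y], of "Plain (Agent c)"] Cons by simp
qed

text \<open>The summand of the normalizing constant for one ordering, in recursive form. The
  ordering lists the waiting types by first occurrence; each denominator comes from the free word
  over \<open>stays D D\<close> up to the next new type.\<close>

primrec order_weight :: "'c set \<Rightarrow> 'c list \<Rightarrow> real" where
  "order_weight D [] = 1"
| "order_weight D (c # xs) =
     pmf p (Agent c) / (mass_goods (insert c D) - mass_agents (insert c D)) * order_weight (insert c D) xs"

definition orders :: "'c set \<Rightarrow> 'c list set" where
  "orders D = {xs. distinct xs \<and> set xs \<inter> D = {}}"

lemma finite_orders: "finite (orders D)"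
proof (rule finite_subset)
  show "orders D \<subseteq> {xs. set xs \<subseteq> UNIV \<and> length xs \<le> CARD('c)}"
    unfolding orders_def by (auto simp: distinct_card[symmetric] card_mono)
qed (rule finite_lists_length_le, simp)

lemma sum_orders:
  "(\<Sum>xs\<in>orders D. order_weight D xs) = 1 + (\<Sum>c\<in>- D.
     pmf p (Agent c) / (mass_goods (insert c D) - mass_agents (insert c D)) *
     (\<Sum>xs\<in>orders (insert c D). order_weight (insert c D) xs))"
proof -
  have o: "orders D = insert [] ((\<lambda>(c, xs). c # xs) ` (SIGMA c:- D. orders (insert c D)))"
  proof (intro equalityI subsetI)
    fix xs assume "xs \<in> orders D"
    then show "xs \<in> insert [] ((\<lambda>(c, xs). c # xs) ` (SIGMA c:- D. orders (insert c D)))"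
      by (cases xs) (auto simp: orders_def)
  qed (auto simp: orders_def)
  show ?thesis
    unfolding o
    by (subst sum.insert) (auto simp: finite_orders sum.reindex inj_on_def sum.Sigma
        sum_distrib_left split_def)
qed

text \<open>Induction on the number of types outside \<open>D\<close>: the free word over
  \<open>stays D D\<close> either is everything or is followed by the first waiting agent of a new
  type, which enlarges \<open>D\<close>.\<close>

lemma has_sum_continuation:
  assumes "D \<noteq> {}"
  shows "(weight has_sum (\<Sum>xs\<in>orders D. order_weight D xs) / (mass_goods D - mass_agents D))
    {u. continuation D u}"
  using assms
proof (induction "card (- D)" arbitrary: D rule: less_induct)
  case less
  define m where "m D = (\<Sum>xs\<in>orders D. order_weight D xs) / (mass_goods D - mass_agents D)" for D
  let ?U = "\<lambda>c. {u. continuation (insert c D) u}"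
  let ?h = "\<lambda>c (v, u'). v @ Plain (Agent c) # u'"
  let ?T = "\<lambda>c. ?h c ` (lists (stays D D) \<times> ?U c)"
  have notin: "Plain (Agent c) \<notin> set v" if "v \<in> lists (stays D D)" "c \<notin> D" for v c
    using that by (auto simp: stays_def)
  \<comment> \<open>The decomposition is unique because \<open>v\<close> is the longest prefix over
    \<open>stays D D\<close>.\<close>
  have pre: "v = v' \<and> c = c' \<and> u = u'" if "v \<in> lists (stays D D)" "v' \<in> lists (stays D D)" "c \<notin> D" "c' \<notin> D"
    "v @ Plain (Agent c) # u = v' @ Plain (Agent c') # u'" for v v' c c' u u'
  proof -
    have "takeWhile (\<lambda>e. e \<in> stays D D) (v @ Plain (Agent c) # u) = v"
      "takeWhile (\<lambda>e. e \<in> stays D D) (v' @ Plain (Agent c') # u') = v'"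
      using that(1-4) by (subst takeWhile_append2; auto simp: stays_def)+
    with that(5) have "v = v'" by argo
    with that(5) show ?thesis by simp
  qed
  have T: "(weight has_sum 1 / (mass_goods D - mass_agents D) * (pmf p (Agent c) * m (insert c D))) (?T c)"
    if "c \<in> - D" for c
  proof -
    have "card (- insert c D) < card (- D)"
      using that by (intro psubset_card_mono) auto
    then have IH: "(weight has_sum m (insert c D)) (?U c)"
      unfolding m_def by (intro less.hyps) auto
    have "Plain (Agent c) \<notin> stays D D" using that by (auto simp: stays_def)
    from has_sum_append_Cons[OF has_sum_stays[OF less.prems order_refl] IH this] show ?thesis by simp
  qed
  have disj: "?T c \<inter> ?T c' = {}" if "c \<in> - D" "c' \<in> - D" "c \<noteq> c'" for c c'
  proof (intro equals0I, elim IntE imageE SigmaE2)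
    fix u a b assume "u = ?h c a" "a \<in> lists (stays D D) \<times> ?U c" "u = ?h c' b" "b \<in> lists (stays D D) \<times> ?U c'"
    then show False
      using that pre[of "fst a" "fst b" c c' "snd a" "snd b"] by (simp add: split_def mem_Times_iff)
  qed
  have U: "(weight has_sum (\<Sum>c\<in>- D. 1 / (mass_goods D - mass_agents D) * (pmf p (Agent c) * m (insert c D))))
      (\<Union>c\<in>- D. ?T c)"
    using T disj by (intro has_sum_UN_finite) (auto simp: disjoint_family_on_def)
  have disj2: "lists (stays D D) \<inter> (\<Union>c\<in>- D. ?T c) = {}"
    by (auto simp: stays_def)
  have all: "{u. continuation D u} = lists (stays D D) \<union> (\<Union>c\<in>- D. ?T c)"
  proof (intro equalityI subsetI)
    fix u assume "u \<in> {u. continuation D u}"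
    then have "continuation D u" by simp
    from this order_refl show "u \<in> lists (stays D D) \<union> (\<Union>c\<in>- D. ?T c)"
    proof (cases rule: continuation_split)
      case (2 v c u')
      then have "u \<in> ?T c" by auto
      with 2 show ?thesis by blast
    qed simp
  next
    fix u assume "u \<in> lists (stays D D) \<union> (\<Union>c\<in>- D. ?T c)"
    then show "u \<in> {u. continuation D u}"
    proof (elim UnE UN_E imageE)
      fix c a assume "u = ?h c a" "a \<in> lists (stays D D) \<times> ?U c"
      then show ?thesis
        using continuation_append_stays[of "fst a" D D] by (simp add: split_def mem_Times_iff)
    qed (use continuation_append_stays[of u D D "[]"] in simp)
  qed
  have val: "1 / (mass_goods D - mass_agents D) +
      (\<Sum>c\<in>- D. 1 / (mass_goods D - mass_agents D) * (pmf p (Agent c) * m (insert c D))) = m D"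
    unfolding m_def[of D]
    by (subst sum_orders) (simp add: m_def mult.commute[of "mass_goods D - mass_agents D"] sum_distrib_left add_divide_distrib sum_divide_distrib)
  show ?case
    unfolding all m_def[symmetric] val[symmetric]
    by (rule has_sum_Un_disjoint[OF has_sum_stays[OF less.prems order_refl] U disj2])
qed

definition total_weight :: real where
  "total_weight = (\<Sum>xs\<in>orders {}. order_weight {} xs)"

lemma has_sum_admissible: "(weight has_sum total_weight) {u. admissible u}"
proof -
  define m where "m D = (\<Sum>xs\<in>orders D. order_weight D xs) / (mass_goods D - mass_agents D)" for D
  let ?T = "\<lambda>c. (#) (Plain (Agent c)) ` {u. continuation {c} u}"
  have U: "(weight has_sum (\<Sum>c\<in>UNIV. pmf p (Agent c) * m {c})) (\<Union>c\<in>UNIV. ?T c)"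
  proof (rule has_sum_UN_finite)
    show "(weight has_sum pmf p (Agent c) * m {c}) (?T c)" for c
      using has_sum_Cons_image[OF has_sum_continuation[of "{c}"], of "Plain (Agent c)"] by (simp add: m_def)
  qed (auto simp: disjoint_family_on_def)
  have "{u. admissible u} = {[]} \<union> (\<Union>c\<in>UNIV. ?T c)"
  proof (intro set_eqI)
    fix u show "u \<in> {u. admissible u} \<longleftrightarrow> u \<in> {[]} \<union> (\<Union>c\<in>UNIV. ?T c)"
      by (cases u) (auto simp: admissible_Cons)
  qed
  moreover have "total_weight = 1 + (\<Sum>c\<in>UNIV. pmf p (Agent c) * m {c})"
    unfolding total_weight_def by (subst sum_orders) (simp add: m_def)
  moreover have "(weight has_sum 1) {[]}"
    using has_sum_finite[of "{[]}" weight] by simp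
  moreover have "{[]} \<inter> (\<Union>c\<in>UNIV. ?T c) = {}"
    by auto
  ultimately show ?thesis
    using has_sum_Un_disjoint[where f = weight and a = 1 and A = "{[]}", OF _ U] by simp
qed

lemma total_weight_ge_1: "1 \<le> total_weight"
proof -
  have "0 \<le> order_weight D xs" for D xs
  proof (induction xs arbitrary: D)
    case (Cons c xs)
    then show ?case using mass_less[of "insert c D"] by simp
  qed simp
  then have "0 \<le> pmf p (Agent c) / (mass_goods {c} - mass_agents {c}) *
      (\<Sum>xs\<in>orders {c}. order_weight {c} xs)" for c
    using mass_less[of "{c}"] by (intro mult_nonneg_nonneg divide_nonneg_nonneg sum_nonneg) auto
  then have "0 \<le> (\<Sum>c\<in>UNIV. pmf p (Agent c) / (mass_goods {c} - mass_agents {c}) *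
      (\<Sum>xs\<in>orders {c}. order_weight {c} xs))"
    by (rule sum_nonneg)
  then show ?thesis
    unfolding total_weight_def by (subst sum_orders) simp
qed

lemma order_weight_eq_prod:
  "order_weight D xs = (\<Prod>l = 1..length xs. pmf p (Agent (xs ! (l - 1))) /
     (mass_goods (D \<union> set (take l xs)) - mass_agents (D \<union> set (take l xs))))"
proof (induction xs arbitrary: D)
  case (Cons c xs)
  let ?g = "\<lambda>l. pmf p (Agent ((c # xs) ! (l - 1))) /
     (mass_goods (D \<union> set (take l (c # xs))) - mass_agents (D \<union> set (take l (c # xs))))"
  have "(\<Prod>l = 1..length (c # xs). ?g l) = ?g 1 * (\<Prod>l = 1..length xs. ?g (Suc l))"
    by (simp only: length_Cons prod.atLeast_Suc_atMost[of 1 "Suc (length xs)"] prod.shift_bounds_cl_Suc_ivl)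
  also have "?g 1 = pmf p (Agent c) / (mass_goods (insert c D) - mass_agents (insert c D))"
    by simp
  also have "(\<Prod>l = 1..length xs. ?g (Suc l)) =
     (\<Prod>l = 1..length xs. pmf p (Agent (xs ! (l - 1))) /
     (mass_goods (insert c D \<union> set (take l xs)) - mass_agents (insert c D \<union> set (take l xs))))"
    by (intro prod.cong refl) (auto simp: nth_Cons')
  finally show ?case by (simp only: order_weight.simps Cons)
qed simp

lemma orders_UN: "orders {} = (\<Union>k\<in>{0..CARD('c)}. \<Union>C\<in>{C. card C = k}. permutations_of_set C)"
  by (auto simp: orders_def permutations_of_set_def card_mono)

lemma total_weight_eq:
  "total_weight = (\<Sum>k = 0..CARD('c). \<Sum>C\<in>{C. card C = k}. \<Sum>xs\<in>permutations_of_set C. order_weight {} xs)"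
proof -
  have "(\<Sum>k = 0..CARD('c). \<Sum>C\<in>{C. card C = k}. \<Sum>xs\<in>permutations_of_set C. order_weight {} xs) =
    (\<Sum>k = 0..CARD('c). \<Sum>xs\<in>(\<Union>C\<in>{C. card C = k}. permutations_of_set C). order_weight {} xs)"
    by (intro sum.cong refl sum.UNION_disjoint[symmetric]) (auto dest: permutations_of_setD)
  also have "\<dots> = (\<Sum>xs\<in>orders {}. order_weight {} xs)"
    unfolding orders_UN by (intro sum.UNION_disjoint[symmetric]) (auto dest: permutations_of_setD)
  finally show ?thesis unfolding total_weight_def ..
qed

end

section \<open>Balance equations and uniqueness\<close>

lemma pmf_bind_finite:
  fixes p :: "'i::finite pmf" and F :: "'i \<Rightarrow> 'b pmf"
  shows "measure_pmf.prob (bind_pmf p F) S = (\<Sum>i\<in>UNIV. pmf p i * measure_pmf.prob (F i) S)"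
proof -
  have "measure_pmf.prob M S = pmf (map_pmf (\<lambda>x. x \<in> S) M) True" for M :: "'b pmf"
    by (simp add: pmf_map vimage_def)
  then show ?thesis
    by (simp add: map_bind_pmf pmf_bind integral_measure_pmf_real[of UNIV] mult.commute)
qed

lemma measure_pmf_mono_pointwise:
  assumes "\<And>x. x \<in> X \<Longrightarrow> pmf q x \<le> pmf p x"
  shows "measure_pmf.prob q X \<le> measure_pmf.prob p X"
  unfolding measure_pmf_conv_infsetsum
  by (rule infsetsum_mono) (use assms in \<open>auto simp: pmf_abs_summable\<close>)

lemma measure_pmf_eq_has_sum:
  assumes "(f has_sum a) (A \<inter> B)" "\<And>x. x \<in> A \<inter> B \<Longrightarrow> pmf p x = f x" "\<And>x. x \<notin> B \<Longrightarrow> pmf p x = 0"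
  shows "measure_pmf.prob p A = a"
proof -
  have "measure_pmf.prob p A = infsetsum (pmf p) A"
    by (simp add: measure_pmf_conv_infsetsum)
  also have "\<dots> = infsum (pmf p) A"
    by (intro infsetsum_infsum pmf_abs_summable)
  also have "\<dots> = infsum f (A \<inter> B)"
    using assms(2,3) by (intro infsum_cong_neutral) auto
  also have "\<dots> = a" using assms(1) by (rule infsumI)
  finally show ?thesis .
qed

text \<open>The set where \<open>q\<close> exceeds \<open>q'\<close> maximises the difference of the two measures; by invariance its
  preimages are maximisers too, so it is closed under the dynamics. So is the set where \<open>q'\<close> exceeds
  \<open>q\<close>, and both cannot contain \<open>e\<close>.\<close>

lemma invariant_pmf_unique:
  fixes p :: "'i::finite pmf" and q q' :: "'x pmf"
  assumes inv: "\<And>S. measure_pmf.prob q S = (\<Sum>i\<in>UNIV. pmf p i * measure_pmf.prob q {x. f x i \<in> S})"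
    and inv': "\<And>S. measure_pmf.prob q' S = (\<Sum>i\<in>UNIV. pmf p i * measure_pmf.prob q' {x. f x i \<in> S})"
    and closed: "\<And>A. A \<noteq> {} \<Longrightarrow> (\<And>x i. x \<in> A \<Longrightarrow> 0 < pmf p i \<Longrightarrow> f x i \<in> A) \<Longrightarrow> e \<in> A"
  shows "q = q'"
proof -
  \<comment> \<open>Stated for any pair of laws, as it is applied below to both orders of the two
    given ones.\<close>
  have main: "e \<in> {x. pmf q' x < pmf q x}" if "{x. pmf q' x < pmf q x} \<noteq> {}"
      and inv: "\<And>S. measure_pmf.prob q S = (\<Sum>i\<in>UNIV. pmf p i * measure_pmf.prob q {x. f x i \<in> S})"
      and inv': "\<And>S. measure_pmf.prob q' S = (\<Sum>i\<in>UNIV. pmf p i * measure_pmf.prob q' {x. f x i \<in> S})"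
    for q q' :: "'x pmf"
  proof -
    define A where "A = {x. pmf q' x < pmf q x}"
    define d where "d S = measure_pmf.prob q S - measure_pmf.prob q' S" for S
    have d_split: "d S = d (S \<inter> T) + d (S - T)" for S T
    proof -
      have "measure_pmf.prob r S = measure_pmf.prob r (S \<inter> T) + measure_pmf.prob r (S - T)" for r :: "'x pmf"
        by (subst measure_pmf.finite_measure_Union[symmetric]) (auto simp: Int_Diff_Un)
      then show ?thesis unfolding d_def by simp
    qed
    have d_neg: "d S \<le> 0" if "S \<inter> A = {}" for S
      unfolding d_def using that by (auto simp: A_def not_less intro!: measure_pmf_mono_pointwise)
    have d_pos: "0 \<le> d S" if "S \<subseteq> A" for S
      using measure_pmf_mono_pointwise[of S q' q] that unfolding d_def A_def by force
    have d_pos': "0 < d S" if "S \<subseteq> A" "x \<in> S" for S x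
    proof -
      have "0 < d {x}" using that by (auto simp: d_def A_def measure_pmf_single)
      moreover have "d S = d {x} + d (S - {x})" using d_split[of S "{x}"] that by (simp add: Int_absorb1)
      moreover have "0 \<le> d (S - {x})" using that by (intro d_pos) auto
      ultimately show ?thesis by simp
    qed
    have dS: "d S = d A - d (A - S) + d (S - A)" for S
      using d_split[of S A] d_split[of A S] by (simp add: Int_commute)
    have max: "d S \<le> d A" for S
      using dS[of S] d_pos[OF Diff_subset, of S] d_neg[of "S - A"] by (simp add: Diff_Int_distrib2)
    have sub: "A \<subseteq> S" if "d A \<le> d S" for S
    proof (rule ccontr)
      assume "\<not> A \<subseteq> S"
      then obtain x where "x \<in> A - S" by auto
      then have "0 < d (A - S)" by (intro d_pos') auto
      with that dS[of S] d_neg[of "S - A"] show False by (simp add: Diff_Int_distrib2)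
    qed
    have "d A = (\<Sum>i\<in>UNIV. pmf p i * d {x. f x i \<in> A})"
      unfolding d_def inv[of A] inv'[of A] by (simp add: sum_subtractf right_diff_distrib)
    moreover have "d A = (\<Sum>i\<in>UNIV. pmf p i * d A)"
      by (simp add: sum_distrib_right[symmetric] sum_pmf_eq_1)
    ultimately have "(\<Sum>i\<in>UNIV. pmf p i * (d A - d {x. f x i \<in> A})) = 0"
      by (simp add: right_diff_distrib sum_subtractf)
    \<comment> \<open>An average of numbers that are at most \<open>d A\<close> equals
      \<open>d A\<close>, so every one with positive weight attains it.\<close>
    then have "\<forall>i\<in>UNIV. pmf p i * (d A - d {x. f x i \<in> A}) = 0"
      using max by (subst (asm) sum_nonneg_eq_0_iff) auto
    then have "A \<subseteq> {x. f x i \<in> A}" if "0 < pmf p i" for i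
      using that by (intro sub) (auto dest: spec[of _ i])
    then show ?thesis
      using closed[of A] that(1) unfolding A_def[symmetric] by auto
  qed
  show ?thesis
  proof (rule ccontr)
    assume "q \<noteq> q'"
    have "{x. pmf q' x < pmf q x} \<noteq> {}" if "q \<noteq> q'" for q q' :: "'x pmf"
    proof
      assume "{x. pmf q' x < pmf q x} = {}"
      then have le: "pmf q x \<le> pmf q' x" for x by (auto simp: not_less)
      have "pmf q x = pmf q' x" for x
      proof (rule antisym[OF le])
        \<comment> \<open>Both laws have total mass 1, so the inequality on the complement of
          \<open>x\<close> reverses at \<open>x\<close>.\<close>
        have "measure_pmf.prob q (- {x}) \<le> measure_pmf.prob q' (- {x})"
          by (rule measure_pmf_mono_pointwise) (rule le)
        then show "pmf q' x \<le> pmf q x"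
          by (simp add: measure_pmf.prob_compl[of "{x}", simplified, unfolded Compl_eq_Diff_UNIV[symmetric]] measure_pmf_single)
      qed
      with that show False by (auto intro: pmf_eqI)
    qed
    from main[OF this[OF \<open>q \<noteq> q'\<close>] inv inv'] main[OF this[OF \<open>q \<noteq> q'\<close>[symmetric]] inv' inv]
    show False by simp
  qed
qed

lemma sum_lists_length_Suc:
  fixes f :: "'e::finite list \<Rightarrow> real"
  shows "(\<Sum>v | length v = Suc n. f v) = (\<Sum>e\<in>UNIV. \<Sum>v | length v = n. f (e # v))"
  using sum_lists_Suc[of "UNIV :: 'e set" f n] by simp

lemma finite_lists_length [simp]: "finite {v :: 'e::finite list. length v = n}"
  using finite_lists_length_eq[of "UNIV :: 'e set" n] by simp

context fcfs_model
begin

section \<open>Single transitions between admissible states\<close>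

lemma continuation_append:
  "continuation D (a @ b) \<longleftrightarrow> continuation D a \<and> continuation (D \<union> set (waiting a)) b"
proof (induction D a rule: continuation.induct)
  case (2 D c u)
  then show ?case by simp
qed auto

text \<open>Only good letters are constrained by the types ahead. In the balance equation this
  decides at which position an agent of type \<open>c\<close> may be put back.\<close>

lemma continuation_insert:
  "continuation (insert c D) u \<longleftrightarrow> continuation D u \<and> (\<forall>s. Tilde (Good s) \<in> set u \<longrightarrow> (s, c) \<notin> G)"
proof (induction D u rule: continuation.induct)
  case (2 D c' u)
  then show ?case by (simp add: insert_commute[of c c'])
qed (auto simp: compatible_goods_def)

lemma find_available_None:
  "find (available G s) u = None \<longleftrightarrow> s \<notin> compatible_goods G (set (waiting u))"
  by (auto simp: find_available find_None_iff compatible_goods_def)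

lemma not_available_iff:
  "(\<forall>e\<in>set u. \<not> available G s e) \<longleftrightarrow> s \<notin> compatible_goods G (set (waiting u))"
  using find_available_None[of s u] by (auto simp: find_None_iff)

lemma exchange_step_cases:
  obtains "s \<notin> compatible_goods G (set (waiting u))" "exchange_step G u (Good s) = u @ [Tilde (Good s)]"
  | a c b where "u = a @ Plain (Agent c) # b" "(s, c) \<in> G" "s \<notin> compatible_goods G (set (waiting a))"
      "exchange_step G u (Good s) = a @ Tilde (Good s) # b @ [Tilde (Agent c)]"
proof (cases "find (available G s) u")
  case None
  then have "exchange_step G u (Good s) = u @ [Tilde (Good s)]" by simp
  moreover have "s \<notin> compatible_goods G (set (waiting u))" using None find_available_None[of s u] by blast
  ultimately show ?thesis using that(1) by blast
next
  case (Some e)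
  from find_Some_split[OF this] obtain a b where ab: "u = a @ e # b" "available G s e" "\<forall>e\<in>set a. \<not> available G s e"
    by blast
  then obtain c where c: "e = Plain (Agent c)" "(s, c) \<in> G" by (auto simp: available_def)
  show ?thesis
    using that(2)[of a c b] ab c Some find_append_Cons[OF ab(3,2)] not_available_iff[of a s] by simp
qed

lemma admissible_append: "admissible (a @ b) \<Longrightarrow> a \<noteq> [] \<Longrightarrow> admissible a"
  by (cases a) (auto simp: admissible_Cons continuation_append)

lemma trim_admissible_append: "admissible (a @ b) \<Longrightarrow> a \<noteq> [] \<Longrightarrow> trim (a @ v) = a @ v"
  by (cases a) (auto simp: admissible_Cons trim_def)

lemma continuation_trim: "continuation {} u \<Longrightarrow> continuation {} (trim u)"
  by (metis continuation_append continuation_mono empty_subsetI trim_split)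

text \<open>A match removes a waiting type ahead, which only relaxes the conditions behind it. The
  good moved forward fits nobody further ahead, since it took the first compatible agent.\<close>

lemma admissible_U_step:
  assumes "admissible u"
  shows "admissible (U_step G u i)"
proof -
  have u: "continuation {} u" using assms by (simp add: admissible_def)
  have "continuation {} (exchange_step G u i)"
  proof (cases i)
    case (Agent c)
    with u show ?thesis by (simp add: continuation_append)
  next
    case (Good s)
    show ?thesis
    proof (cases rule: exchange_step_cases[of s u])
      case 1
      with u Good show ?thesis by (simp add: continuation_append)
    next
      case (2 a c b)
      with u have "continuation {} a" "continuation (insert c (set (waiting a))) b"
        by (simp_all add: continuation_append)
      then have "continuation (set (waiting a)) b" by (auto intro: continuation_mono)
      with \<open>continuation {} a\<close> 2 Good show ?thesis by (simp add: continuation_append)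
    qed
  qed
  then show ?thesis unfolding admissible_def U_step_def by (simp add: continuation_trim)
qed

lemma U_step_Agent: "admissible u \<Longrightarrow> U_step G u (Agent c) = u @ [Plain (Agent c)]"
  using trim_admissible_append[of u "[]" "[Plain (Agent c)]"]
  by (cases "u = []") (simp_all add: U_step_def, simp add: trim_def)

text \<open>In the last case below the matched agent was the first one, so the state is truncated.\<close>

lemma U_step_Good_cases:
  assumes "admissible u"
  obtains "u \<noteq> []" "s \<notin> compatible_goods G (set (waiting u))" "U_step G u (Good s) = u @ [Tilde (Good s)]"
  | "U_step G u (Good s) = []"
  | a c b where "u = a @ Plain (Agent c) # b" "(s, c) \<in> G" "a \<noteq> []"
      "U_step G u (Good s) = a @ Tilde (Good s) # b @ [Tilde (Agent c)]"
  | c b where "u = Plain (Agent c) # b" "(s, c) \<in> G" "U_step G u (Good s) = trim b @ [Tilde (Agent c)]"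
proof (cases rule: exchange_step_cases[of s u])
  case 1
  then show ?thesis
  proof (cases "u = []")
    case True
    with 1 show ?thesis using that(2) by (simp add: U_step_def trim_def)
  next
    case False
    with 1 show ?thesis
      using that(1) trim_admissible_append[of u "[]"] assms by (simp add: U_step_def)
  qed
next
  case (2 a c b)
  show ?thesis
  proof (cases "a = []")
    case True
    have eq: "U_step G u (Good s) = trim (b @ [Tilde (Agent c)])"
      using 2 True by (simp add: U_step_def trim_def)
    show ?thesis
    proof (cases "waiting b = []")
      case True
      then have "trim (b @ [Tilde (Agent c)]) = []" by (simp add: trim_append) (simp add: trim_def)
      with eq show ?thesis using that(2) by simp
    next
      case False
      with eq show ?thesis using that(4)[of c b] 2 \<open>a = []\<close> by (simp add: trim_append)
    qed
  next
    case False
    with 2 show ?thesis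
      using that(3)[of a c b] trim_admissible_append[of a "Plain (Agent c) # b"] assms by (simp add: U_step_def)
  qed
qed

section \<open>The normalized weight and its balance equations\<close>

definition stationary_U :: "('c, 's) item entry list pmf" where
  "stationary_U = embed_pmf (\<lambda>u. of_bool (admissible u) * (weight u / total_weight))"

lemma pmf_stationary_U: "pmf stationary_U u = of_bool (admissible u) * (weight u / total_weight)"
proof -
  let ?f = "\<lambda>u. of_bool (admissible u) * (weight u / total_weight)"
  have T: "0 < total_weight" using total_weight_ge_1 by simp
  have nonneg: "0 \<le> ?f u" for u using T weight_nonneg[of u] by simp
  have "((\<lambda>u. weight u / total_weight) has_sum 1) {u. admissible u}"
    using has_sum_cmult_left[OF has_sum_admissible, of "1 / total_weight"] T by simp
  then have hs: "(?f has_sum 1) UNIV"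
    by (subst has_sum_cong_neutral[where T = "{u. admissible u}" and g = "\<lambda>u. weight u / total_weight"]) auto
  then have "(\<lambda>u. norm (?f u)) summable_on UNIV"
    using nonneg has_sum_imp_summable[OF hs] by (simp only: real_norm_def abs_of_nonneg)
  then have abs: "Infinite_Set_Sum.abs_summable_on ?f UNIV"
    by (simp only: abs_summable_equivalent)
  have "(\<integral>\<^sup>+u. ennreal (?f u) \<partial>count_space UNIV) = ennreal (infsetsum ?f UNIV)"
    using abs nonneg by (rule nn_integral_conv_infsetsum)
  also have "infsetsum ?f UNIV = 1"
    using infsetsum_infsum[OF abs] hs by (simp add: infsumI)
  finally show ?thesis
    unfolding stationary_U_def using nonneg by (subst pmf_embed_pmf) auto
qed

lemma prob_stationary_U:
  assumes "(weight has_sum a) {u. admissible u \<and> u \<in> A}"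
  shows "measure_pmf.prob stationary_U A = a / total_weight"
proof (rule measure_pmf_eq_has_sum[where f = "\<lambda>u. weight u / total_weight" and B = "{u. admissible u}"])
  have "{u. admissible u \<and> u \<in> A} = A \<inter> {u. admissible u}" by auto
  then show "((\<lambda>u. weight u / total_weight) has_sum a / total_weight) (A \<inter> {u. admissible u})"
    using has_sum_cmult_left[OF assms, of "1 / total_weight"] by simp
qed (auto simp: pmf_stationary_U)

lemma has_sum_single: "(weight has_sum weight u) {u}"
  using has_sum_finite[of "{u}" weight] by simp

text \<open>Global balance of the weight at \<open>y\<close>. The inflow is summed separately for
  each item, as the predecessors under one item can form an infinite set.\<close>

definition balanced :: "('c, 's) item entry list \<Rightarrow> bool" where
  "balanced y \<longleftrightarrow> (\<exists>a. (\<forall>i. (weight has_sum a i) {u. admissible u \<and> U_step G u i = y}) \<and>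
     (\<Sum>i\<in>UNIV. pmf p i * a i) = weight y)"

lemma balanced_unique_predecessor:
  assumes "\<And>i u. admissible u \<and> U_step G u i = y \<longleftrightarrow> i = j \<and> u = x" "pmf p j * weight x = weight y"
  shows "balanced y"
  unfolding balanced_def
proof (intro exI[of _ "\<lambda>i. if i = j then weight x else 0"] conjI allI)
  fix i show "(weight has_sum (if i = j then weight x else 0)) {u. admissible u \<and> U_step G u i = y}"
    unfolding assms(1) by (cases "i = j") (simp_all add: has_sum_single)
next
  have "(\<Sum>i\<in>UNIV. pmf p i * (if i = j then weight x else 0)) = (\<Sum>i\<in>UNIV. if i = j then pmf p j * weight x else 0)"
    by (intro sum.cong) auto
  then show "(\<Sum>i\<in>UNIV. pmf p i * (if i = j then weight x else 0)) = weight y"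
    by (simp add: assms(2))
qed

text \<open>Predecessors of the empty state under a good are the empty state and the states with a
  single waiting agent compatible with that good. For each type \<open>c\<close> the inflow from the
  latter is \<open>pmf p (Agent c)\<close>, and with the mass of all goods this adds up to
  1.\<close>

lemma balanced_Nil: "balanced []"
proof -
  let ?a = "\<lambda>i. case i of Agent c \<Rightarrow> 0
      | Good s \<Rightarrow> 1 + (\<Sum>c\<in>{c. (s, c) \<in> G}. pmf p (Agent c) / mass_goods {c})"
  have "(weight has_sum ?a i) {u. admissible u \<and> U_step G u i = []}" for i
  proof (cases i)
    case (Agent c)
    then have none: "{u. admissible u \<and> U_step G u i = []} = {}" by (auto simp: U_step_Agent)
    show ?thesis unfolding none using Agent by simp
  next
    case (Good s)
    have "U_step G u i = [] \<longleftrightarrow> waiting u = [] \<or> (\<exists>c. (s, c) \<in> G \<and> waiting u = [c])" for u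
    proof -
      have "U_step G u i = [] \<longleftrightarrow> queue_step G (waiting u) i = []"
        using trim_eq_Nil[of "exchange_step G u i"] by (simp add: U_step_def waiting_exchange_step)
      also have "\<dots> \<longleftrightarrow> waiting u = [] \<or> (\<exists>c. (s, c) \<in> G \<and> waiting u = [c])"
        using Good by (cases "waiting u") auto
      finally show ?thesis .
    qed
    then have set: "{u. admissible u \<and> U_step G u i = []} = {u. admissible u \<and> waiting u = []} \<union>
        (\<Union>c\<in>{c. (s, c) \<in> G}. {u. admissible u \<and> waiting u = [c]})" by auto
    have U: "(weight has_sum (\<Sum>c\<in>C. queue_weight {} [c])) (\<Union>c\<in>C. {u. admissible u \<and> waiting u = [c]})" for C
      by (intro has_sum_UN_finite has_sum_admissible_waiting) (auto simp: disjoint_family_on_def)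
    show ?thesis
      unfolding set using Good
      by (auto intro!: has_sum_Un_disjoint has_sum_admissible_waiting[of "[]", simplified] U[simplified])
  qed
  moreover have "(\<Sum>i\<in>UNIV. pmf p i * ?a i) = weight []"
  proof -
    \<comment> \<open>Summing over the goods before the agents makes the compatible goods of each
      type add up to \<open>mass_goods {c}\<close>, which cancels the denominator.\<close>
    have "(\<Sum>s\<in>UNIV. pmf p (Good s) * (\<Sum>c\<in>{c. (s, c) \<in> G}. pmf p (Agent c) / mass_goods {c})) =
        (\<Sum>s\<in>UNIV. \<Sum>c\<in>UNIV. if (s, c) \<in> G then pmf p (Good s) * (pmf p (Agent c) / mass_goods {c}) else 0)"
      by (intro sum.cong refl) (simp add: sum_distrib_left sum.If_cases)
    also have "\<dots> = (\<Sum>c\<in>UNIV. \<Sum>s\<in>UNIV. if (s, c) \<in> G then pmf p (Good s) * (pmf p (Agent c) / mass_goods {c}) else 0)"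
      by (rule sum.swap)
    also have "\<dots> = (\<Sum>c\<in>UNIV. mass_goods {c} * (pmf p (Agent c) / mass_goods {c}))"
      by (intro sum.cong refl) (simp add: mass_goods_def compatible_goods_def sum_distrib_right sum_divide_distrib sum.If_cases)
    also have "\<dots> = (\<Sum>c\<in>UNIV. pmf p (Agent c))"
      using mass_goods_pos by (intro sum.cong) (auto simp: less_imp_neq[symmetric])
    finally show ?thesis
      using sum_item[of "pmf p"] sum_pmf_eq_1[of UNIV p]
      by (simp add: sum_item distrib_left sum.distrib)
  qed
  ultimately show ?thesis unfolding balanced_def by blast
qed

lemma admissible_snoc:
  assumes "admissible (y @ [e])"
  shows "continuation {} y" "continuation (set (waiting y)) [e]" "y \<noteq> [] \<Longrightarrow> admissible y"
    "y = [] \<Longrightarrow> \<exists>c. e = Plain (Agent c)"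
  using assms admissible_append[of y "[e]"]
  by (auto simp: admissible_def[of "y @ [e]"] continuation_append) (use assms in \<open>simp add: admissible_Cons\<close>)

lemma balanced_snoc_agent:
  assumes "admissible (y @ [Plain (Agent c)])"
  shows "balanced (y @ [Plain (Agent c)])"
proof (rule balanced_unique_predecessor)
  show "admissible u \<and> U_step G u i = y @ [Plain (Agent c)] \<longleftrightarrow> i = Agent c \<and> u = y" for i u
  proof (cases i)
    case (Agent c')
    then show ?thesis using admissible_snoc(3)[OF assms] by (cases "y = []") (auto simp: U_step_Agent)
  next
    case (Good s)
    have "U_step G u (Good s) \<noteq> y @ [Plain (Agent c)]" if "admissible u"
      using that by (cases rule: U_step_Good_cases[of u s]) auto
    with Good show ?thesis by auto
  qed
qed simp

text \<open>A matched good puts the letter of its agent at the end, so a final good letter means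
  that the good was lost and the predecessor is the state without it.\<close>

lemma balanced_snoc_good:
  assumes adm: "admissible (y @ [Tilde (Good s)])"
  shows "balanced (y @ [Tilde (Good s)])"
proof (rule balanced_unique_predecessor)
  have ne: "y \<noteq> []" using admissible_snoc(4)[OF adm] by auto
  then have y: "admissible y" using admissible_snoc(3)[OF adm] by simp
  have "find (available G s) y = None" using admissible_snoc(2)[OF adm] by (simp add: find_available_None)
  then have step: "U_step G y (Good s) = y @ [Tilde (Good s)]"
    using trim_admissible_append[of y "[]" "[Tilde (Good s)]"] y ne by (simp add: U_step_def)
  show "admissible u \<and> U_step G u i = y @ [Tilde (Good s)] \<longleftrightarrow> i = Good s \<and> u = y" for i u
  proof (cases i)
    case (Agent c')
    then show ?thesis by (auto simp: U_step_Agent)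
  next
    case (Good s')
    have "s' = s \<and> u = y" if "admissible u" "U_step G u (Good s') = y @ [Tilde (Good s)]"
      using that(1) by (cases rule: U_step_Good_cases[of u s']) (use that(2) in auto)
    with Good y step show ?thesis by auto
  qed
qed simp

text \<open>The last good was matched with an agent of type \<open>c\<close>. Its position carries the last \<open>Tilde (Good s)\<close>
  with \<open>s\<close> compatible with \<open>c\<close>, if there is one. Otherwise the agent was the first one and the entries
  truncated with it are arbitrary, which gives a geometric series.\<close>

lemma balanced_snoc_matched:
  assumes "admissible y"
  assumes snoc: "y = y' @ [e]" and e: "e = Tilde (Agent c)"
  shows "balanced y"
proof -
  note snoc_facts = admissible_snoc[OF assms(1)[unfolded snoc]]
  note cont = snoc_facts(1,2) and adm' = snoc_facts(3)
  have ne: "y' \<noteq> []" using snoc_facts(4) e by auto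
  have pre: "\<exists>s. i = Good s \<and> (s, c) \<in> G \<and>
      ((\<exists>a b. u = a @ Plain (Agent c) # b \<and> a \<noteq> [] \<and> y' = a @ Tilde (Good s) # b) \<or>
       (\<exists>b. u = Plain (Agent c) # b \<and> trim b = y'))"
    if "admissible u" "U_step G u i = y" for u i
  proof (cases i)
    case (Agent c')
    with that e snoc show ?thesis by (simp add: U_step_Agent)
  next
    case (Good s)
    show ?thesis
      using that(1) by (cases rule: U_step_Good_cases[of u s]) (use e snoc Good that(2) in auto)
  qed
  have after: "(s, c) \<notin> G" if "admissible (a @ Plain (Agent c) # b)" "Tilde (Good s) \<in> set b" for a b s
    using that by (auto simp: admissible_def continuation_append continuation_insert)
  let ?Q = "\<lambda>e. \<exists>s. e = Tilde (Good s) \<and> (s, c) \<in> G"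
  show ?thesis
  proof (cases "\<exists>e\<in>set y'. ?Q e")
    case True
    from split_list_last_prop[OF this] obtain a e' b where split: "y' = a @ e' # b" "?Q e'" "\<forall>e\<in>set b. \<not> ?Q e"
      by blast
    then obtain s where s: "e' = Tilde (Good s)" "(s, c) \<in> G" by blast
    have a: "a \<noteq> []" using adm'[OF ne] split s by (auto simp: admissible_Cons)
    let ?x = "a @ Plain (Agent c) # b"
    have only: "i = Good s \<and> u = ?x" if u: "admissible u" "U_step G u i = y" for u i
    proof -
      from pre[OF u] obtain s' where s': "i = Good s'" "(s', c) \<in> G"
        and "(\<exists>a b. u = a @ Plain (Agent c) # b \<and> a \<noteq> [] \<and> y' = a @ Tilde (Good s') # b) \<or>
          (\<exists>b. u = Plain (Agent c) # b \<and> trim b = y')" by blast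
      then consider a' b' where "u = a' @ Plain (Agent c) # b'" "y' = a' @ Tilde (Good s') # b'"
        | b' where "u = Plain (Agent c) # b'" "trim b' = y'" by blast
      then show ?thesis
      proof cases
        case (1 a' b')
        \<comment> \<open>Behind the waiting agent no compatible good letter can stand, so
          \<open>s'\<close> also marks the last compatible one and the two splittings
          coincide.\<close>
        have "\<forall>e\<in>set b'. \<not> ?Q e" using after[of a' b'] u(1) 1 by auto
        then have "a = a' \<and> e' = Tilde (Good s') \<and> b = b'"
          using split_list_last_unique[of a e' b a' "Tilde (Good s')" b' ?Q] split s' 1(2) by auto
        with 1 s s' show ?thesis by simp
      next
        case (2 b')
        \<comment> \<open>Had the agent stood first and been truncated, the letter \<open>e'\<close>
          would stand behind a waiting agent compatible with it.\<close>
        have "e' \<in> set b'"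
          using split 2(2) by (metis in_set_conv_decomp trim_split Un_iff set_append)
        then have "(s, c) \<notin> G" using after[of "[]" b'] u(1) 2 s by auto
        with s show ?thesis by simp
      qed
    qed
    have "admissible ?x"
    proof -
      have "trim ?x = ?x" using trim_admissible_append[of a "e' # b"] adm'[OF ne] split a by simp
      moreover have "continuation {} ?x"
        using cont(1) split s by (auto simp: continuation_append continuation_insert)
      ultimately show ?thesis by (simp add: admissible_def)
    qed
    moreover have "U_step G ?x (Good s) = y"
    proof -
      have "s \<notin> compatible_goods G (set (waiting a))"
        using cont(1) split s by (simp add: continuation_append)
      then have "\<forall>e\<in>set a. \<not> available G s e" by (simp add: not_available_iff)
      moreover have "available G s (Plain (Agent c))" using s by (simp add: available_def)
      ultimately have "exchange_step G ?x (Good s) = a @ Tilde (Good s) # b @ [Tilde (Agent c)]"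
        by (simp add: find_append_Cons)
      then show ?thesis
        using trim_admissible_append[of a "e' # b"] adm'[OF ne] split a s e snoc by (simp add: U_step_def)
    qed
    ultimately have "admissible u \<and> U_step G u i = y \<longleftrightarrow> i = Good s \<and> u = ?x" for i u
      using only by blast
    then show ?thesis
      by (rule balanced_unique_predecessor) (use split s e snoc in auto)
  next
    case False
    let ?h = "\<lambda>v. Plain (Agent c) # v @ y'"
    let ?a = "\<lambda>i. case i of Agent c \<Rightarrow> 0
      | Good s \<Rightarrow> of_bool ((s, c) \<in> G) * (pmf p (Agent c) * (weight y' / mass_goods {c}))"
    \<comment> \<open>The lost prefix is the agent followed by a free word \<open>v\<close> behind
      the single waiting type \<open>c\<close>.\<close>
    have set: "{u. admissible u \<and> U_step G u (Good s) = y} = ?h ` lists (tildes {c})" if sc: "(s, c) \<in> G" for s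
    proof (intro equalityI subsetI)
      fix u assume "u \<in> {u. admissible u \<and> U_step G u (Good s) = y}"
      then have u: "admissible u" "U_step G u (Good s) = y" by auto
      from pre[OF u] obtain b where b: "u = Plain (Agent c) # b" "trim b = y'"
        using False by auto
      obtain v where v: "b = v @ y'" "waiting v = []" using trim_split b(2) by metis
      have "continuation {c} v"
        using u(1) b(1) v by (simp add: admissible_Cons continuation_append)
      from this empty_subsetI have "v \<in> lists (tildes {c})"
        by (cases rule: continuation_split) (use v(2) in \<open>auto simp: waiting_append\<close>)
      then show "u \<in> ?h ` lists (tildes {c})" using b v by blast
    next
      fix u assume "u \<in> ?h ` lists (tildes {c})"
      then obtain v where v: "u = ?h v" "v \<in> lists (tildes {c})" by blast
      have "continuation {c} y'" using cont(1) False by (auto simp: continuation_insert)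
      then have "admissible u" using v by (simp add: admissible_Cons continuation_append_stays del: in_lists_conv_set)
      moreover have "U_step G u (Good s) = y"
      proof -
        have "exchange_step G u (Good s) = (Tilde (Good s) # v) @ y' @ [Tilde (Agent c)]"
          using v(1) sc by (simp add: available_def)
        moreover have "waiting (Tilde (Good s) # v) = []" using waiting_tildes[OF v(2)] by simp
        moreover have "trim (y' @ [Tilde (Agent c)]) = y' @ [Tilde (Agent c)]"
          using trim_admissible_append[of y' "[]"] adm'[OF ne] ne by simp
        ultimately show ?thesis unfolding U_step_def using snoc e trim_append by metis
      qed
      ultimately show "u \<in> {u. admissible u \<and> U_step G u (Good s) = y}" by simp
    qed
    have hs: "(weight has_sum pmf p (Agent c) * (weight y' / mass_goods {c})) (?h ` lists (tildes {c}))"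
    proof -
      have "((\<lambda>v. pmf p (Agent c) * (weight v * weight y')) has_sum
          pmf p (Agent c) * (1 / mass_goods {c} * weight y')) (lists (tildes {c}))"
        by (intro has_sum_cmult_right has_sum_cmult_left has_sum_tildes) simp
      then show ?thesis
        by (subst has_sum_reindex) (auto simp: inj_on_def o_def)
    qed
    have "(weight has_sum ?a i) {u. admissible u \<and> U_step G u i = y}" for i
    proof (cases "\<exists>s. i = Good s \<and> (s, c) \<in> G")
      case True
      then show ?thesis using set hs by auto
    next
      case False
      then have none: "{u. admissible u \<and> U_step G u i = y} = {}" using pre by blast
      show ?thesis unfolding none using False by (auto split: item.splits)
    qed
    moreover have "(\<Sum>i\<in>UNIV. pmf p i * ?a i) = weight y"
    proof -
      have "(\<Sum>i\<in>UNIV. pmf p i * ?a i) =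
          (\<Sum>s\<in>UNIV. if (s, c) \<in> G then pmf p (Good s) else 0) * (pmf p (Agent c) * (weight y' / mass_goods {c}))"
        unfolding sum_item sum_distrib_right by (auto intro!: sum.cong)
      \<comment> \<open>Every compatible good has the same set of predecessors, so their masses add
        up and cancel the geometric series.\<close>
      also have "(\<Sum>s\<in>UNIV. if (s, c) \<in> G then pmf p (Good s) else 0) = mass_goods {c}"
        by (simp add: mass_goods_def compatible_goods_def sum.If_cases)
      finally show ?thesis using mass_goods_pos[of "{c}"] snoc e by simp
    qed
    ultimately show ?thesis unfolding balanced_def by blast
  qed
qed

lemma balance:
  assumes "admissible y"
  shows "balanced y"
proof (cases y rule: rev_cases)
  case (snoc y' e)
  note snoc_facts = admissible_snoc[OF assms[unfolded snoc]]
  consider c where "e = Plain (Agent c)" | s where "e = Tilde (Good s)" | c where "e = Tilde (Agent c)"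
    using snoc_facts(2) by (cases "({} :: 'c set, [e])" rule: continuation.cases) auto
  then show ?thesis
    using assms snoc balanced_snoc_agent balanced_snoc_good balanced_snoc_matched[OF assms snoc] by cases auto
qed (simp add: balanced_Nil)

lemma stationary_U_invariant:
  "measure_pmf.prob stationary_U S = (\<Sum>i\<in>UNIV. pmf p i * measure_pmf.prob stationary_U {u. U_step G u i \<in> S})"
proof -
  have "pmf (bind_pmf p (\<lambda>i. map_pmf (\<lambda>u. U_step G u i) stationary_U)) y = pmf stationary_U y" for y
  proof -
    have "\<exists>a. (\<forall>i. (weight has_sum a i) {u. admissible u \<and> U_step G u i = y}) \<and>
      (\<Sum>i\<in>UNIV. pmf p i * a i) = of_bool (admissible y) * weight y"
    proof (cases "admissible y")
      case True
      then show ?thesis using balance by (simp add: balanced_def)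
    next
      case False
      then have none: "{u. admissible u \<and> U_step G u i = y} = {}" for i using admissible_U_step by auto
      show ?thesis unfolding none using False by (intro exI[of _ "\<lambda>_. 0"]) auto
    qed
    then obtain a where a: "\<And>i. (weight has_sum a i) {u. admissible u \<and> U_step G u i = y}"
      "(\<Sum>i\<in>UNIV. pmf p i * a i) = of_bool (admissible y) * weight y" by blast
    have "measure_pmf.prob (map_pmf (\<lambda>u. U_step G u i) stationary_U) {y} = a i / total_weight" for i
      using a(1)[of i] by (simp add: vimage_def prob_stationary_U)
    then have "pmf (bind_pmf p (\<lambda>i. map_pmf (\<lambda>u. U_step G u i) stationary_U)) y =
        (\<Sum>i\<in>UNIV. pmf p i * a i) / total_weight"
      using pmf_bind_finite[of p _ "{y}"] by (simp add: measure_pmf_single sum_divide_distrib)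
    then show ?thesis by (simp add: a(2) pmf_stationary_U)
  qed
  then have eq: "bind_pmf p (\<lambda>i. map_pmf (\<lambda>u. U_step G u i) stationary_U) = stationary_U"
    by (rule pmf_eqI)
  have "measure_pmf.prob stationary_U S =
      measure_pmf.prob (bind_pmf p (\<lambda>i. map_pmf (\<lambda>u. U_step G u i) stationary_U)) S"
    unfolding eq ..
  then show ?thesis by (simp add: pmf_bind_finite vimage_def)
qed

lemma exists_compatible_good: "\<exists>s. (s, c) \<in> G \<and> 0 < pmf p (Good s)"
proof (rule ccontr)
  assume "\<not> ?thesis"
  then have "pmf p (Good s) = 0" if "s \<in> compatible_goods G {c}" for s
    using that by (auto simp: compatible_goods_def pmf_eq_0_set_pmf pmf_positive_iff)
  then have "mass_goods {c} = 0" unfolding mass_goods_def by simp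
  with mass_goods_pos[of "{c}"] show False by simp
qed

lemma invariant_U_unique:
  assumes "\<And>S. measure_pmf.prob q S = (\<Sum>i\<in>UNIV. pmf p i * measure_pmf.prob q {u. U_step G u i \<in> S})"
  shows "q = stationary_U"
proof (rule invariant_pmf_unique[OF assms stationary_U_invariant])
  fix A :: "('c, 's) item entry list set"
  assume "A \<noteq> {}" and closed: "\<And>u i. u \<in> A \<Longrightarrow> 0 < pmf p i \<Longrightarrow> U_step G u i \<in> A"
  then obtain u where "u \<in> A" by blast
  then show "[] \<in> A"
  proof (induction "length (waiting u)" arbitrary: u rule: less_induct)
    case less
    show ?case
    proof (cases "waiting u")
      case Nil
      obtain s where s: "0 < pmf p (Good s)" using exists_compatible_good by blast
      \<comment> \<open>Admissibility of \<open>u\<close> is not known here: a list without waiting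
        agents may be nonempty, and one more step trims it away.\<close>
      have "U_step G u (Good s) = []"
        unfolding U_step_def trim_eq_Nil waiting_exchange_step Nil by simp
      with closed[OF less.prems s] show ?thesis by simp
    next
      case (Cons c x)
      obtain s where s: "(s, c) \<in> G" "0 < pmf p (Good s)" using exists_compatible_good by blast
      then have "length (waiting (U_step G u (Good s))) < length (waiting u)"
        unfolding waiting_U_step Cons by simp
      from less.hyps[OF this closed[OF less.prems s(2)]] show ?thesis .
    qed
  qed
qed

section \<open>Several items at once and the probability of an empty queue\<close>

definition item_weight :: "('c, 's) item list \<Rightarrow> real" where
  "item_weight zs = prod_list (map (pmf p) zs)"

lemma item_weight_simps [simp]: "item_weight [] = 1" "item_weight (i # zs) = pmf p i * item_weight zs"
  by (simp_all add: item_weight_def)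

lemma item_weight_nonneg: "0 \<le> item_weight zs"
  by (induction zs) auto

lemma stationary_U_iterate:
  "measure_pmf.prob stationary_U S =
    (\<Sum>zs | length zs = n. item_weight zs * measure_pmf.prob stationary_U {u. foldl (U_step G) u zs \<in> S})"
proof (induction n arbitrary: S)
  case 0
  have "{zs :: ('c, 's) item list. length zs = 0} = {[]}" by auto
  then show ?case by simp
next
  case (Suc n)
  let ?m = "measure_pmf.prob stationary_U"
  have "(\<Sum>zs | length zs = Suc n. item_weight zs * ?m {u. foldl (U_step G) u zs \<in> S}) =
      (\<Sum>i\<in>UNIV. \<Sum>zs | length zs = n. item_weight zs * (pmf p i * ?m {u. U_step G u i \<in> {u. foldl (U_step G) u zs \<in> S}}))"
    by (subst sum_lists_length_Suc) (simp add: mult_ac)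
  also have "\<dots> = (\<Sum>zs | length zs = n. \<Sum>i\<in>UNIV. item_weight zs * (pmf p i * ?m {u. U_step G u i \<in> {u. foldl (U_step G) u zs \<in> S}}))"
    by (rule sum.swap)
  also have "\<dots> = (\<Sum>zs | length zs = n. item_weight zs * ?m {u. foldl (U_step G) u zs \<in> S})"
  proof (intro sum.cong refl)
    fix zs :: "('c, 's) item list"
    show "(\<Sum>i\<in>UNIV. item_weight zs * (pmf p i * ?m {u. U_step G u i \<in> {u. foldl (U_step G) u zs \<in> S}})) =
        item_weight zs * ?m {u. foldl (U_step G) u zs \<in> S}"
      unfolding sum_distrib_left[symmetric]
      by (subst stationary_U_invariant[of "{u. foldl (U_step G) u zs \<in> S}"]) (rule refl)
  qed
  finally show ?case by (subst Suc.IH) (rule sym)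
qed

lemma prob_empty_lower_bound:
  "1 / total_weight \<le> (\<Sum>zs | length zs = n. item_weight zs * of_bool (foldl (queue_step G) [] zs = []))"
proof -
  have "1 / total_weight = measure_pmf.prob stationary_U {u. waiting u = []}"
    using has_sum_admissible_waiting[of "[]"] by (intro prob_stationary_U[symmetric]) simp
  also have "\<dots> = (\<Sum>zs | length zs = n. item_weight zs *
      measure_pmf.prob stationary_U {u. foldl (queue_step G) (waiting u) zs = []})"
    by (subst stationary_U_iterate[of _ n]) (simp add: waiting_foldl_U_step)
  also have "\<dots> \<le> (\<Sum>zs | length zs = n. item_weight zs * of_bool (foldl (queue_step G) [] zs = []))"
  proof (intro sum_mono mult_left_mono item_weight_nonneg)
    fix zs
    have "foldl (queue_step G) [] zs = []" if "foldl (queue_step G) x zs = []" for x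
      using subseq_foldl_queue_step[of "[]" x G zs] that by simp
    then have none: "{u. foldl (queue_step G) (waiting u) zs = []} = {}" if "foldl (queue_step G) [] zs \<noteq> []"
      using that by auto
    show "measure_pmf.prob stationary_U {u. foldl (queue_step G) (waiting u) zs = []} \<le>
        of_bool (foldl (queue_step G) [] zs = [])"
    proof (cases "foldl (queue_step G) [] zs = []")
      case False
      show ?thesis unfolding none[OF False] by simp
    qed simp
  qed
  finally show ?thesis .
qed

text \<open>The order-independence identity behind the law of \<open>W\<close>: \<open>H\<close> is evaluated at the queue from
  which an agent of type \<open>c\<close>, the first one compatible with the arriving good, has been removed. The
  general \<open>D\<close> is needed for the induction; for \<open>D = {}\<close> the second term vanishes.\<close>

lemma sum_remove_first:
  "(\<Sum>x | length x = Suc n. queue_weight D x * (\<Sum>s\<in>- compatible_goods G D. pmf p (Good s) *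
      (of_bool (find (\<lambda>c. (s, c) \<in> G) x = Some c) * H (remove_first (\<lambda>c. (s, c) \<in> G) x)))) =
   pmf p (Agent c) * ((\<Sum>x | length x = n. queue_weight D x * H x) -
      mass_goods D / mass_goods (insert c D) * (\<Sum>x | length x = n. queue_weight (insert c D) x * H x))"
proof -
  let ?f = "\<lambda>s. find (\<lambda>c. (s, c) \<in> G)" and ?r = "\<lambda>s. remove_first (\<lambda>c. (s, c) \<in> G)"
  let ?S = "compatible_goods G" and ?P = "\<lambda>s. pmf p (Good s)"
  define I where "I D H x = (\<Sum>s\<in>- ?S D. ?P s * (of_bool (?f s x = Some c) * H (?r s x)))"
    for D and H :: "'c list \<Rightarrow> real" and x
  \<comment> \<open>Goods that fit nobody in \<open>D\<close> either fit the head \<open>a\<close>,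
    which is then the agent removed, or search on with \<open>a\<close> added to the types
    ahead.\<close>
  have I_Cons: "I D H (a # x) = (mass_goods (insert a D) - mass_goods D) * (of_bool (a = c) * H x) +
      I (insert a D) (\<lambda>x. H (a # x)) x" for D H a x
  proof -
    have split: "- ?S D = (?S {a} - ?S D) \<union> - ?S (insert a D)" and ins: "?S (insert a D) = ?S D \<union> (?S {a} - ?S D)"
      by (auto simp: compatible_goods_def)
    have "I D H (a # x) = (\<Sum>s\<in>?S {a} - ?S D. ?P s * (of_bool (?f s (a # x) = Some c) * H (?r s (a # x)))) +
        (\<Sum>s\<in>- ?S (insert a D). ?P s * (of_bool (?f s (a # x) = Some c) * H (?r s (a # x))))"
      unfolding I_def by (subst split, subst sum.union_disjoint) (auto simp: compatible_goods_def)
    also have "(\<Sum>s\<in>?S {a} - ?S D. ?P s * (of_bool (?f s (a # x) = Some c) * H (?r s (a # x)))) =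
        (\<Sum>s\<in>?S {a} - ?S D. ?P s) * (of_bool (a = c) * H x)"
      unfolding sum_distrib_right by (intro sum.cong refl) (auto simp: compatible_goods_def)
    also have "(\<Sum>s\<in>?S {a} - ?S D. ?P s) = mass_goods (insert a D) - mass_goods D"
      unfolding mass_goods_def ins by (subst sum.union_disjoint) auto
    also have "(\<Sum>s\<in>- ?S (insert a D). ?P s * (of_bool (?f s (a # x) = Some c) * H (?r s (a # x)))) =
        I (insert a D) (\<lambda>x. H (a # x)) x"
      unfolding I_def by (intro sum.cong refl) (auto simp: compatible_goods_def)
    finally show ?thesis .
  qed
  have step: "(\<Sum>x | length x = Suc n. queue_weight D x * I D H x) =
      pmf p (Agent c) * (1 - mass_goods D / mass_goods (insert c D)) *
        (\<Sum>x | length x = n. queue_weight (insert c D) x * H x) +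
      (\<Sum>a\<in>UNIV. pmf p (Agent a) / mass_goods (insert a D) *
        (\<Sum>x | length x = n. queue_weight (insert a D) x * I (insert a D) (\<lambda>x. H (a # x)) x))" for n D H
  proof -
    let ?q = "\<lambda>a. pmf p (Agent a) / mass_goods (insert a D)"
    have "(\<Sum>x | length x = Suc n. queue_weight D x * I D H x) =
      (\<Sum>a\<in>UNIV. \<Sum>x | length x = n.
        of_bool (a = c) * (?q c * (mass_goods (insert c D) - mass_goods D) * (queue_weight (insert c D) x * H x)) +
        ?q a * (queue_weight (insert a D) x * I (insert a D) (\<lambda>x. H (a # x)) x))"
      unfolding sum_lists_length_Suc
    proof (intro sum.cong refl)
      fix a x
      have gen: "(k * y) * (m * (b * h) + i) = b * (k * m * (y * h)) + k * (y * i)" for k y m b h i :: real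
        by (simp add: algebra_simps)
      show "queue_weight D (a # x) * I D H (a # x) =
        of_bool (a = c) * (?q c * (mass_goods (insert c D) - mass_goods D) * (queue_weight (insert c D) x * H x)) +
        ?q a * (queue_weight (insert a D) x * I (insert a D) (\<lambda>x. H (a # x)) x)"
        unfolding queue_weight.simps I_Cons gen by (cases "a = c") simp_all
    qed
    also have "\<dots> = (\<Sum>a\<in>UNIV. of_bool (a = c) * (?q c * (mass_goods (insert c D) - mass_goods D) *
          (\<Sum>x | length x = n. queue_weight (insert c D) x * H x)) +
        ?q a * (\<Sum>x | length x = n. queue_weight (insert a D) x * I (insert a D) (\<lambda>x. H (a # x)) x))"
      by (simp add: sum.distrib sum_distrib_left)
    also have "\<dots> = ?q c * (mass_goods (insert c D) - mass_goods D) *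
          (\<Sum>x | length x = n. queue_weight (insert c D) x * H x) +
        (\<Sum>a\<in>UNIV. ?q a * (\<Sum>x | length x = n. queue_weight (insert a D) x * I (insert a D) (\<lambda>x. H (a # x)) x))"
    proof -
      have "(\<Sum>a\<in>UNIV. of_bool (a = c) * k) = k" for k :: real
        by (simp add: sum_distrib_right[symmetric] of_bool_def)
      then show ?thesis by (simp only: sum.distrib)
    qed
    also have "?q c * (mass_goods (insert c D) - mass_goods D) =
        pmf p (Agent c) * (1 - mass_goods D / mass_goods (insert c D))"
      using mass_goods_pos[of "insert c D"] by (simp add: field_simps)
    finally show ?thesis .
  qed
  have "(\<Sum>x | length x = Suc n. queue_weight D x * I D H x) =
   pmf p (Agent c) * ((\<Sum>x | length x = n. queue_weight D x * H x) -
      mass_goods D / mass_goods (insert c D) * (\<Sum>x | length x = n. queue_weight (insert c D) x * H x))"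
  proof (induction n arbitrary: D H)
    case 0
    have "{x :: 'c list. length x = 0} = {[]}" by auto
    then show ?case unfolding step by (simp add: I_def algebra_simps)
  next
    case (Suc n)
    let ?q = "\<lambda>a. pmf p (Agent a) / mass_goods (insert a D)"
    have "?q a * (\<Sum>x | length x = Suc n. queue_weight (insert a D) x * I (insert a D) (\<lambda>x. H (a # x)) x) =
        pmf p (Agent c) * (\<Sum>x | length x = n. queue_weight D (a # x) * H (a # x)) -
        pmf p (Agent c) * (\<Sum>x | length x = n. queue_weight (insert c D) (a # x) * H (a # x))" for a
    proof -
      let ?A = "\<Sum>x | length x = n. queue_weight (insert a D) x * H (a # x)"
      let ?B = "\<Sum>x | length x = n. queue_weight (insert a (insert c D)) x * H (a # x)"
      have "?q a * (pmf p (Agent c) * (?A - mass_goods (insert a D) / mass_goods (insert a (insert c D)) * ?B)) =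
          pmf p (Agent c) * (?q a * ?A) - pmf p (Agent c) * (pmf p (Agent a) / mass_goods (insert a (insert c D)) * ?B)"
        using mass_goods_pos[of "insert a D"] by (simp add: field_simps)
      then show ?thesis
        unfolding Suc.IH by (simp add: sum_distrib_left mult.assoc insert_commute[of c a])
    qed
    then have "(\<Sum>a\<in>UNIV. ?q a * (\<Sum>x | length x = Suc n. queue_weight (insert a D) x * I (insert a D) (\<lambda>x. H (a # x)) x)) =
        pmf p (Agent c) * (\<Sum>x | length x = Suc n. queue_weight D x * H x) -
        pmf p (Agent c) * (\<Sum>x | length x = Suc n. queue_weight (insert c D) x * H x)"
      unfolding sum_lists_length_Suc by (simp only: sum_subtractf sum_distrib_left)
    \<comment> \<open>The telescoping: the sum with \<open>insert c D\<close> produced by the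
      induction hypothesis cancels the part of the first term of \<open>step\<close> that comes from
      the 1.\<close>
    then show ?case
      unfolding step[where n = "Suc n"] by (simp add: algebra_simps)
  qed
  then show ?thesis unfolding I_def .
qed

text \<open>The probability that the next \<open>length u\<close> items serve the queue
  \<open>x\<close> completely and show the entries \<open>u\<close>, as a recursion over
  \<open>u\<close>; see \<open>sum_finishes\<close>.\<close>

fun serve_prob :: "'c list \<Rightarrow> ('c, 's) item entry list \<Rightarrow> real" where
  "serve_prob x [] = of_bool (x = [])"
| "serve_prob x (Plain (Agent c) # u) = pmf p (Agent c) * serve_prob x u"
| "serve_prob x (Plain (Good s) # u) =
     pmf p (Good s) * (of_bool (find (\<lambda>c. (s, c) \<in> G) x = None) * serve_prob x u)"
| "serve_prob x (Tilde (Agent c) # u) = (\<Sum>s\<in>UNIV. pmf p (Good s) *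
     (of_bool (find (\<lambda>c. (s, c) \<in> G) x = Some c) * serve_prob (remove_first (\<lambda>c. (s, c) \<in> G) x) u))"
| "serve_prob x (Tilde (Good s) # u) = 0"

text \<open>Every agent of the queue must appear in \<open>u\<close> as an exchanged letter.
  Conditions on the contents of \<open>x\<close> thereby become conditions on
  \<open>u\<close>.\<close>

lemma set_serve_prob:
  "serve_prob x u \<noteq> 0 \<Longrightarrow> set x = {c. Tilde (Agent c) \<in> set u} \<and> length x = length (filter is_tilde u)"
proof (induction x u rule: serve_prob.induct)
  case (4 x c u)
  then obtain s where s: "find (\<lambda>c. (s, c) \<in> G) x = Some c" "serve_prob (remove_first (\<lambda>c. (s, c) \<in> G) x) u \<noteq> 0"
    by (auto elim!: sum.not_neutral_contains_not_neutral)
  from find_Some_split[OF s(1)] obtain a b where ab: "x = a @ c # b" "(s, c) \<in> G" "\<forall>c\<in>set a. (s, c) \<notin> G"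
    by blast
  have "remove_first (\<lambda>c. (s, c) \<in> G) x = a @ b"
    unfolding ab(1) by (rule find_append_Cons) (use ab in auto)
  with "4.IH"[of s] s(2) ab(1) show ?case by auto
qed auto

text \<open>The value 0 is for lists that no queue can produce. An exchanged agent letter is handled
  by \<open>sum_remove_first\<close> with \<open>D = {}\<close>, where the sum over queues one
  longer collapses to that for the remaining entries.\<close>

lemma sum_serve_prob:
  "(\<Sum>x | length x = length (filter is_tilde u). queue_weight {} x * serve_prob x u) \<in> {0, weight u}"
proof (induction u)
  case Nil
  have "{x :: 'c list. length x = 0} = {[]}" by auto
  then show ?case by simp
next
  case (Cons e u)
  let ?F = "\<lambda>u. \<Sum>x | length x = length (filter is_tilde u). queue_weight {} x * serve_prob x u"
  consider c where "e = Plain (Agent c)" | s where "e = Plain (Good s)" | c where "e = Tilde (Agent c)"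
    | s where "e = Tilde (Good s)"
    by (metis entry.exhaust item.exhaust)
  then show ?case
  proof cases
    case (1 c)
    then have "?F (e # u) = pmf p (Agent c) * ?F u"
      by (simp add: sum_distrib_left mult.left_commute)
    with Cons 1 show ?thesis by auto
  next
    case (2 s)
    let ?b = "of_bool (\<forall>c. Tilde (Agent c) \<in> set u \<longrightarrow> (s, c) \<notin> G) :: real"
    \<comment> \<open>The condition that the good fits nobody in \<open>x\<close> is expressed by
      \<open>u\<close> alone, so it can be taken out of the sum over \<open>x\<close>.\<close>
    have eq: "of_bool (find (\<lambda>c. (s, c) \<in> G) x = None) * serve_prob x u = ?b * serve_prob x u" for x
      using set_serve_prob[of x u] by (cases "serve_prob x u = 0") (auto simp: find_None_iff)
    have "queue_weight {} x * serve_prob x (e # u) = pmf p (Good s) * (?b * (queue_weight {} x * serve_prob x u))" for x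
      unfolding 2 serve_prob.simps eq by (rule trans[OF mult.left_commute]) (simp only: mult.left_commute)
    then have "?F (e # u) = pmf p (Good s) * (?b * ?F u)"
      using 2 by (simp only: sum_distrib_left) simp
    with Cons 2 show ?thesis by auto
  next
    case (3 c)
    have "?F (e # u) = pmf p (Agent c) * ?F u"
      using 3 sum_remove_first[where n = "length (filter is_tilde u)" and D = "{}" and c = c and H = "\<lambda>x. serve_prob x u"]
      by (simp add: compatible_goods_def)
    with Cons 3 show ?thesis by auto
  qed simp
qed

end

section \<open>The path space and the law of U\<close>

lemma pmf_of_random_variable:
  fixes Y :: "'a \<Rightarrow> 'b::countable"
  assumes "prob_space N" "Y \<in> measurable N (count_space UNIV)"
  shows "\<exists>q. \<forall>S. measure_pmf.prob q S = measure N {w \<in> space N. Y w \<in> S}"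
proof -
  interpret N: prob_space N by fact
  define D where "D = distr N (count_space UNIV) Y"
  interpret D: prob_space D unfolding D_def using assms(2) by (rule N.prob_space_distr)
  have sets_D [simp]: "sets D = UNIV" "space D = UNIV" by (simp_all add: D_def)
  have D: "measure D S = measure N {w \<in> space N. Y w \<in> S}" for S
    unfolding D_def using assms(2) by (subst measure_distr) (auto intro!: arg_cong[where f = "measure N"])
  define f where "f x = measure D {x}" for x
  have "(\<integral>\<^sup>+x. ennreal (f x) \<partial>count_space UNIV) = (\<integral>\<^sup>+x. emeasure D {x} \<partial>count_space UNIV)"
    by (simp add: f_def D.emeasure_eq_measure)
  also have "\<dots> = emeasure D UNIV"
    by (rule emeasure_countable_singleton[symmetric]) auto
  also have "\<dots> = 1" using D.emeasure_space_1 by simp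
  finally have pmf: "pmf (embed_pmf f) x = f x" for x
    by (intro pmf_embed_pmf) (auto simp: f_def)
  have "measure_pmf (embed_pmf f) = D"
    by (rule measure_eqI_countable[where A = UNIV]) (auto simp: emeasure_pmf_single pmf f_def D.emeasure_eq_measure)
  then show ?thesis using D by metis
qed

lemma map_upto_shift: "map (\<lambda>n. f (n + k)) [a..b] = map f [a + k..b + k :: int]"
proof -
  have "map (\<lambda>n. n + k) [a..b] = [a + k..b + k]"
  proof (induction "nat (b - a + 1)" arbitrary: a)
    case (Suc n)
    then have "a \<le> b" "n = nat (b - (a + 1) + 1)" by auto
    with Suc.hyps(1)[of "a + 1"] show ?case by (simp add: upto_rec1 algebra_simps)
  qed simp
  then show ?thesis by (metis (no_types) list.map_comp comp_apply map_eq_conv)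
qed

text \<open>Stands in for measurability with respect to the coordinates in \<open>I\<close>;
  combined with measurability in \<open>path\<close> it yields independence and the tail
  property.\<close>

definition depends_on :: "'i set \<Rightarrow> ('i \<Rightarrow> 'b) set \<Rightarrow> bool" where
  "depends_on I A \<longleftrightarrow> (\<forall>w w'. (\<forall>n\<in>I. w n = w' n) \<longrightarrow> (w \<in> A \<longleftrightarrow> w' \<in> A))"

context fcfs_model
begin

section \<open>The product space: independence, zero-one law, shift invariance\<close>

abbreviation path :: "(int \<Rightarrow> ('c, 's) item) measure" where
  "path \<equiv> PiM UNIV (\<lambda>_. measure_pmf p)"

sublocale path: prob_space path
  by (rule prob_space_PiM) (rule prob_space_measure_pmf)

lemma space_path [simp]: "space path = UNIV"
  by (simp add: space_PiM)

lemma measurable_coord: "(\<lambda>w. w n) \<in> measurable path (count_space UNIV)"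
proof -
  have "(\<lambda>w. w n) \<in> measurable path (measure_pmf p)" by (rule measurable_component_singleton) simp
  then show ?thesis by (simp add: measurable_def)
qed

lemma measurable_window: "(\<lambda>w. f (map w ps)) \<in> measurable path (count_space UNIV)"
proof -
  have "(\<lambda>w. map w ps) \<in> measurable path (count_space UNIV)"
  proof (induction ps)
    case (Cons a ps)
    have "(\<lambda>w. (\<lambda>i w. i # map w ps) (w a) w) \<in> measurable path (count_space UNIV)"
    proof (rule measurable_compose_countable[where f = "\<lambda>i w. i # map w ps", OF _ measurable_coord])
      fix i :: "('c, 's) item"
      show "(\<lambda>w. i # map w ps) \<in> measurable path (count_space UNIV)"
        using measurable_compose[OF Cons, of "\<lambda>x. i # x" "count_space UNIV"] by simp
    qed
    then show ?case by simp
  qed simp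
  from measurable_compose[OF this, of f "count_space UNIV"] show ?thesis by simp
qed

lemma sets_window: "{w. Q (map w ps)} \<in> sets path"
  using measurable_sets[OF measurable_window[of Q ps], of "{True}"] by (simp add: vimage_def)

lemma depends_on_window: "set ps \<subseteq> I \<Longrightarrow> depends_on I {w. Q (map w ps)}"
  unfolding depends_on_def by (metis (mono_tags, lifting) map_cong mem_Collect_eq subsetD)

lemma distr_coord: "distr path (measure_pmf p) (\<lambda>w. w n) = measure_pmf p"
  using distr_PiM_component[of UNIV "\<lambda>_. measure_pmf p" n] by (simp add: prob_space_measure_pmf)

lemma prob_depends_on_Int:
  assumes A: "A \<in> sets path" "depends_on I A" and B: "B \<in> sets path" "depends_on J B" and IJ: "I \<inter> J = {}"
  shows "path.prob (A \<inter> B) = path.prob A * path.prob B"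
proof -
  have "path.indep_vars (\<lambda>_. measure_pmf p) (\<lambda>i w. w i) UNIV"
  proof (subst path.indep_vars_iff_distr_eq_PiM)
    show "distr path path (\<lambda>w. \<lambda>i\<in>UNIV. w i) = PiM UNIV (\<lambda>i. distr path (measure_pmf p) (\<lambda>w. w i))"
      using distr_id2[of path path] by (simp add: distr_coord restrict_UNIV)
  qed (auto intro: measurable_component_singleton)
  from path.indep_var_restrict[OF this IJ]
  have ind: "path.indep_var (PiM I (\<lambda>_. measure_pmf p)) (\<lambda>w. restrict w I) (PiM J (\<lambda>_. measure_pmf p)) (\<lambda>w. restrict w J)"
    by simp
  \<comment> \<open>Filling the coordinates outside \<open>I\<close> with a fixed value is
    measurable and does not affect membership in \<open>A\<close>, so \<open>A\<close> is a preimage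
    under restriction to \<open>I\<close>.\<close>
  have ext: "\<exists>A'\<in>sets (PiM I (\<lambda>_. measure_pmf p)). A = (\<lambda>w. restrict w I) -` A' \<inter> space path"
    if "A \<in> sets path" "depends_on I A" for A I
  proof -
    let ?e = "\<lambda>x n. if n \<in> I then x n else undefined"
    have e: "?e \<in> measurable (PiM I (\<lambda>_. measure_pmf p)) path"
    proof (rule measurable_PiM_single')
      fix n show "(\<lambda>x. if n \<in> I then x n else undefined) \<in> measurable (PiM I (\<lambda>_. measure_pmf p)) (measure_pmf p)"
        by (cases "n \<in> I") (auto intro: measurable_component_singleton)
    qed (auto simp: space_PiM)
    have "w \<in> A \<longleftrightarrow> ?e (restrict w I) \<in> A" for w
      using that(2) unfolding depends_on_def by (auto dest: spec2[of _ w "?e (restrict w I)"])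
    then have "A = (\<lambda>w. restrict w I) -` (?e -` A \<inter> space (PiM I (\<lambda>_. measure_pmf p))) \<inter> space path"
      by (auto simp: space_PiM)
    with measurable_sets[OF e that(1)] show ?thesis by blast
  qed
  obtain A' where A': "A' \<in> sets (PiM I (\<lambda>_. measure_pmf p))" "A = (\<lambda>w. restrict w I) -` A' \<inter> space path"
    using ext[OF A] by blast
  obtain B' where B': "B' \<in> sets (PiM J (\<lambda>_. measure_pmf p))" "B = (\<lambda>w. restrict w J) -` B' \<inter> space path"
    using ext[OF B] by blast
  have "A \<inter> B = (\<lambda>w. (restrict w I, restrict w J)) -` (A' \<times> B') \<inter> space path"
    using A' B' by auto
  then show ?thesis
    using path.indep_varD[OF ind A'(1) B'(1)] A'(2) B'(2) by simp
qed

text \<open>Time is reversed to index the coordinates by natural numbers, so the remote past becomes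
  the tail in Kolmogorov's law.\<close>

lemma tail_0_1:
  assumes A: "A \<in> sets path" and tail: "\<And>N. depends_on {..N} A"
  shows "path.prob A = 0 \<or> path.prob A = 1"
proof -
  let ?X = "\<lambda>n w. w (- int n)"
  define F where "F n = {?X n -` B \<inter> space path | B. B \<in> sets (measure_pmf p)}" for n
  have inj: "inj (\<lambda>n. - int n)" by (auto simp: inj_on_def)
  have "path.indep_vars (\<lambda>_. measure_pmf p) ?X UNIV"
  proof (subst path.indep_vars_iff_distr_eq_PiM)
    have "distr path (PiM UNIV (\<lambda>_. measure_pmf p)) (\<lambda>w. \<lambda>n\<in>UNIV. w (- int n)) = PiM UNIV (\<lambda>_. measure_pmf p)"
      by (rule distr_PiM_reindex[OF _ inj]) (auto simp: prob_space_measure_pmf)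
    then show "distr path (PiM UNIV (\<lambda>_. measure_pmf p)) (\<lambda>w. \<lambda>n\<in>UNIV. w (- int n)) =
        PiM UNIV (\<lambda>i. distr path (measure_pmf p) (?X i))"
      by (simp add: distr_coord)
  qed (auto intro: measurable_component_singleton)
  then have ind: "path.indep_sets F UNIV"
    unfolding path.indep_vars_def2 F_def by simp
  have sig: "sigma_algebra (space path) (F n)" for n
  proof -
    have "F n = sets (vimage_algebra (space path) (?X n) (measure_pmf p))"
      unfolding F_def by (subst sets_vimage_algebra2) auto
    then show ?thesis using sets.sigma_algebra_axioms[of "vimage_algebra (space path) (?X n) (measure_pmf p)"]
      by simp
  qed
  have "A \<in> sigma_sets (space path) (\<Union> (F ` {n..}))" for n
  proof -
    define Mn where "Mn = sigma (space path) (\<Union> (F ` {n..}))"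
    have sets_Mn: "sets Mn = sigma_sets (space path) (\<Union> (F ` {n..}))" and space_Mn: "space Mn = UNIV"
      unfolding Mn_def by (simp_all add: sets_measure_of space_measure_of_conv)
    \<comment> \<open>Erases all coordinates after \<open>- int n\<close>. The set \<open>A\<close>
      does not notice this, so it is generated by the remaining coordinates.\<close>
    let ?r = "\<lambda>w m. if m \<le> - int n then w m else undefined"
    have "?r \<in> measurable Mn path"
    proof (rule measurable_PiM_single')
      fix m :: int
      show "(\<lambda>w. if m \<le> - int n then w m else undefined) \<in> measurable Mn (measure_pmf p)"
      proof (cases "m \<le> - int n")
        case True
        have "(\<lambda>w. w m) \<in> measurable Mn (measure_pmf p)"
        proof (rule measurableI)
          fix B assume "B \<in> sets (measure_pmf p)"
          then have "(\<lambda>w. w m) -` B \<inter> space Mn \<in> F (nat (- m))"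
            unfolding F_def space_Mn using True by (intro CollectI exI[of _ B]) auto
          moreover have "nat (- m) \<in> {n..}" using True by auto
          ultimately show "(\<lambda>w. w m) -` B \<inter> space Mn \<in> sets Mn"
            unfolding sets_Mn by (intro sigma_sets.Basic) blast
        qed simp
        with True show ?thesis by simp
      qed simp
    qed (auto simp: space_Mn space_PiM)
    from measurable_sets[OF this A] have "?r -` A \<inter> space Mn \<in> sets Mn" .
    moreover have "?r -` A \<inter> space Mn = A"
    proof -
      have "?r w \<in> A \<longleftrightarrow> w \<in> A" for w
        using tail[of "- int n"] unfolding depends_on_def by (auto dest: spec2[of _ w "?r w"])
      then show ?thesis unfolding space_Mn by auto
    qed
    ultimately show ?thesis unfolding sets_Mn by simp
  qed
  then have "A \<in> path.tail_events F" unfolding path.tail_events_def by blast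
  from path.kolmogorov_0_1_law[OF sig ind this] show ?thesis .
qed

lemma distr_shift: "distr path path (\<lambda>w n. w (n + k)) = path"
proof -
  have "distr path (PiM UNIV (\<lambda>_. measure_pmf p)) (\<lambda>w. \<lambda>n\<in>UNIV. w (n + k)) = PiM UNIV (\<lambda>_. measure_pmf p)"
    by (rule distr_PiM_reindex) (auto simp: prob_space_measure_pmf inj_on_def)
  then show ?thesis by (simp add: restrict_def)
qed

lemma measurable_shift: "(\<lambda>w n. w (n + k)) \<in> measurable path path"
  by (rule measurable_PiM_single') (auto intro: measurable_component_singleton)

lemma prob_shift: "A \<in> sets path \<Longrightarrow> path.prob {w. (\<lambda>n. w (n + k)) \<in> A} = path.prob A"
  using measure_distr[OF measurable_shift, of A k] by (simp add: distr_shift vimage_def)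

lemma prob_coord: "path.prob {w. w n = i} = pmf p i"
proof -
  have "path.prob {w. w n = i} = measure (distr path (measure_pmf p) (\<lambda>w. w n)) {i}"
    by (subst measure_distr) (auto intro: measurable_component_singleton simp: vimage_def)
  then show ?thesis by (simp add: distr_coord measure_pmf_single)
qed

lemma prob_window: "path.prob {w. map w [a + 1..a + int (length zs)] = zs} = item_weight zs"
proof (induction zs arbitrary: a)
  case Nil
  then show ?case using path.prob_space by simp
next
  case (Cons i zs)
  let ?A = "{w. map w [a + 1 + 1..a + 1 + int (length zs)] = zs}"
  have "[a + 1..a + int (length (i # zs))] = (a + 1) # [a + 1 + 1..a + 1 + int (length zs)]"
    by (subst upto_rec1) (auto simp: algebra_simps)
  then have "{w. map w [a + 1..a + int (length (i # zs))] = i # zs} = {w. w (a + 1) = i} \<inter> ?A" by auto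
  also have "path.prob \<dots> = path.prob {w. w (a + 1) = i} * path.prob ?A"
  proof (rule prob_depends_on_Int[where I = "{a + 1}" and J = "{a + 1 + 1..}"])
    show "{w. w (a + 1) = i} \<in> sets path" using sets_window[of "\<lambda>x. x = [i]" "[a + 1]"] by simp
    show "?A \<in> sets path" by (rule sets_window)
    show "depends_on {a + 1 + 1..} ?A" by (rule depends_on_window) auto
  qed (auto simp: depends_on_def)
  finally show ?case unfolding prob_coord Cons by simp
qed

lemma prob_window_pred:
  "path.prob {w. Q (map w [a + 1..a + int n])} = (\<Sum>zs | length zs = n. item_weight zs * of_bool (Q zs))"
proof -
  let ?A = "\<lambda>zs. {w. map w [a + 1..a + int n] = zs \<and> Q zs}"
  have len: "length (map w [a + 1..a + int n]) = n" for w :: "int \<Rightarrow> ('c, 's) item" by simp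
  have "{w. Q (map w [a + 1..a + int n])} = (\<Union>zs\<in>{zs. length zs = n}. ?A zs)"
    using len by auto
  also have "path.prob \<dots> = (\<Sum>zs | length zs = n. path.prob (?A zs))"
  proof (rule path.finite_measure_finite_Union)
    show "?A ` {zs. length zs = n} \<subseteq> sets path"
      using sets_window[of "\<lambda>x. x = _ \<and> Q _"] by auto
  qed (auto simp: disjoint_family_on_def)
  also have "\<dots> = (\<Sum>zs | length zs = n. item_weight zs * of_bool (Q zs))"
  proof (intro sum.cong refl)
    fix zs :: "('c, 's) item list" assume "zs \<in> {zs. length zs = n}"
    then show "path.prob (?A zs) = item_weight zs * of_bool (Q zs)"
      using prob_window[of a zs] by (cases "Q zs") auto
  qed
  finally show ?thesis .
qed

section \<open>Renewal points exist almost surely\<close>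

lemma sets_empties: "{w. empties G w k} \<in> sets path"
proof -
  have "{w. empties G w k} = (\<Inter>j\<in>{..k}. {w. foldl (queue_step G) [] (map w [j + 1..k]) = []})"
    by (auto simp: empties_def)
  also have "\<dots> \<in> sets path"
    using sets_window[of "\<lambda>x. foldl (queue_step G) [] x = []"]
    by (intro sets.countable_INT') auto
  finally show ?thesis .
qed

lemma empties_cong:
  assumes "\<And>n. n \<le> k \<Longrightarrow> w n = w' n"
  shows "empties G w k \<longleftrightarrow> empties G w' k"
proof -
  have "map w [j + 1..k] = map w' [j + 1..k]" for j using assms by (intro map_cong) auto
  then show ?thesis by (simp add: empties_def del: map_eq_conv)
qed

lemma empties_shift: "empties G (\<lambda>n. w (n + k)) j \<longleftrightarrow> empties G w (j + k)"
proof
  assume "empties G (\<lambda>n. w (n + k)) j"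
  then have *: "foldl (queue_step G) [] (map w [i + 1 + k..j + k]) = []" if "i \<le> j" for i
    using that by (simp add: empties_def map_upto_shift)
  show "empties G w (j + k)"
    unfolding empties_def
  proof (intro allI impI)
    fix i assume "i \<le> j + k"
    then show "foldl (queue_step G) [] (map w [i + 1..j + k]) = []" using *[of "i - k"] by simp
  qed
next
  assume *: "empties G w (j + k)"
  show "empties G (\<lambda>n. w (n + k)) j"
    unfolding empties_def map_upto_shift
  proof (intro allI impI)
    fix i assume "i \<le> j"
    then show "foldl (queue_step G) [] (map w [i + 1 + k..j + k]) = []"
      using * unfolding empties_def by (auto dest: spec[of _ "i + k"] simp: algebra_simps)
  qed
qed

text \<open>A queue started earlier dominates one started later, so emptiness at \<open>k\<close>
  becomes a stronger requirement as the start recedes. Along this decreasing sequence the uniform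
  lower bound passes to the intersection.\<close>

lemma prob_empties: "1 / total_weight \<le> path.prob {w. empties G w k}"
proof -
  define D where "D n = {w. foldl (queue_step G) [] (map w [k - int n + 1..k]) = []}" for n
  have eq: "{w. empties G w k} = (\<Inter>n. D n)"
  proof (intro equalityI subsetI)
    fix w assume w: "w \<in> (\<Inter>n. D n)"
    have "foldl (queue_step G) [] (map w [j + 1..k]) = []" if "j \<le> k" for j
      using w that by (auto simp: D_def dest: spec[of _ "nat (k - j)"])
    then show "w \<in> {w. empties G w k}" by (simp add: empties_def)
  qed (auto simp: empties_def D_def)
  have "decseq D"
  proof (rule decseq_SucI, rule subsetI)
    fix n w assume "w \<in> D (Suc n)"
    moreover have "[k - int (Suc n) + 1..k] = (k - int n) # [k - int n + 1..k]"
      by (subst upto_rec1) auto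
    ultimately have "foldl (queue_step G) (queue_step G [] (w (k - int n))) (map w [k - int n + 1..k]) = []"
      by (simp add: D_def)
    then show "w \<in> D n"
      using subseq_foldl_queue_step[of "[]" "queue_step G [] (w (k - int n))" G "map w [k - int n + 1..k]"]
      by (simp add: D_def)
  qed
  then have "(\<lambda>n. path.prob (D n)) \<longlonglongrightarrow> path.prob (\<Inter>n. D n)"
    unfolding D_def using sets_window[of "\<lambda>x. foldl (queue_step G) [] x = []"]
    by (intro path.finite_Lim_measure_decseq) auto
  moreover have "1 / total_weight \<le> path.prob (D n)" for n
    using prob_empty_lower_bound[of n] prob_window_pred[of "\<lambda>x. foldl (queue_step G) [] x = []" "k - int n" n]
    by (simp add: D_def)
  ultimately show ?thesis
    unfolding eq by (intro LIMSEQ_le_const) auto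
qed

text \<open>For the future the 0-1 law on the past is not applied directly. The probability of a
  renewal point after \<open>n\<close> is the same for all \<open>n\<close>, and as \<open>n\<close>
  recedes these events increase to one that contains the almost sure event \<open>P\<close>.\<close>

lemma AE_regular: "AE w in path. regular G w"
proof -
  define A where "A n = {w. \<exists>k\<le>n. empties G w k}" for n :: int
  define H where "H n = {w. \<exists>k\<ge>n. empties G w k}" for n :: int
  have UN: "(\<Union>k\<in>I. {w. empties G w k}) \<in> sets path" for I :: "int set"
    using sets_empties by (intro sets.countable_UN') auto
  have "A n = (\<Union>k\<in>{..n}. {w. empties G w k})" "H n = (\<Union>k\<in>{n..}. {w. empties G w k})" for n
    by (auto simp: A_def H_def)
  then have sets_A: "A n \<in> sets path" and sets_H: "H n \<in> sets path" for n
    using UN by simp_all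
  have T: "0 < 1 / total_weight" using total_weight_ge_1 by simp
  define P where "P = (\<Inter>n::nat. A (- int n))"
  have P_eq: "P = {w. \<forall>N. \<exists>k\<le>N. empties G w k}"
  proof (intro equalityI subsetI)
    fix w assume w: "w \<in> P"
    have "\<exists>k\<le>N. empties G w k" for N
    proof -
      from w have "w \<in> A (- int (nat (- N)))" unfolding P_def by blast
      then obtain k where "k \<le> - int (nat (- N))" "empties G w k" unfolding A_def by blast
      then show ?thesis by (intro exI[of _ k]) (auto split: if_splits)
    qed
    then show "w \<in> {w. \<forall>N. \<exists>k\<le>N. empties G w k}" by simp
  qed (auto simp: P_def A_def)
  have sets_P: "P \<in> sets path" unfolding P_def using sets_A by auto
  have "(\<lambda>n. path.prob (A (- int n))) \<longlonglongrightarrow> path.prob P"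
    unfolding P_def
  proof (rule path.finite_Lim_measure_decseq)
    show "decseq (\<lambda>n. A (- int n))"
    proof (rule decseq_SucI, rule subsetI)
      fix n w assume "w \<in> A (- int (Suc n))"
      then obtain k where "k \<le> - int (Suc n)" "empties G w k" unfolding A_def by blast
      then show "w \<in> A (- int n)" unfolding A_def by (intro CollectI exI[of _ k]) auto
    qed
  qed (use sets_A in auto)
  moreover have "1 / total_weight \<le> path.prob (A n)" for n
  proof -
    have "{w. empties G w n} \<subseteq> A n" by (auto simp: A_def)
    from path.finite_measure_mono[OF this sets_A] prob_empties[of n] show ?thesis by simp
  qed
  ultimately have "1 / total_weight \<le> path.prob P" by (intro LIMSEQ_le_const) auto
  moreover have "depends_on {..N} P" for N
  proof -
    \<comment> \<open>Arbitrarily early renewal points may be sought before \<open>N\<close> alone,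
      and these are visible from the items up to \<open>N\<close>.\<close>
    have eq: "P = {w. \<forall>n\<le>N. \<exists>k\<le>n. empties G w k}"
    proof -
      have "\<exists>k\<le>m. empties G w k" if w: "\<forall>n\<le>N. \<exists>k\<le>n. empties G w k" for w m
      proof -
        have "min m N \<le> N" by simp
        with w obtain k where "k \<le> min m N" "empties G w k" by blast
        then show ?thesis by (intro exI[of _ k]) auto
      qed
      then show ?thesis unfolding P_eq by blast
    qed
    have "empties G w k \<longleftrightarrow> empties G w' k" if "\<forall>n\<in>{..N}. w n = w' n" "k \<le> N" for w w' k
      using that by (intro empties_cong) auto
    then show ?thesis unfolding depends_on_def eq mem_Collect_eq by (meson order.trans)
  qed
  ultimately have P1: "path.prob P = 1" using tail_0_1[OF sets_P] T by force
  have "{w. (\<lambda>n. w (n + k)) \<in> H 0} = H k" for k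
  proof -
    have "(\<exists>j\<ge>0. empties G w (j + k)) \<longleftrightarrow> (\<exists>j\<ge>k. empties G w j)" for w
    proof
      assume "\<exists>j\<ge>k. empties G w j"
      then obtain j where "j \<ge> k" "empties G w j" by blast
      then show "\<exists>j\<ge>0. empties G w (j + k)" by (intro exI[of _ "j - k"]) auto
    next
      assume "\<exists>j\<ge>0. empties G w (j + k)"
      then obtain j where "j \<ge> 0" "empties G w (j + k)" by blast
      then show "\<exists>j\<ge>k. empties G w j" by (intro exI[of _ "j + k"]) auto
    qed
    then show ?thesis by (simp add: H_def empties_shift)
  qed
  then have H_eq: "path.prob (H k) = path.prob (H 0)" for k
    using prob_shift[OF sets_H[of 0], of k] by simp
  have "(\<lambda>n. path.prob (H (- int n))) \<longlonglongrightarrow> path.prob (\<Union>n::nat. H (- int n))"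
  proof (rule path.finite_Lim_measure_incseq)
    show "incseq (\<lambda>n. H (- int n))"
    proof (rule incseq_SucI, rule subsetI)
      fix n w assume "w \<in> H (- int n)"
      then obtain k where "k \<ge> - int n" "empties G w k" unfolding H_def by blast
      then show "w \<in> H (- int (Suc n))" unfolding H_def by (intro CollectI exI[of _ k]) auto
    qed
  qed (use sets_H in auto)
  then have "path.prob (\<Union>n::nat. H (- int n)) = path.prob (H 0)"
    unfolding H_eq[of "- int _"] using LIMSEQ_unique tendsto_const by blast
  moreover have "P \<subseteq> (\<Union>n::nat. H (- int n))"
  proof
    fix w assume "w \<in> P"
    then obtain k where "k \<le> 0" "empties G w k" unfolding P_eq by blast
    then have "w \<in> H (- int (nat (- k)))" unfolding H_def by auto
    then show "w \<in> (\<Union>n::nat. H (- int n))" by blast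
  qed
  then have "path.prob P \<le> path.prob (\<Union>n::nat. H (- int n))"
    using sets_H by (intro path.finite_measure_mono) auto
  ultimately have H1: "path.prob (H k) = 1" for k
    using P1 H_eq[of k] path.prob_le_1[of "H 0"] by simp
  have "AE w in path. w \<in> P" using P1 by (rule path.AE_prob_1)
  moreover have "AE w in path. \<forall>k. w \<in> H k"
    unfolding AE_all_countable using H1 path.AE_prob_1 by blast
  ultimately show ?thesis
    by eventually_elim (auto simp: P_eq H_def regular_def)
qed

text \<open>A version of U that mentions no matching and is measurable on the whole path space; the
  two agree on regular paths.\<close>

definition U_state :: "int \<Rightarrow> (int \<Rightarrow> ('c, 's) item) \<Rightarrow> ('c, 's) item entry list" where
  "U_state N w = foldl (U_step G) [] (map w [start G w N + 1..N])"

lemma measurable_U_state: "U_state N \<in> measurable path (count_space UNIV)"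
proof -
  have "(\<lambda>w. LEAST j. empties G w (N - int j)) \<in> measurable path (count_space UNIV)"
    using sets_empties by (intro measurable_Least) (simp add: pred_def)
  then have "(\<lambda>w. (\<lambda>j w. foldl (U_step G) [] (map w [N - int j + 1..N])) (LEAST j. empties G w (N - int j)) w)
      \<in> measurable path (count_space UNIV)"
    by (rule measurable_compose_countable[where f = "\<lambda>j w. foldl (U_step G) [] (map w [N - int j + 1..N])", OF measurable_window])
  then show ?thesis unfolding U_state_def[abs_def] start_def by simp
qed

lemma U_state_cong:
  assumes "\<And>n. n \<le> N \<Longrightarrow> w n = w' n"
  shows "U_state N w = U_state N w'"
proof -
  have "empties G w (N - int j) = empties G w' (N - int j)" for j
    using assms by (intro empties_cong) auto
  then have "start G w N = start G w' N" by (simp add: start_def)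
  moreover have "map w [k + 1..N] = map w' [k + 1..N]" for k using assms by (intro map_cong) auto
  ultimately show ?thesis by (simp add: U_state_def del: map_eq_conv)
qed

lemma depends_on_U_state: "depends_on {..N} {w. Q (U_state N w)}"
  unfolding depends_on_def
proof (intro allI impI)
  fix w w' :: "int \<Rightarrow> ('c, 's) item" assume "\<forall>n\<in>{..N}. w n = w' n"
  then have "U_state N w = U_state N w'" by (intro U_state_cong) auto
  then show "w \<in> {w. Q (U_state N w)} \<longleftrightarrow> w' \<in> {w. Q (U_state N w)}" by simp
qed

lemma U_state_shift: "U_state N (\<lambda>n. w (n + k)) = U_state (N + k) w"
proof -
  have "start G w (N + k) = start G (\<lambda>n. w (n + k)) N + k"
    by (simp add: start_def empties_shift algebra_simps)
  then show ?thesis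
    unfolding U_state_def map_upto_shift by (simp add: algebra_simps)
qed

lemma regular_start:
  assumes "regular G w"
  shows "start G w N \<le> N" "empties G w (start G w N)"
  using assms start_props[of N G w] unfolding regular_def by blast+

lemma U_state_eq: "regular G w \<Longrightarrow> U_path w (the_matching G w) N = U_state N w"
  unfolding U_state_def by (rule regular_processes(1)) (auto dest: regular_start)

lemma U_state_step:
  assumes "regular G w"
  shows "U_state (N + 1) w = U_step G (U_state N w) (w (N + 1))"
proof -
  let ?k = "start G w N"
  note k = regular_start[OF assms, of N]
  \<comment> \<open>The renewal point used for \<open>N\<close> remains valid for
    \<open>N + 1\<close>, even when a later one has appeared.\<close>
  have "U_state (N + 1) w = foldl (U_step G) [] (map w [?k + 1..N + 1])"
    using regular_processes(1)[OF assms k(2), of "N + 1"] k(1) U_state_eq[OF assms, of "N + 1"] by simp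
  also have "[?k + 1..N + 1] = [?k + 1..N] @ [N + 1]" using k(1) by (subst upto_rec2) auto
  finally show ?thesis by (simp add: U_state_def)
qed

lemma sets_U_state: "{w. U_state N w \<in> S} \<in> sets path"
  using measurable_sets[OF measurable_U_state[of N], of S] by (simp add: vimage_def)

text \<open>By shift invariance the law is the same at times 0 and 1, and the item between them is
  independent of the state at 0. This is invariance, and invariant laws are unique.\<close>

lemma prob_U_state: "path.prob {w. U_state N w \<in> S} = measure_pmf.prob stationary_U S"
proof -
  obtain q where q: "measure_pmf.prob q S = path.prob {w. U_state 0 w \<in> S}" for S
    using pmf_of_random_variable[OF path.prob_space_axioms measurable_U_state[of 0]] by auto
  have shift: "path.prob {w. U_state N w \<in> S} = measure_pmf.prob q S" for N S
    using prob_shift[OF sets_U_state[of 0 S], of N] by (simp add: q U_state_shift)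
  have "q = stationary_U"
  proof (rule invariant_U_unique)
    fix S
    have "measure_pmf.prob q S = path.prob {w. U_step G (U_state 0 w) (w 1) \<in> S}"
      unfolding shift[of 1, symmetric]
    proof (rule path.finite_measure_eq_AE)
      show "AE w in path. w \<in> {w. U_state 1 w \<in> S} \<longleftrightarrow> w \<in> {w. U_step G (U_state 0 w) (w 1) \<in> S}"
        using AE_regular by eventually_elim (use U_state_step[of _ 0] in auto)
      have "{w. U_step G (U_state 0 w) (w 1) \<in> S} = (\<Union>i. {w. U_step G (U_state 0 w) i \<in> S} \<inter> {w. w 1 = i})"
        by auto
      also have "\<dots> \<in> sets path"
        using sets_U_state[of 0 "{u. U_step G u _ \<in> S}"] sets_window[of "\<lambda>x. x = [_]" "[1]"]
        by (intro sets.countable_UN' sets.Int) auto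
      finally show "{w. U_step G (U_state 0 w) (w 1) \<in> S} \<in> sets path" .
    qed (rule sets_U_state)
    also have "{w. U_step G (U_state 0 w) (w 1) \<in> S} = (\<Union>i\<in>UNIV. {w. U_step G (U_state 0 w) i \<in> S} \<inter> {w. w 1 = i})"
      by auto
    also have "path.prob \<dots> = (\<Sum>i\<in>UNIV. path.prob ({w. U_step G (U_state 0 w) i \<in> S} \<inter> {w. w 1 = i}))"
      using sets_U_state[of 0 "{u. U_step G u _ \<in> S}"] sets_window[of "\<lambda>x. x = [_]" "[1]"]
      by (intro path.finite_measure_finite_Union) (auto simp: disjoint_family_on_def)
    also have "\<dots> = (\<Sum>i\<in>UNIV. pmf p i * measure_pmf.prob q {u. U_step G u i \<in> S})"
    proof (intro sum.cong refl)
      fix i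
      have "path.prob ({w. U_step G (U_state 0 w) i \<in> S} \<inter> {w. w 1 = i}) =
          path.prob {w. U_step G (U_state 0 w) i \<in> S} * path.prob {w. w 1 = i}"
      proof (rule prob_depends_on_Int[where I = "{..0}" and J = "{1}"])
        show "{w. U_step G (U_state 0 w) i \<in> S} \<in> sets path"
          using sets_U_state[of 0 "{u. U_step G u i \<in> S}"] by simp
        show "{w. w 1 = i} \<in> sets path" using sets_window[of "\<lambda>x. x = [i]" "[1]"] by simp
        show "depends_on {..0} {w. U_step G (U_state 0 w) i \<in> S}" by (rule depends_on_U_state)
      qed (auto simp: depends_on_def)
      then show "path.prob ({w. U_step G (U_state 0 w) i \<in> S} \<inter> {w. w 1 = i}) =
          pmf p i * measure_pmf.prob q {u. U_step G u i \<in> S}"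
        using q[of "{u. U_step G u i \<in> S}"] by (simp add: prob_coord)
    qed
    finally show "measure_pmf.prob q S = (\<Sum>i\<in>UNIV. pmf p i * measure_pmf.prob q {u. U_step G u i \<in> S})" .
  qed
  then show ?thesis using shift by simp
qed

end

section \<open>Markov property and the law of W\<close>

context fcfs_model
begin

section \<open>Transfer from the path space to the given probability space\<close>

lemma sets_past:
  fixes n :: nat
  assumes "\<And>N x. {w. Y N w = x} \<in> sets path"
  shows "{w. (\<forall>i<n. Y (k i) w = f i) \<and> Y N w = x} \<in> sets path"
proof -
  have "{w. (\<forall>i<n. Y (k i) w = f i) \<and> Y N w = x} = (\<Inter>i\<in>{..<n}. {w. Y (k i) w = f i}) \<inter> {w. Y N w = x}" by auto
  moreover have "(\<Inter>i\<in>I. {w. Y (k i) w = f i}) \<in> sets path" if "finite I" for I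
    using that by (induction I) (use assms sets.top[of path] in auto)
  from sets.Int[OF this[OF finite_lessThan] assms] have "(\<Inter>i\<in>{..<n}. {w. Y (k i) w = f i}) \<inter> {w. Y N w = x} \<in> sets path" .
  ultimately show ?thesis by simp
qed

lemma AE_completion_regular:
  assumes Z: "Z \<in> measurable M path" and dZ: "distr M path Z = path"
  shows "AE \<omega> in completion M. regular G (Z \<omega>)"
proof (rule AE_completion)
  have "AE w in distr M path Z. regular G w" unfolding dZ by (rule AE_regular)
  then show "AE \<omega> in M. regular G (Z \<omega>)" by (rule AE_distrD[OF Z])
qed

text \<open>Transfer from the path space. The kernel is obtained from conditional probabilities; all that
  is needed is that the transition probabilities \<open>\<kappa>\<close> do not depend on the time and the past.\<close>

lemma stationary_distribution_of_chainI:
  fixes Y :: "int \<Rightarrow> 'a \<Rightarrow> 'b::countable" and Y' :: "int \<Rightarrow> (int \<Rightarrow> ('c, 's) item) \<Rightarrow> 'b"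
  assumes Z: "Z \<in> measurable M path" and dZ: "distr M path Z = path"
    and Y: "\<And>N \<omega>. regular G (Z \<omega>) \<Longrightarrow> Y N \<omega> = Y' N (Z \<omega>)"
    and meas: "\<And>N. Y' N \<in> measurable path (count_space UNIV)"
    and law: "\<And>N x. path.prob {w. Y' N w = x} = pmf \<pi> x"
    and step: "\<And>N xs x y. \<exists>D R I. D \<in> sets path \<and> R \<in> sets path \<and> depends_on I D \<and> depends_on (- I) R \<and>
      path.prob R = \<kappa> x y \<and> (\<forall>w. regular G w \<longrightarrow>
        (w \<in> D \<longleftrightarrow> (\<forall>i<length xs. Y' (N - int (length xs) + int i) w = xs ! i) \<and> Y' N w = x) \<and>
        (Y' N w = x \<longrightarrow> (w \<in> R \<longleftrightarrow> Y' (N + 1) w = y)))"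
  shows "stationary_distribution_of_chain M Y \<pi>"
proof -
  have set1: "{w. Y' N w \<in> S} \<in> sets path" for N S
    using measurable_sets[OF meas[of N], of S] by (simp add: vimage_def)
  have setx: "{w. Y' N w = x} \<in> sets path" for N x using set1[of N "{x}"] by simp
  note past = sets_past[of Y', OF setx]
  have step: "path.prob {w. ((\<forall>i<length xs. Y' (N - int (length xs) + int i) w = xs ! i) \<and> Y' N w = x) \<and> Y' (N + 1) w = y} =
      path.prob {w. (\<forall>i<length xs. Y' (N - int (length xs) + int i) w = xs ! i) \<and> Y' N w = x} * \<kappa> x y"
    for N and xs :: "'b list" and x y
  proof -
    let ?P = "\<lambda>w. (\<forall>i<length xs. Y' (N - int (length xs) + int i) w = xs ! i) \<and> Y' N w = x"
    obtain D R I where D: "D \<in> sets path" "depends_on I D" and R: "R \<in> sets path" "depends_on (- I) R"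
      and "path.prob R = \<kappa> x y" and iff: "\<And>w. regular G w \<Longrightarrow> (w \<in> D \<longleftrightarrow> ?P w) \<and> (Y' N w = x \<longrightarrow> (w \<in> R \<longleftrightarrow> Y' (N + 1) w = y))"
      using step[of x y xs N] by (elim exE conjE) simp
    have "path.prob {w. ?P w \<and> Y' (N + 1) w = y} = path.prob (D \<inter> R)"
    proof (rule path.finite_measure_eq_AE)
      show "{w. ?P w \<and> Y' (N + 1) w = y} \<in> sets path"
        unfolding Collect_conj_eq[of ?P] by (intro sets.Int past setx)
      show "AE w in path. (w \<in> {w. ?P w \<and> Y' (N + 1) w = y}) = (w \<in> D \<inter> R)"
        using AE_regular by eventually_elim (use iff in blast)
    qed (use D R in auto)
    also have "\<dots> = path.prob D * path.prob R"
      by (rule prob_depends_on_Int[OF D R]) simp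
    also have "path.prob D = path.prob {w. ?P w}"
    proof (rule path.finite_measure_eq_AE)
      show "AE w in path. (w \<in> D) = (w \<in> {w. ?P w})"
        using AE_regular by eventually_elim (use iff in blast)
    qed (use D past in auto)
    finally show ?thesis using \<open>path.prob R = \<kappa> x y\<close> by simp
  qed
  have joint: "path.prob {w. Y' N w = x \<and> Y' (N + 1) w = y} = pmf \<pi> x * \<kappa> x y" for N x y
    using step[of "[]" N x y] by (simp add: law)
  \<comment> \<open>For states of positive probability the kernel is the conditional law of the next
    state; for null states any law will do.\<close>
  have "\<exists>q. \<forall>y. pmf \<pi> x \<noteq> 0 \<longrightarrow> pmf q y = \<kappa> x y" for x
  proof (cases "pmf \<pi> x = 0")
    case False
    let ?A = "{w. Y' 0 w = x}"
    have A0: "emeasure path ?A \<noteq> 0" using False law[of 0 x] by (simp add: path.emeasure_eq_measure)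
    then have "prob_space (uniform_measure path ?A)" by (rule prob_space_uniform_measure) simp
    moreover have "Y' 1 \<in> measurable (uniform_measure path ?A) (count_space UNIV)"
      using meas[of 1] by (simp add: measurable_def)
    ultimately obtain q where q: "\<And>S. measure_pmf.prob q S = measure (uniform_measure path ?A) {w. Y' 1 w \<in> S}"
      using pmf_of_random_variable[of "uniform_measure path ?A" "Y' 1"] by auto
    have "pmf q y = \<kappa> x y" for y
    proof -
      have "?A \<inter> {w. Y' 1 w = y} = {w. Y' 0 w = x \<and> Y' (0 + 1) w = y}" by auto
      then have "pmf q y = path.prob {w. Y' 0 w = x \<and> Y' (0 + 1) w = y} / path.prob ?A"
        using q[of "{y}"] A0 setx[of 1 y] by (simp add: measure_pmf_single)
      also have "\<dots> = \<kappa> x y" unfolding joint law using False by simp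
      finally show ?thesis .
    qed
    then show ?thesis by blast
  qed simp
  then obtain K where K: "\<And>x y. pmf \<pi> x \<noteq> 0 \<Longrightarrow> pmf (K x) y = \<kappa> x y" by metis
  \<comment> \<open>The given process is controlled on regular paths only, so its events are
    measurable merely in the completion.\<close>
  have transfer: "{\<omega> \<in> space M. \<Phi> (\<lambda>n. Y n \<omega>)} \<in> sets (completion M) \<and>
      measure (completion M) {\<omega> \<in> space M. \<Phi> (\<lambda>n. Y n \<omega>)} = path.prob {w. \<Phi> (\<lambda>n. Y' n w)}"
    if "{w. \<Phi> (\<lambda>n. Y' n w)} \<in> sets path" for \<Phi>
  proof -
    let ?A = "Z -` {w. \<Phi> (\<lambda>n. Y' n w)} \<inter> space M" and ?B = "{\<omega> \<in> space M. \<Phi> (\<lambda>n. Y n \<omega>)}"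
    have A: "?A \<in> sets M" using measurable_sets[OF Z that] .
    have mA: "measure M ?A = path.prob {w. \<Phi> (\<lambda>n. Y' n w)}"
      using measure_distr[OF Z that] by (simp add: dZ)
    have ae: "AE \<omega> in completion M. \<omega> \<in> ?A \<longleftrightarrow> \<omega> \<in> ?B"
      using AE_completion_regular[OF Z dZ] AE_space
    proof eventually_elim
      case (elim \<omega>)
      then have "(\<lambda>n. Y n \<omega>) = (\<lambda>n. Y' n (Z \<omega>))" using Y by auto
      with elim show ?case by simp
    qed
    have B: "?B \<in> sets (completion M)"
      by (rule completion.in_sets_AE[OF ae]) (use A in auto)
    have "measure (completion M) ?B = measure (completion M) ?A"
      using measure_eq_AE[OF ae] A B by simp
    with A B mA show ?thesis by simp
  qed
  have "markov_chain M Y K"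
    unfolding markov_chain_def
  proof (intro conjI allI)
    fix N
    show "Y N \<in> measurable (completion M) (count_space UNIV)"
    proof (rule measurableI)
      fix S :: "'b set"
      have "{\<omega> \<in> space M. Y N \<omega> \<in> S} \<in> sets (completion M)"
        using transfer[of "\<lambda>f. f N \<in> S"] set1 by simp
      moreover have "Y N -` S \<inter> space (completion M) = {\<omega> \<in> space M. Y N \<omega> \<in> S}" by auto
      ultimately show "Y N -` S \<inter> space (completion M) \<in> sets (completion M)" by simp
    qed simp
  next
    fix N and xs :: "'b list" and x y
    let ?P = "\<lambda>f. (\<forall>i<length xs. f (N - int (length xs) + int i) = xs ! i) \<and> f N = x"
    have sets2: "{w. ?P (\<lambda>n. Y' n w) \<and> Y' (N + 1) w = y} \<in> sets path"
      unfolding Collect_conj_eq[of "\<lambda>w. ?P (\<lambda>n. Y' n w)"] by (intro sets.Int past setx)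
    have "measure (completion M) {\<omega> \<in> space M. ?P (\<lambda>n. Y n \<omega>) \<and> Y (N + 1) \<omega> = y} =
        path.prob {w. ?P (\<lambda>n. Y' n w) \<and> Y' (N + 1) w = y}"
      by (rule transfer[of "\<lambda>f. ?P f \<and> f (N + 1) = y", OF sets2, THEN conjunct2])
    also have "\<dots> = path.prob {w. ?P (\<lambda>n. Y' n w)} * pmf (K x) y"
    proof (cases "pmf \<pi> x = 0")
      case True
      \<comment> \<open>For a null state both sides of the Markov equation vanish, whatever the
        kernel is there.\<close>
      have "path.prob {w. ?P (\<lambda>n. Y' n w)} \<le> path.prob {w. Y' N w = x}"
        using setx by (intro path.finite_measure_mono) auto
      then have "path.prob {w. ?P (\<lambda>n. Y' n w)} = 0"
        using law[of N x] True by (simp add: measure_le_0_iff)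
      then show ?thesis using step[of xs N x y] by simp
    next
      case False
      then show ?thesis using step[of xs N x y] K by simp
    qed
    also have "path.prob {w. ?P (\<lambda>n. Y' n w)} = measure (completion M) {\<omega> \<in> space M. ?P (\<lambda>n. Y n \<omega>)}"
      by (rule transfer[of ?P, OF past, THEN conjunct2, symmetric])
    finally show "measure (completion M) {\<omega> \<in> space M. (\<forall>i<length xs. Y (N - int (length xs) + int i) \<omega> = xs ! i) \<and> Y N \<omega> = x \<and> Y (N + 1) \<omega> = y} =
      measure (completion M) {\<omega> \<in> space M. (\<forall>i<length xs. Y (N - int (length xs) + int i) \<omega> = xs ! i) \<and> Y N \<omega> = x} * pmf (K x) y"
      by (simp only: conj_assoc)
  qed
  moreover have "bind_pmf \<pi> K = \<pi>"
  proof (rule pmf_eqI)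
    fix y
    have "ennreal (pmf (bind_pmf \<pi> K) y) = (\<integral>\<^sup>+x. ennreal (pmf \<pi> x) * ennreal (pmf (K x) y) \<partial>count_space UNIV)"
      by (simp add: ennreal_pmf_bind nn_integral_measure_pmf)
    also have "\<dots> = (\<integral>\<^sup>+x. emeasure path {w. Y' 0 w = x \<and> Y' (0 + 1) w = y} \<partial>count_space UNIV)"
    proof (intro nn_integral_cong)
      fix x show "ennreal (pmf \<pi> x) * ennreal (pmf (K x) y) = emeasure path {w. Y' 0 w = x \<and> Y' (0 + 1) w = y}"
        unfolding path.emeasure_eq_measure joint using K[of x y]
        by (cases "pmf \<pi> x = 0") (simp_all add: ennreal_mult')
    qed
    also have "\<dots> = emeasure path (\<Union>x. {w. Y' 0 w = x \<and> Y' (0 + 1) w = y})"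
    proof (rule emeasure_UN_countable[symmetric])
      show "{w. Y' 0 w = x \<and> Y' (0 + 1) w = y} \<in> sets path" for x
        using sets.Int[OF setx[of 0 x] setx[of "0 + 1" y]] by (simp add: Collect_conj_eq)
    qed (auto simp: disjoint_family_on_def)
    also have "(\<Union>x. {w. Y' 0 w = x \<and> Y' (0 + 1) w = y}) = {w. Y' 1 w = y}" by auto
    finally show "pmf (bind_pmf \<pi> K) y = pmf \<pi> y"
      using law[of 1 y] by (simp add: path.emeasure_eq_measure)
  qed
  moreover have "measure (completion M) {\<omega> \<in> space M. Y N \<omega> = x} = pmf \<pi> x" for N x
    using transfer[of "\<lambda>f. f N = x"] setx law by simp
  ultimately show ?thesis unfolding stationary_distribution_of_chain_def by blast
qed

lemma prob_coord_in: "path.prob {w. w n \<in> S} = measure_pmf.prob p S"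
proof -
  have "path.prob {w. w n \<in> S} = measure (distr path (measure_pmf p) (\<lambda>w. w n)) S"
    by (subst measure_distr) (auto intro: measurable_component_singleton simp: vimage_def)
  then show ?thesis by (simp add: distr_coord)
qed

lemma stationary_distribution_U:
  assumes Z: "(\<lambda>\<omega> n. z n \<omega>) \<in> measurable M path" and dZ: "distr M path (\<lambda>\<omega> n. z n \<omega>) = path"
  shows "stationary_distribution_of_chain M (U_process G z) stationary_U"
proof (rule stationary_distribution_of_chainI[OF Z dZ, where Y' = U_state and
      \<kappa> = "\<lambda>x y. measure_pmf.prob p {i. U_step G x i = y}"])
  show "U_process G z N \<omega> = U_state N (\<lambda>n. z n \<omega>)" if "regular G (\<lambda>n. z n \<omega>)" for N \<omega>
    unfolding U_process_def Let_def by (rule U_state_eq[OF that])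
  show "U_state N \<in> measurable path (count_space UNIV)" for N by (rule measurable_U_state)
  show "path.prob {w. U_state N w = x} = pmf stationary_U x" for N x
    using prob_U_state[of N "{x}"] by (simp add: measure_pmf_single)
  fix N and xs :: "('c, 's) item entry list list" and x y :: "('c, 's) item entry list"
  let ?P = "\<lambda>w. (\<forall>i<length xs. U_state (N - int (length xs) + int i) w = xs ! i) \<and> U_state N w = x"
  let ?R = "{w. w (N + 1) \<in> {i. U_step G x i = y}}"
  have setx: "{w. U_state N w = x} \<in> sets path" for N x using sets_U_state[of N "{x}"] by simp
  have sets_P: "{w. ?P w} \<in> sets path" by (rule sets_past[of U_state, OF setx])
  have sets_R: "?R \<in> sets path"
    using sets_window[of "\<lambda>v. U_step G x (hd v) = y" "[N + 1]"] by simp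
  have "depends_on {..N} {w. ?P w}"
    unfolding depends_on_def
  proof (intro allI impI)
    fix w w' :: "int \<Rightarrow> ('c, 's) item" assume "\<forall>n\<in>{..N}. w n = w' n"
    then have "U_state n w = U_state n w'" if "n \<le> N" for n
      using that by (intro U_state_cong) auto
    then show "w \<in> {w. ?P w} \<longleftrightarrow> w' \<in> {w. ?P w}" by auto
  qed
  moreover have "depends_on (- {..N}) ?R"
    by (auto simp: depends_on_def)
  moreover have "(w \<in> ?R) = (U_state (N + 1) w = y)" if "regular G w" "U_state N w = x" for w
    using U_state_step[OF that(1), of N] that(2) by simp
  ultimately show "\<exists>D R I. D \<in> sets path \<and> R \<in> sets path \<and> depends_on I D \<and> depends_on (- I) R \<and>
      path.prob R = measure_pmf.prob p {i. U_step G x i = y} \<and> (\<forall>w. regular G w \<longrightarrow>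
        (w \<in> D \<longleftrightarrow> ?P w) \<and> (U_state N w = x \<longrightarrow> (w \<in> R \<longleftrightarrow> U_state (N + 1) w = y)))"
    using sets_P sets_R prob_coord_in[of "N + 1" "{i. U_step G x i = y}"]
    by - (rule exI[of _ "{w. ?P w}"], rule exI[of _ ?R], rule exI[of _ "{..N}"], blast)
qed

section \<open>W on the path space\<close>

abbreviation queue_state :: "int \<Rightarrow> (int \<Rightarrow> ('c, 's) item) \<Rightarrow> 'c list" where
  "queue_state N w \<equiv> waiting (U_state N w)"

text \<open>A measurable version of W. The shortest window that serves the whole queue is taken for
  definiteness; longer ones give the same state after \<open>strip\<close>.\<close>

definition W_state :: "int \<Rightarrow> (int \<Rightarrow> ('c, 's) item) \<Rightarrow> ('c, 's) item entry list" where
  "W_state N w = strip (serve G (queue_state N w)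
     (map w [N + 1..N + int (LEAST l. left_over G (queue_state N w) (map w [N + 1..N + int l]) = [])]))"

lemma measurable_U_window: "(\<lambda>w. f (U_state N w) (map w ps)) \<in> measurable path (count_space UNIV)"
  by (rule measurable_compose_countable[where f = "\<lambda>u w. f u (map w ps)", OF measurable_window measurable_U_state])

lemma sets_U_window: "{w. Q (U_state N w) (map w ps)} \<in> sets path"
  using measurable_sets[OF measurable_U_window[of Q N ps], of "{True}"] by (simp add: vimage_def)

lemma measurable_W_state: "W_state N \<in> measurable path (count_space UNIV)"
proof -
  have "(\<lambda>w. LEAST l. left_over G (queue_state N w) (map w [N + 1..N + int l]) = []) \<in> measurable path (count_space UNIV)"
    by (intro measurable_Least measurable_U_window[of "\<lambda>u zs. left_over G (waiting u) zs = []"])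
  then have "(\<lambda>w. (\<lambda>l w. strip (serve G (queue_state N w) (map w [N + 1..N + int l])))
      (LEAST l. left_over G (queue_state N w) (map w [N + 1..N + int l]) = []) w) \<in> measurable path (count_space UNIV)"
    by (rule measurable_compose_countable[where f = "\<lambda>l w. strip (serve G (queue_state N w) (map w [N + 1..N + int l]))",
          OF measurable_U_window[of "\<lambda>u zs. strip (serve G (waiting u) zs)"]])
  then show ?thesis unfolding W_state_def[abs_def] by simp
qed

lemma regular_W:
  assumes "regular G w"
  shows "N \<le> M \<Longrightarrow> left_over G (queue_state N w) (map w [N + 1..M]) = [] \<Longrightarrow>
      W_state N w = strip (serve G (queue_state N w) (map w [N + 1..M]))"
    and "W_path w (the_matching G w) N = W_state N w"
    and "\<exists>M\<ge>N. left_over G (queue_state N w) (map w [N + 1..M]) = []"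
proof -
  note k = regular_start[OF assms, of N]
  note R = regular_processes[OF assms k(2,1), folded U_state_def]
  show ex: "\<exists>M\<ge>N. left_over G (queue_state N w) (map w [N + 1..M]) = []" by (rule R(3))
  then obtain M where "N \<le> M" "left_over G (queue_state N w) (map w [N + 1..M]) = []" by blast
  then have "left_over G (queue_state N w) (map w [N + 1..N + int (nat (M - N))]) = []" by simp
  then have "left_over G (queue_state N w)
      (map w [N + 1..N + int (LEAST l. left_over G (queue_state N w) (map w [N + 1..N + int l]) = [])]) = []"
    by (rule LeastI)
  from R(2)[OF _ this] show W: "W_path w (the_matching G w) N = W_state N w" unfolding W_state_def by simp
  show "W_state N w = strip (serve G (queue_state N w) (map w [N + 1..M]))"
    if "N \<le> M" "left_over G (queue_state N w) (map w [N + 1..M]) = []" for M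
    using R(2)[OF that] W by simp
qed

lemma left_over_extend:
  assumes "left_over G x (map w [N + 1..M]) = []" "N \<le> M" "M \<le> M'"
  shows "left_over G x (map w [N + 1..M']) = []"
  using assms upto_append[of N M M'] by (simp add: left_over_append)

lemma W_state_eq_iff:
  assumes "regular G w"
  shows "W_state N w = u \<longleftrightarrow> finishes G (queue_state N w) (map w [N + 1..N + int (length u)]) u"
proof -
  obtain M where M: "N \<le> M" "left_over G (queue_state N w) (map w [N + 1..M]) = []"
    using regular_W(3)[OF assms] by blast
  define M' where "M' = max M (N + int (length u))"
  have M': "left_over G (queue_state N w) (map w [N + 1..M']) = []"
    using M unfolding M'_def by (intro left_over_extend[OF M(2,1)]) auto
  have "[N + 1..M'] = [N + 1..N + int (length u)] @ [N + int (length u) + 1..M']"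
    by (intro upto_append) (auto simp: M'_def)
  moreover have "W_state N w = strip (serve G (queue_state N w) (map w [N + 1..M']))"
    using M M' by (intro regular_W(1)[OF assms]) (auto simp: M'_def)
  ultimately show ?thesis
    using strip_serve_eq_iff[of G "queue_state N w" "map w [N + 1..N + int (length u)]" "map w [N + int (length u) + 1..M']" u] M'
    by simp
qed

text \<open>Lets one window end serve for the present and all earlier observation points, as the
  Markov property of W requires.\<close>

lemma left_over_earlier:
  assumes "regular G w" "left_over G (queue_state N w) (map w [N + 1..M]) = []" "N \<le> M" "k \<le> N"
  shows "left_over G (queue_state k w) (map w [k + 1..M]) = []"
  using assms(4)
proof (induction k rule: int_le_induct)
  case (step k)
  have "queue_state k w = queue_step G (queue_state (k - 1) w) (w k)"
    using U_state_step[OF assms(1), of "k - 1"] by (simp add: waiting_U_step)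
  moreover have "[k - 1 + 1..M] = k # [k + 1..M]" using step.hyps assms(3) by (simp add: upto_rec1)
  ultimately show ?case using left_over_queue_step[of G "queue_state (k - 1) w" "w k"] step.IH by simp
qed (use assms in simp)

lemma sum_finishes:
  "(\<Sum>zs | length zs = length u. item_weight zs * of_bool (serve G x zs = u \<and> left_over G x zs = [])) = serve_prob x u"
proof (induction u arbitrary: x)
  case Nil
  have "{zs :: ('c, 's) item list. length zs = 0} = {[]}" by auto
  then show ?case by simp
next
  case (Cons e u)
  let ?S = "\<lambda>x u. \<Sum>zs | length zs = length u. item_weight zs * of_bool (serve G x zs = u \<and> left_over G x zs = [])"
  define g where "g i = (\<Sum>zs | length zs = length u. item_weight zs *
    of_bool (serve G x (i # zs) = e # u \<and> left_over G x (i # zs) = []))" for i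
  have "?S x (e # u) = (\<Sum>i\<in>UNIV. pmf p i * g i)"
    unfolding g_def length_Cons sum_lists_length_Suc by (simp only: sum_distrib_left item_weight_simps mult.assoc)
  also have "\<dots> = (\<Sum>c\<in>UNIV. pmf p (Agent c) * g (Agent c)) + (\<Sum>s\<in>UNIV. pmf p (Good s) * g (Good s))"
    by (rule sum_item)
  finally have S: "?S x (e # u) = \<dots>" .
  have gA: "g (Agent c) = of_bool (e = Plain (Agent c)) * serve_prob x u" for c
    unfolding g_def Cons.IH[symmetric] by (auto simp: sum_distrib_left intro!: sum.cong)
  have gG: "g (Good s) = of_bool (e = Plain (Good s)) *
        (of_bool (find (\<lambda>c. (s, c) \<in> G) x = None) * serve_prob x u) +
      (\<Sum>c\<in>UNIV. of_bool (e = Tilde (Agent c)) * (of_bool (find (\<lambda>c. (s, c) \<in> G) x = Some c) *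
        serve_prob (remove_first (\<lambda>c. (s, c) \<in> G) x) u))" for s
  proof (cases "find (\<lambda>c. (s, c) \<in> G) x")
    case None
    then show ?thesis
      unfolding g_def Cons.IH[symmetric] by (auto simp: sum_distrib_left remove_first_None intro!: sum.cong)
  next
    case (Some c)
    have "(\<Sum>c'\<in>UNIV. of_bool (e = Tilde (Agent c')) * (of_bool (Some c = Some c') *
        serve_prob (remove_first (\<lambda>c. (s, c) \<in> G) x) u)) =
        (\<Sum>c'\<in>UNIV. if c' = c then of_bool (e = Tilde (Agent c)) * serve_prob (remove_first (\<lambda>c. (s, c) \<in> G) x) u else 0)"
      by (intro sum.cong) auto
    with Some show ?thesis
      unfolding g_def Cons.IH[symmetric] by (auto simp: sum_distrib_left intro!: sum.cong)
  qed
  have delta: "(\<Sum>a\<in>UNIV. f a * (of_bool (b = a) * h a)) = f b * h b" for f h :: "'x::finite \<Rightarrow> real" and b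
  proof -
    have "(\<Sum>a\<in>UNIV. f a * (of_bool (b = a) * h a)) = (\<Sum>a\<in>UNIV. if a = b then f b * h b else 0)"
      by (intro sum.cong) auto
    then show ?thesis by simp
  qed
  have delta1: "(\<Sum>a\<in>UNIV. of_bool (b = a) * h a) = h b" for h :: "'x::finite \<Rightarrow> real" and b
    using delta[of "\<lambda>_. 1" b h] by simp
  show ?case
    unfolding S gA gG by (cases e; cases "letter e") (simp_all add: delta delta1)
qed

definition W_prob :: "('c, 's) item entry list \<Rightarrow> real" where
  "W_prob u = of_bool (u = [] \<or> is_tilde (last u)) *
     (\<Sum>x | length x = length (filter is_tilde u). queue_weight {} x * serve_prob x u) / total_weight"

lemma W_prob_cases: "W_prob u = 0 \<or> W_prob u = weight u / total_weight"
  using sum_serve_prob[of u] by (auto simp: W_prob_def)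

lemma prob_W_state: "path.prob {w. W_state N w = u} = W_prob u"
proof -
  let ?win = "\<lambda>w. map w [N + 1..N + int (length u)]"
  let ?X = "{x :: 'c list. length x = length (filter is_tilde u)}"
  have "path.prob {w. W_state N w = u} = path.prob {w. finishes G (queue_state N w) (?win w) u}"
  proof (rule path.finite_measure_eq_AE)
    show "AE w in path. (w \<in> {w. W_state N w = u}) = (w \<in> {w. finishes G (queue_state N w) (?win w) u})"
      using AE_regular by eventually_elim (simp add: W_state_eq_iff)
    show "{w. W_state N w = u} \<in> sets path"
      using measurable_sets[OF measurable_W_state[of N], of "{u}"] by (simp add: vimage_def)
    show "{w. finishes G (queue_state N w) (?win w) u} \<in> sets path"
      by (rule sets_U_window[of "\<lambda>v zs. finishes G (waiting v) zs u"])
  qed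
  also have "{w. finishes G (queue_state N w) (?win w) u} =
      (\<Union>x\<in>?X. {w. queue_state N w = x} \<inter> {w. finishes G x (?win w) u})"
  proof (intro set_eqI iffI)
    fix w assume "w \<in> {w. finishes G (queue_state N w) (?win w) u}"
    then have f: "finishes G (queue_state N w) (?win w) u" by simp
    \<comment> \<open>The tildes of \<open>u\<close> fix the length of the queue, so the union below
      is finite.\<close>
    then have "queue_state N w \<in> ?X"
      using length_left_over[of "queue_state N w" G "?win w"] by (simp add: finishes_def)
    with f show "w \<in> (\<Union>x\<in>?X. {w. queue_state N w = x} \<inter> {w. finishes G x (?win w) u})" by blast
  qed auto
  also have "path.prob \<dots> = (\<Sum>x\<in>?X. path.prob ({w. queue_state N w = x} \<inter> {w. finishes G x (?win w) u}))"
    using sets_U_window[of "\<lambda>v zs. waiting v = _" N "[]"] sets_window[of "\<lambda>zs. finishes G _ zs u"]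
    by (intro path.finite_measure_finite_Union) (auto simp: disjoint_family_on_def)
  also have "\<dots> = (\<Sum>x\<in>?X. queue_weight {} x / total_weight * (of_bool (u = [] \<or> is_tilde (last u)) * serve_prob x u))"
  proof (intro sum.cong refl)
    fix x
    have "path.prob ({w. queue_state N w = x} \<inter> {w. finishes G x (?win w) u}) =
        path.prob {w. queue_state N w = x} * path.prob {w. finishes G x (?win w) u}"
    proof (rule prob_depends_on_Int[where I = "{..N}" and J = "{N<..}"])
      show "{w. queue_state N w = x} \<in> sets path"
        using sets_U_window[of "\<lambda>v zs. waiting v = x" N "[]"] .
      show "{w. finishes G x (?win w) u} \<in> sets path" by (rule sets_window)
      show "depends_on {N<..} {w. finishes G x (?win w) u}" by (rule depends_on_window) auto
      show "depends_on {..N} {w. queue_state N w = x}" by (rule depends_on_U_state)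
    qed auto
    also have "path.prob {w. queue_state N w = x} = queue_weight {} x / total_weight"
      using prob_U_state[of N "{v. waiting v = x}"] prob_stationary_U[where a = "queue_weight {} x" and A = "{v. waiting v = x}"]
        has_sum_admissible_waiting[of x] by simp
    also have "path.prob {w. finishes G x (?win w) u} =
        (\<Sum>zs | length zs = length u. item_weight zs * of_bool (finishes G x zs u))"
      by (rule prob_window_pred)
    also have "\<dots> = of_bool (u = [] \<or> is_tilde (last u)) * serve_prob x u"
      unfolding sum_finishes[symmetric] sum_distrib_left by (intro sum.cong) (auto simp: finishes_def)
    finally show "path.prob ({w. queue_state N w = x} \<inter> {w. finishes G x (?win w) u}) =
        queue_weight {} x / total_weight * (of_bool (u = [] \<or> is_tilde (last u)) * serve_prob x u)" .
  qed
  also have "\<dots> = W_prob u"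
    unfolding W_prob_def sum_distrib_left sum_divide_distrib by (intro sum.cong) (auto simp: field_simps)
  finally show ?thesis .
qed

text \<open>Given the current state \<open>x\<close>, the next one is a function of the items beyond it.\<close>

definition W_next :: "int \<Rightarrow> ('c, 's) item entry list \<Rightarrow> ('c, 's) item entry list \<Rightarrow> (int \<Rightarrow> ('c, 's) item) set" where
  "W_next a x y = {w. \<exists>r0. \<forall>r\<ge>r0. strip (advance G (x @ map Plain (map w [a + 1..a + int r]))) = y}"

lemma sets_W_next: "W_next a x y \<in> sets path"
proof -
  define A where "A r = {w. strip (advance G (x @ map Plain (map w [a + 1..a + int r]))) = y}" for r
  have A: "A r \<in> sets path" for r
    unfolding A_def by (rule sets_window)
  have "W_next a x y = (\<Union>r0. \<Inter>r\<in>{r0..}. A r)"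
    by (auto simp: W_next_def A_def)
  moreover have "(\<Inter>r\<in>{r0..}. A r) \<in> sets path" for r0
    using A by (intro sets.countable_INT') auto
  ultimately show ?thesis by auto
qed

lemma depends_on_W_next: "depends_on {a<..} (W_next a x y)"
  unfolding depends_on_def
proof (intro allI impI)
  fix w w' :: "int \<Rightarrow> ('c, 's) item" assume "\<forall>n\<in>{a<..}. w n = w' n"
  then have "map w [a + 1..a + int r] = map w' [a + 1..a + int r]" for r by (intro map_cong) auto
  then show "w \<in> W_next a x y \<longleftrightarrow> w' \<in> W_next a x y"
    unfolding W_next_def by (simp del: map_eq_conv map_map)
qed

lemma prob_W_next: "path.prob (W_next a x y) = path.prob (W_next 0 x y)"
proof -
  have "{w. (\<lambda>n. w (n + a)) \<in> W_next 0 x y} = W_next a x y"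
    unfolding W_next_def mem_Collect_eq map_upto_shift by (simp add: add.commute)
  then show ?thesis using prob_shift[OF sets_W_next[of 0 x y], of a] by simp
qed

text \<open>The entries \<open>x\<close> already contain all service given to the queue of
  \<open>N\<close>; behind them the items are unaltered. Moving the observation point by one is then
  \<open>advance\<close>, and a window that is long enough reveals the next state.\<close>

lemma W_state_step:
  assumes "regular G w" "W_state N w = x"
  shows "W_state (N + 1) w = y \<longleftrightarrow> w \<in> W_next (N + int (length x)) x y"
proof -
  let ?a = "N + int (length x)"
  let ?f = "\<lambda>r. strip (advance G (x @ map Plain (map w [?a + 1..?a + int r])))"
  have fin: "finishes G (queue_state N w) (map w [N + 1..?a]) x"
    using W_state_eq_iff[OF assms(1)] assms(2) by simp
  obtain M where M: "N + 1 \<le> M" "left_over G (queue_state (N + 1) w) (map w [N + 1 + 1..M]) = []"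
    using regular_W(3)[OF assms(1)] by blast
  have f: "?f r = W_state (N + 1) w" if "r \<ge> nat (M - N)" for r
  proof -
    have r: "M \<le> ?a + int r" using that by simp
    have "[N + 1..?a + int r] = [N + 1..?a] @ [?a + 1..?a + int r]" by (intro upto_append) auto
    then have "serve G (queue_state N w) (map w [N + 1..?a + int r]) = x @ map Plain (map w [?a + 1..?a + int r])"
      using fin by (simp add: serve_append finishes_def)
    moreover have "[N + 1..?a + int r] = (N + 1) # [N + 1 + 1..?a + int r]"
      using r M(1) by (intro upto_rec1) simp
    ultimately have "advance G (x @ map Plain (map w [?a + 1..?a + int r])) =
        advance G (serve G (queue_state N w) (w (N + 1) # map w [N + 1 + 1..?a + int r]))"
      by (metis list.simps(9))
    also have "\<dots> = serve G (queue_step G (queue_state N w) (w (N + 1))) (map w [N + 1 + 1..?a + int r])"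
      by (rule advance_serve)
    also have "queue_step G (queue_state N w) (w (N + 1)) = queue_state (N + 1) w"
      unfolding U_state_step[OF assms(1)] waiting_U_step ..
    finally show ?thesis
      using regular_W(1)[OF assms(1), of "N + 1" "?a + int r"] left_over_extend[OF M(2,1) r] M(1) r by simp
  qed
  show ?thesis
  proof
    assume "W_state (N + 1) w = y"
    with f show "w \<in> W_next ?a x y" unfolding W_next_def by auto
  next
    assume "w \<in> W_next ?a x y"
    then obtain r0 where "\<forall>r\<ge>r0. ?f r = y" unfolding W_next_def by blast
    then have "?f (max r0 (nat (M - N))) = y" by simp
    then show "W_state (N + 1) w = y" using f[of "max r0 (nat (M - N))"] by simp
  qed
qed

text \<open>The independence cut is made at the end of the current state,
  \<open>N + length x\<close>. By then all earlier queues are served as well, so the past states in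
  \<open>?D\<close> are determined by the items up to the cut, and \<open>W_next\<close> by those
  after it.\<close>

lemma stationary_distribution_W:
  assumes Z: "(\<lambda>\<omega> n. z n \<omega>) \<in> measurable M path" and dZ: "distr M path (\<lambda>\<omega> n. z n \<omega>) = path"
    and law: "\<And>u. pmf \<pi> u = W_prob u"
  shows "stationary_distribution_of_chain M (W_process G z) \<pi>"
proof (rule stationary_distribution_of_chainI[OF Z dZ, where Y' = W_state and \<kappa> = "\<lambda>x y. path.prob (W_next 0 x y)"])
  show "W_process G z N \<omega> = W_state N (\<lambda>n. z n \<omega>)" if "regular G (\<lambda>n. z n \<omega>)" for N \<omega>
    unfolding W_process_def Let_def by (rule regular_W(2)[OF that])
  show "W_state N \<in> measurable path (count_space UNIV)" for N by (rule measurable_W_state)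
  show "path.prob {w. W_state N w = x} = pmf \<pi> x" for N x
    unfolding law by (rule prob_W_state)
  fix N and xs :: "('c, 's) item entry list list" and x y :: "('c, 's) item entry list"
  let ?a = "N + int (length x)" and ?k = "\<lambda>i. N - int (length xs) + int i"
  let ?P = "\<lambda>w. (\<forall>i<length xs. W_state (?k i) w = xs ! i) \<and> W_state N w = x"
  let ?D = "{w. (\<forall>i<length xs. strip (serve G (queue_state (?k i) w) (map w [?k i + 1..?a])) = xs ! i) \<and>
    finishes G (queue_state N w) (map w [N + 1..?a]) x}"
  have setx: "{w. W_state N w = x} \<in> sets path" for N x
    using measurable_sets[OF measurable_W_state[of N], of "{x}"] by (simp add: vimage_def)
  have INT: "(\<Inter>i\<in>I. A i) \<in> sets path" if "finite I" "\<And>i. A i \<in> sets path" for I :: "nat set" and A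
    using that by (induction I) (use sets.top[of path] in auto)
  have "?D = (\<Inter>i\<in>{..<length xs}. {w. strip (serve G (queue_state (?k i) w) (map w [?k i + 1..?a])) = xs ! i}) \<inter>
      {w. finishes G (queue_state N w) (map w [N + 1..?a]) x}" by auto
  also have "\<dots> \<in> sets path"
    by (intro sets.Int INT sets_U_window[of "\<lambda>v zs. finishes G (waiting v) zs x"]
        sets_U_window[of "\<lambda>v zs. strip (serve G (waiting v) zs) = xs ! _"]) simp
  finally have sets_D: "?D \<in> sets path" .
  have iff: "?P w \<longleftrightarrow> w \<in> ?D" if w: "regular G w" for w
  proof -
    have "W_state (?k i) w = strip (serve G (queue_state (?k i) w) (map w [?k i + 1..?a]))"
      if "finishes G (queue_state N w) (map w [N + 1..?a]) x" "i < length xs" for i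
      using that left_over_earlier[OF w, of N ?a "?k i"]
      by (intro regular_W(1)[OF w]) (auto simp: finishes_def)
    then show ?thesis using W_state_eq_iff[OF w, of N x] by auto
  qed
  have "depends_on {..?a} ?D"
    unfolding depends_on_def
  proof (intro allI impI)
    fix w w' :: "int \<Rightarrow> ('c, 's) item" assume w: "\<forall>n\<in>{..?a}. w n = w' n"
    then have "U_state n w = U_state n w'" if "n \<le> N" for n
      using that by (intro U_state_cong) auto
    moreover have "map w [n + 1..?a] = map w' [n + 1..?a]" for n using w by (intro map_cong) auto
    ultimately show "w \<in> ?D \<longleftrightarrow> w' \<in> ?D" by (auto simp del: map_eq_conv)
  qed
  moreover have "depends_on (- {..?a}) (W_next ?a x y)"
    using depends_on_W_next[of ?a x y] by (simp add: Compl_atMost)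
  ultimately show "\<exists>D R I. D \<in> sets path \<and> R \<in> sets path \<and> depends_on I D \<and> depends_on (- I) R \<and>
      path.prob R = path.prob (W_next 0 x y) \<and> (\<forall>w. regular G w \<longrightarrow>
        (w \<in> D \<longleftrightarrow> ?P w) \<and> (W_state N w = x \<longrightarrow> (w \<in> R \<longleftrightarrow> W_state (N + 1) w = y)))"
    using sets_D sets_W_next prob_W_next[of ?a x y] iff W_state_step[of _ N x y]
    by - (rule exI[of _ ?D], rule exI[of _ "W_next ?a x y"], rule exI[of _ "{..?a}"], blast)
qed

text \<open>That the masses add up to 1 needs no computation, because \<open>W_prob\<close> is the
  law of a random variable.\<close>

lemma exists_stationary_W: "\<exists>\<pi>. \<forall>u. pmf \<pi> u = W_prob u"
proof -
  obtain q where "\<And>S. measure_pmf.prob q S = path.prob {w. W_state 0 w \<in> S}"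
    using pmf_of_random_variable[OF path.prob_space_axioms measurable_W_state[of 0]] by auto
  then have "pmf q u = W_prob u" for u
    using prob_W_state[of 0 u] by (simp add: measure_pmf_single[symmetric])
  then show ?thesis by blast
qed

end

theorem theorem4:
  fixes G :: "('s::finite \<times> 'c::finite) set"
    and lb mb :: real
    and \<alpha> :: "'c \<Rightarrow> real" and \<beta> :: "'s \<Rightarrow> real"
    and M :: "'a measure"
    and z :: "int \<Rightarrow> 'a \<Rightarrow> ('c, 's) item"
  assumes "lb > 0" and "mb > 0"
    and "\<And>c. \<alpha> c \<ge> 0" and "(\<Sum>c\<in>UNIV. \<alpha> c) = 1"
    and "\<And>s. \<beta> s \<ge> 0" and "(\<Sum>s\<in>UNIV. \<beta> s) = 1"
    and "prob_space M"
    and "prob_space.indep_vars M (\<lambda>_. count_space UNIV) z UNIV"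
    and "\<And>n c. measure M {\<omega> \<in> space M. z n \<omega> = Agent c} = lb * \<alpha> c / (lb + mb)"
    and "\<And>n s. measure M {\<omega> \<in> space M. z n \<omega> = Good s} = mb * \<beta> s / (lb + mb)"
    and stability: "\<And>C. C \<noteq> {} \<Longrightarrow> agent_rate lb \<alpha> C < good_rate mb \<beta> (compatible_goods G C)"
  shows "\<exists>\<pi>U \<pi>W.
    stationary_distribution_of_chain M (U_process G z) \<pi>U \<and>
    stationary_distribution_of_chain M (W_process G z) \<pi>W \<and>
    (\<forall>u. pmf \<pi>U u > 0 \<longrightarrow> pmf \<pi>U u = product_form G lb mb \<alpha> \<beta> u) \<and>
    (\<forall>u. pmf \<pi>W u > 0 \<longrightarrow> pmf \<pi>W u = product_form G lb mb \<alpha> \<beta> u)"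
proof -
  interpret M: prob_space M by fact
  have rate: "0 < lb + mb" using assms(1,2) by simp
  have rv: "z n \<in> measurable M (count_space UNIV)" for n
    using assms(8) unfolding M.indep_vars_def by auto
  obtain p where p0: "\<And>S. measure_pmf.prob p S = measure M {\<omega> \<in> space M. z 0 \<omega> \<in> S}"
    using pmf_of_random_variable[OF assms(7) rv[of 0]] by auto
  have pmf_p: "pmf p (Agent c) = lb * \<alpha> c / (lb + mb)" "pmf p (Good s) = mb * \<beta> s / (lb + mb)" for c s
    using p0[of "{Agent c}"] p0[of "{Good s}"] assms(9)[of 0 c] assms(10)[of 0 s]
    by (simp_all add: measure_pmf_single)
  have rv': "z n \<in> measurable M (measure_pmf p)" for n
    using rv[of n] by (simp add: measurable_def)
  have dz: "distr M (measure_pmf p) (z n) = measure_pmf p" for n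
  proof (rule measure_eqI_countable[where A = UNIV])
    interpret D: prob_space "distr M (measure_pmf p) (z n)" using rv' by (rule M.prob_space_distr)
    fix i
    have "measure (distr M (measure_pmf p) (z n)) {i} = measure M {\<omega> \<in> space M. z n \<omega> = i}"
      using rv' by (subst measure_distr) (auto intro!: arg_cong[where f = "measure M"])
    also have "\<dots> = pmf p i" by (cases i) (simp_all add: pmf_p assms(9,10))
    finally show "emeasure (distr M (measure_pmf p) (z n)) {i} = emeasure (measure_pmf p) {i}"
      by (simp add: D.emeasure_eq_measure emeasure_pmf_single)
  qed auto
  have "M.indep_vars (\<lambda>_. measure_pmf p) z UNIV"
    using assms(8) unfolding M.indep_vars_def by (simp add: rv)
  then have "distr M (PiM UNIV (\<lambda>_. measure_pmf p)) (\<lambda>\<omega>. \<lambda>n\<in>UNIV. z n \<omega>) =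
      PiM UNIV (\<lambda>n. distr M (measure_pmf p) (z n))"
    by (subst (asm) M.indep_vars_iff_distr_eq_PiM) (auto simp: rv)
  then have dZ: "distr M (PiM UNIV (\<lambda>_. measure_pmf p)) (\<lambda>\<omega> n. z n \<omega>) = PiM UNIV (\<lambda>_. measure_pmf p)"
    by (simp add: dz restrict_def)
  have Z: "(\<lambda>\<omega> n. z n \<omega>) \<in> measurable M (PiM UNIV (\<lambda>_. measure_pmf p))"
    by (rule measurable_PiM_single') (use rv' in auto)
  have agents: "(\<Sum>c\<in>C. pmf p (Agent c)) = agent_rate lb \<alpha> C / (lb + mb)" for C
    by (simp add: pmf_p agent_rate_def sum_divide_distrib)
  have goods: "(\<Sum>s\<in>S. pmf p (Good s)) = good_rate mb \<beta> S / (lb + mb)" for S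
    by (simp add: pmf_p good_rate_def sum_divide_distrib)
  \<comment> \<open>Dividing the rates by their total turns the stability condition into that of the
    locale.\<close>
  interpret fcfs_model G p
    by standard (use stability rate in \<open>simp add: agents goods divide_strict_right_mono\<close>)
  have norm: "normalizing_constant G lb mb \<alpha> \<beta> = inverse total_weight"
    unfolding normalizing_constant_def total_weight_eq
  proof (intro arg_cong[where f = inverse] sum.cong refl)
    fix k C xs assume "C \<in> {C :: 'c set. card C = k}" "xs \<in> permutations_of_set C"
    then have len: "length xs = k" by (auto simp: permutations_of_set_def distinct_card)
    \<comment> \<open>The total rate cancels in each factor, so rates may replace probabilities in
      the normalizing constant.\<close>
    have "agent_rate lb \<alpha> {c} / (good_rate mb \<beta> (compatible_goods G A) - agent_rate lb \<alpha> A) =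
        pmf p (Agent c) / (mass_goods A - mass_agents A)" for c A
      unfolding mass_goods_def mass_agents_def goods agents
      using rate by (simp add: pmf_p agent_rate_def diff_divide_distrib[symmetric])
    then show "(\<Prod>l = 1..k. agent_rate lb \<alpha> {xs ! (l - 1)} /
        (good_rate mb \<beta> (compatible_goods G (set (take l xs))) - agent_rate lb \<alpha> (set (take l xs)))) = order_weight {} xs"
      by (simp add: order_weight_eq_prod len)
  qed
  \<comment> \<open>Each entry, with or without tilde, contributes exactly the probability of its
    letter.\<close>
  have letters: "(lb / (lb + mb)) ^ num_agents u * (mb / (lb + mb)) ^ num_goods u *
     (\<Prod>c\<in>UNIV. \<alpha> c ^ letter_count u (Agent c)) * (\<Prod>s\<in>UNIV. \<beta> s ^ letter_count u (Good s)) = weight u" for u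
  proof (induction u)
    case Nil
    then show ?case by (simp add: num_agents_def num_goods_def letter_count_def)
  next
    case (Cons e u)
    have count: "letter_count (e # u) x = (if x = letter e then Suc (letter_count u x) else letter_count u x)" for x
      by (cases e) (auto simp: letter_count_def)
    have delta: "(\<Prod>x\<in>UNIV. f x ^ (if x = b then Suc (n x) else n x)) = f b * (\<Prod>x\<in>UNIV. f x ^ n x)"
      for f :: "'x::finite \<Rightarrow> real" and n b
    proof -
      have "(\<Prod>x\<in>UNIV. f x ^ (if x = b then Suc (n x) else n x)) = (\<Prod>x\<in>UNIV. (if x = b then f b else 1) * f x ^ n x)"
        by (intro prod.cong) auto
      then show ?thesis by (simp add: prod.distrib)
    qed
    have num: "num_agents (e # u) = num_agents u + (case letter e of Agent c \<Rightarrow> 1 | Good s \<Rightarrow> 0)"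
      "num_goods (e # u) = num_goods u + (case letter e of Agent c \<Rightarrow> 0 | Good s \<Rightarrow> 1)"
      by (cases e; cases "letter e"; simp add: num_agents_def num_goods_def)+
    show ?case
    proof (cases "letter e")
      case (Agent c)
      then show ?thesis by (simp add: num count delta pmf_p Cons.IH[symmetric])
    next
      case (Good s)
      then show ?thesis by (simp add: num count delta pmf_p Cons.IH[symmetric])
    qed
  qed
  have form: "product_form G lb mb \<alpha> \<beta> u = weight u / total_weight" for u
    unfolding product_form_def norm letters[of u, symmetric] divide_inverse[of _ total_weight]
    by (simp only: mult_ac)
  obtain \<pi> where \<pi>: "\<And>u. pmf \<pi> u = W_prob u" using exists_stationary_W by blast
  show ?thesis
  proof (intro exI conjI allI impI)
    show "stationary_distribution_of_chain M (U_process G z) stationary_U"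
      by (rule stationary_distribution_U[OF Z dZ])
    show "stationary_distribution_of_chain M (W_process G z) \<pi>"
      by (rule stationary_distribution_W[OF Z dZ \<pi>])
    show "pmf stationary_U u = product_form G lb mb \<alpha> \<beta> u" if "0 < pmf stationary_U u" for u
      using that by (cases "admissible u") (simp_all add: pmf_stationary_U form)
    show "pmf \<pi> u = product_form G lb mb \<alpha> \<beta> u" if "0 < pmf \<pi> u" for u
      using that W_prob_cases[of u] by (auto simp: \<pi> form)
  qed
qed

end
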